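(* Let $B$ be a standard Brownian motion started at $0$, $t>0$ and $\varepsilon>0$. Then $\mathbb{E}[N_t^\varepsilon]$ admits the following series representations, which converge well for large and small $\varepsilon$ respectively: $$\mathbb{E}[N_t^\varepsilon]=4\sum_{k\ge1}\left[(2k-1)\,\mathrm{erfc}\!\left(\frac{(2k-1)\varepsilon}{\sqrt{2t}}\right)-k\,\mathrm{erfc}\!\left(\frac{2k\varepsilon}{\sqrt{2t}}\right)\right]$$ $$=\frac t{2\varepsilon^2}+\frac23+2\sum_{k\ge1}\bigl(2(-1)^k-1\bigr)\frac{t\,e^{-\pi^2k^2t/(2\varepsilon^2)}}{\varepsilon^2}\left[1+\frac{\varepsilon^2}{\pi^2k^2t}\right].$$
   Context: For $\varepsilon>0$, put $S_0^\varepsilon=T_0^\varepsilon=0$ and $T_{i+1}^\varepsilon=\inf\{u\ge S_i^\varepsilon:\sup_{[S_i^\varepsilon,u]}B-B_u>\varepsilon\}$, $S_{i+1}^\varepsilon=\inf\{u\ge T_{i+1}^\varepsilon:B_u-\inf_{[T_{i+1}^\varepsilon,u]}B>\varepsilon\}$. With $R_t=\sup_{[0,t]}B-\inf_{[0,t]}B$, $N_t^\varepsilon=\mathbf{1}_{\{R_t\ge\varepsilon\}}+\max\{k\ge0:S_k^\varepsilon\le t\}$ is the number of bars of length $\ge\varepsilon$ in the $H_0$ superlevel-set barcode of $B|_{[0,t]}$ (infinite bar given length $R_t$). $\mathrm{erfc}(x)=\frac{2}{\sqrt\pi}\int_x^\infty e^{-u^2}du$. *)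

theory Defs
  imports "HOL-Probability.Probability"
begin

definition erfc :: "real \<Rightarrow> real" where
  "erfc x = 2 / sqrt pi * (LINT u:{x..}|lborel. exp (- (u\<^sup>2)))"

text \<open>
  Time is indexed by \<^typ>\<open>real\<close>, but only nonnegative times are constrained. Every path
  (not merely almost every one) is continuous and starts at 0.
\<close>

locale standard_brownian_motion = prob_space M
  for M :: "'a measure" +
  fixes B :: "real \<Rightarrow> 'a \<Rightarrow> real"
  assumes measurable_B: "\<And>s. 0 \<le> s \<Longrightarrow> B s \<in> borel_measurable M"
    and B_zero: "\<And>\<omega>. \<omega> \<in> space M \<Longrightarrow> B 0 \<omega> = 0"
    and continuous_paths: "\<And>\<omega>. \<omega> \<in> space M \<Longrightarrow> continuous_on {0..} (\<lambda>s. B s \<omega>)"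
    and gaussian_increments: "\<And>r s. 0 \<le> r \<Longrightarrow> r < s \<Longrightarrow>
      distributed M lborel (\<lambda>\<omega>. B s \<omega> - B r \<omega>) (normal_density 0 (sqrt (s - r)))"
    and independent_increments: "\<And>\<tau> n. 0 \<le> \<tau> 0 \<Longrightarrow> (\<forall>i<n. \<tau> i \<le> \<tau> (Suc i)) \<Longrightarrow>
      indep_vars (\<lambda>_. borel) (\<lambda>i \<omega>. B (\<tau> (Suc i)) \<omega> - B (\<tau> i) \<omega>) {..<n}"

text \<open>
  The following are defined for a single path \<open>b\<close>. Times take values in \<^typ>\<open>ereal\<close> so that
  the infimum of the empty set is \<open>\<infinity>\<close>; after an infinite time, all later times are infinite.
\<close>

definition drawdown_time :: "(real \<Rightarrow> real) \<Rightarrow> real \<Rightarrow> ereal \<Rightarrow> ereal" where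
  "drawdown_time b \<epsilon> s =
     (INF u\<in>{u::real. s \<le> ereal u \<and> (SUP v\<in>{v. s \<le> ereal v \<and> v \<le> u}. b v) - b u > \<epsilon>}. ereal u)"

definition drawup_time :: "(real \<Rightarrow> real) \<Rightarrow> real \<Rightarrow> ereal \<Rightarrow> ereal" where
  "drawup_time b \<epsilon> s =
     (INF u\<in>{u::real. s \<le> ereal u \<and> b u - (INF v\<in>{v. s \<le> ereal v \<and> v \<le> u}. b v) > \<epsilon>}. ereal u)"

fun S_time T_time :: "(real \<Rightarrow> real) \<Rightarrow> real \<Rightarrow> nat \<Rightarrow> ereal" where
  "S_time b \<epsilon> 0 = 0"
| "T_time b \<epsilon> 0 = 0"
| "T_time b \<epsilon> (Suc i) = drawdown_time b \<epsilon> (S_time b \<epsilon> i)"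
| "S_time b \<epsilon> (Suc i) = drawup_time b \<epsilon> (T_time b \<epsilon> (Suc i))"

definition path_range :: "(real \<Rightarrow> real) \<Rightarrow> real \<Rightarrow> real" where
  "path_range b t = (SUP s\<in>{0..t}. b s) - (INF s\<in>{0..t}. b s)"

text \<open>For a path continuous on the nonnegative half-line, the set under \<^const>\<open>Max\<close> is finite, and
  it contains 0 when \<open>t \<ge> 0\<close>.\<close>

definition bar_count :: "(real \<Rightarrow> real) \<Rightarrow> real \<Rightarrow> real \<Rightarrow> nat" where
  "bar_count b \<epsilon> t =
     (if path_range b t \<ge> \<epsilon> then 1 else 0) + Max {k. S_time b \<epsilon> k \<le> ereal t}"

definition large_eps_term :: "real \<Rightarrow> real \<Rightarrow> nat \<Rightarrow> real" where
  "large_eps_term \<epsilon> t k =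
     (2 * real k - 1) * erfc ((2 * real k - 1) * \<epsilon> / sqrt (2 * t))
     - real k * erfc (2 * real k * \<epsilon> / sqrt (2 * t))"

definition small_eps_term :: "real \<Rightarrow> real \<Rightarrow> nat \<Rightarrow> real" where
  "small_eps_term \<epsilon> t k =
     (2 * (-1) ^ k - 1) * (t * exp (- (pi\<^sup>2 * (real k)\<^sup>2 * t / (2 * \<epsilon>\<^sup>2))) / \<epsilon>\<^sup>2)
     * (1 + \<epsilon>\<^sup>2 / (pi\<^sup>2 * (real k)\<^sup>2 * t))"

end

theory Submission
  imports Defs "HOL-Real_Asymp.Real_Asymp"
begin

text \<open>
  The \<open>S\<close> and \<open>T\<close> times are the successive switching times of a process that alternates between
  a drawdown phase and a drawup phase. Sampling the path on a grid gives a Markov chain driven by a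
  Gaussian walk, and the count for the path is squeezed between the grid counts for the thresholds
  \<open>\<epsilon>\<close> and \<open>\<epsilon>' < \<epsilon>\<close>. Starting the chain in either phase, the two copies merge, in opposite phases,
  exactly when the range exceeds the threshold; by symmetry of the walk the range indicator therefore
  has the expectation of twice the indicator of an odd number of switches.

  If \<open>f\<close> is even and smooth with \<open>f (y + 2) + f (y - 2) = 2 * f y + 4\<close>, then folding a Brownian
  motion \<open>W\<close> turns \<open>E f(W)\<close> into an approximate martingale for the chain, with errors controlled by a
  Lyapunov function. Hence the expected count is \<open>E q(B / \<epsilon>)\<close> for an explicit step function \<open>q\<close>, the
  limit of Abel means of a trigonometric series. The jumps of \<open>q\<close> give the series of complementary
  error functions, the trigonometric series gives the other one.
\<close>

subsection \<open>The alternating chain\<close>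

text \<open>The recurrence comes from the folding. In an odd phase the fold sits at height 1, so the
  value is the mean of f at 1 + x and 1 - x. It equals f 1 at x = 0, where an even phase hands over.
  At the end of an odd phase, where one bar is gained, continuity asks for (f 2 + f 0) / 2 = f 0 +
  1, that is f 2 + f (-2) = 2 f 0 + 4. Asking this at every y makes the condition stable under
  Gaussian averaging. The final payoff is 0 in even phases and 2 in odd ones, the 2 coming from the
  range indicator. Matching it forces q = 0 on [0, 1) and q = 4 on (1, 2); the recurrence gives the
  rest. The obstacle is that this q jumps at the switching threshold, while the one-step errors are
  controlled through second differences. So q is replaced by smooth Abel means with the same
  symmetry and recurrence, and the final error near the threshold is charged to a periodic bump.
  Radius and bump are fixed before the grid is refined, so constants may blow up as the radius tends
  to 1.\<close>

text \<open>A state \<open>(k, x)\<close> records the number \<open>k\<close> of switches and the distance \<open>x\<close> from the running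
  extremum of the current phase: the maximum if \<open>k\<close> is even, the minimum if \<open>k\<close> is odd. The switching
  threshold is 1.\<close>

definition chain_step :: "nat \<times> real \<Rightarrow> real \<Rightarrow> nat \<times> real" where
  "chain_step s z =
     (let y = snd s + (if even (fst s) then - z else z)
      in if y > 1 then (Suc (fst s), 0) else (fst s, max y 0))"

primrec chain :: "(nat \<Rightarrow> real) \<Rightarrow> nat \<Rightarrow> nat \<times> real" where
  "chain z 0 = (0, 0)"
| "chain z (Suc j) = chain_step (chain z j) (z j)"

lemma snd_chain_bounds: "0 \<le> snd (chain z j)" "snd (chain z j) \<le> 1"
  by (induction j) (auto simp: chain_step_def Let_def)

lemma fst_chain_Suc:
  "fst (chain z j) \<le> fst (chain z (Suc j))" "fst (chain z (Suc j)) \<le> Suc (fst (chain z j))"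
  by (auto simp: chain_step_def Let_def)

lemma fst_chain_mono: "i \<le> j \<Longrightarrow> fst (chain z i) \<le> fst (chain z j)"
  by (rule lift_Suc_mono_le[of "\<lambda>j. fst (chain z j)"]) (simp_all only: fst_chain_Suc(1))

lemma fst_chain_le: "fst (chain z j) \<le> j"
  by (induction j) (use fst_chain_Suc(2) in \<open>auto intro: order_trans\<close>)

text \<open>Once the range exceeds the threshold, the chains of a path and of its reflection
  share their second component and are in opposite phases; before that, neither has moved.\<close>

lemma chain_range_aux:
  fixes z s :: "nat \<Rightarrow> real"
  assumes s: "\<And>j. j < n \<Longrightarrow> s (Suc j) = s j + z j" and "j \<le> n"
  defines "A \<equiv> chain z" and "A' \<equiv> chain (\<lambda>i. - z i)"
  shows "fst (A j) = 0 \<and> fst (A' j) = 0 \<and> snd (A j) + snd (A' j) \<le> 1 \<and>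
       (\<forall>i\<le>j. s i \<le> s j + snd (A j)) \<and> (\<exists>i\<le>j. s i = s j + snd (A j)) \<and>
       (\<forall>i\<le>j. s i \<ge> s j - snd (A' j)) \<and> (\<exists>i\<le>j. s i = s j - snd (A' j))
     \<or> (\<exists>i\<le>j. \<exists>l\<le>j. s i - s l > 1) \<and> odd (fst (A j) + fst (A' j)) \<and> snd (A j) = snd (A' j)"
    (is "?P j \<or> ?Q j")
  using \<open>j \<le> n\<close>
proof (induction j)
  case 0
  then show ?case by (auto simp: A_def A'_def)
next
  case (Suc j)
  define x x' where "x = snd (A j)" and "x' = snd (A' j)"
  have sj: "s (Suc j) = s j + z j" using s Suc by auto
  have b: "0 \<le> x" "x \<le> 1" "0 \<le> x'" "x' \<le> 1"
    by (simp_all add: x_def x'_def A_def A'_def snd_chain_bounds)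
  have AS: "A (Suc j) = chain_step (A j) (z j)" "A' (Suc j) = chain_step (A' j) (- z j)"
    by (simp_all add: A_def A'_def)
  consider "?P j" | "?Q j" using Suc by auto
  then show ?case
  proof cases
    case 1
    then have k: "fst (A j) = 0" "fst (A' j) = 0" and xx: "x + x' \<le> 1"
      and hi: "\<And>i. i \<le> j \<Longrightarrow> s i \<le> s j + x" and lo: "\<And>i. i \<le> j \<Longrightarrow> s i \<ge> s j - x'"
      by (auto simp: x_def x'_def)
    from 1 obtain i1 i2 where i: "i1 \<le> j" "s i1 = s j + x" "i2 \<le> j" "s i2 = s j - x'"
      by (auto simp: x_def x'_def)
    consider "x - z j > 1" | "x' + z j > 1" | "x - z j \<le> 1" "x' + z j \<le> 1" by linarith
    then show ?thesis
    proof cases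
      case 1
      \<comment> \<open>Since \<open>x + x' \<le> 1\<close>, the overshoot
        \<open>x - z j > 1\<close> forces \<open>x' + z j < 0\<close>: the reflected chain is
        clamped at 0 in the very step in which this one switches, so both levels become 0.\<close>
      then have "A (Suc j) = (1, 0)" "A' (Suc j) = (0, 0)"
        using k xx by (auto simp: AS chain_step_def Let_def x_def x'_def)
      moreover have "s i1 - s (Suc j) > 1" using i 1 sj by auto
      then have "\<exists>i\<le>Suc j. \<exists>l\<le>Suc j. s i - s l > 1" using i(1) le_SucI by blast
      ultimately show ?thesis by (intro disjI2 conjI) simp_all
    next
      case 2
      then have "A (Suc j) = (0, 0)" "A' (Suc j) = (1, 0)"
        using k xx by (auto simp: AS chain_step_def Let_def x_def x'_def)
      moreover have "s (Suc j) - s i2 > 1" using i 2 sj by auto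
      then have "\<exists>i\<le>Suc j. \<exists>l\<le>Suc j. s i - s l > 1" using i(3) le_SucI by blast
      ultimately show ?thesis by (intro disjI2 conjI) simp_all
    next
      case 3
      then have E: "A (Suc j) = (0, max (x - z j) 0)" "A' (Suc j) = (0, max (x' + z j) 0)"
        using k by (auto simp: AS chain_step_def Let_def x_def x'_def)
      have "s i \<le> s (Suc j) + max (x - z j) 0" if "i \<le> Suc j" for i
        using hi[of i] that sj by (cases "i = Suc j") auto
      moreover have "s i \<ge> s (Suc j) - max (x' + z j) 0" if "i \<le> Suc j" for i
        using lo[of i] that sj by (cases "i = Suc j") auto
      moreover have "\<exists>i\<le>Suc j. s i = s (Suc j) + max (x - z j) 0"
      proof (cases "x - z j \<ge> 0")
        case True then show ?thesis using i sj by (intro exI[of _ i1]) auto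
      next
        case False then show ?thesis by (intro exI[of _ "Suc j"]) auto
      qed
      moreover have "\<exists>i\<le>Suc j. s i = s (Suc j) - max (x' + z j) 0"
      proof (cases "x' + z j \<ge> 0")
        case True then show ?thesis using i sj by (intro exI[of _ i2]) auto
      next
        case False then show ?thesis by (intro exI[of _ "Suc j"]) auto
      qed
      moreover have "max (x - z j) 0 + max (x' + z j) 0 \<le> 1" using 3 xx by auto
      ultimately show ?thesis unfolding E fst_conv snd_conv by blast
    qed
  next
    case 2
    then obtain i l where "i \<le> j" "l \<le> j" "s i - s l > 1" by auto
    then have "\<exists>i\<le>Suc j. \<exists>l\<le>Suc j. s i - s l > 1"
      using le_SucI by blast
    \<comment> \<open>In opposite phases the opposite signs of the increments cancel, so both chains
      make the same move from the same level and switch together.\<close>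
    moreover have "odd (fst (A (Suc j)) + fst (A' (Suc j))) \<and> snd (A (Suc j)) = snd (A' (Suc j))"
      using 2 by (cases "even (fst (A j))") (auto simp: AS chain_step_def Let_def)
    ultimately show ?thesis by blast
  qed
qed

lemma chain_range:
  fixes z s :: "nat \<Rightarrow> real"
  assumes "\<And>j. j < n \<Longrightarrow> s (Suc j) = s j + z j"
  shows "(of_bool (\<exists>i\<le>n. \<exists>l\<le>n. s i - s l > 1) :: real) =
     of_bool (odd (fst (chain z n))) + of_bool (odd (fst (chain (\<lambda>i. - z i) n)))"
proof -
  let ?A = "chain z" and ?A' = "chain (\<lambda>i. - z i)"
  consider "fst (?A n) = 0" "fst (?A' n) = 0" "\<not> (\<exists>i\<le>n. \<exists>l\<le>n. s i - s l > 1)"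
    | "\<exists>i\<le>n. \<exists>l\<le>n. s i - s l > 1" "odd (fst (?A n) + fst (?A' n))"
  proof -
    have "(fst (?A n) = 0 \<and> fst (?A' n) = 0 \<and> snd (?A n) + snd (?A' n) \<le> 1 \<and>
         (\<forall>i\<le>n. s i \<le> s n + snd (?A n)) \<and> (\<exists>i\<le>n. s i = s n + snd (?A n)) \<and>
         (\<forall>i\<le>n. s i \<ge> s n - snd (?A' n)) \<and> (\<exists>i\<le>n. s i = s n - snd (?A' n)))
       \<or> ((\<exists>i\<le>n. \<exists>l\<le>n. s i - s l > 1) \<and> odd (fst (?A n) + fst (?A' n)) \<and> snd (?A n) = snd (?A' n))"
      by (rule chain_range_aux[where n = n]) (simp_all add: assms)
    then show ?thesis
    proof (elim disjE conjE)
      assume 1: "fst (?A n) = 0" "fst (?A' n) = 0" "snd (?A n) + snd (?A' n) \<le> 1"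
        "\<forall>i\<le>n. s i \<le> s n + snd (?A n)" "\<forall>i\<le>n. s i \<ge> s n - snd (?A' n)"
      have "\<not> s i - s l > 1" if "i \<le> n" "l \<le> n" for i l
      proof -
        have "s i \<le> s n + snd (?A n)" "s l \<ge> s n - snd (?A' n)" using 1 that by auto
        then show ?thesis using 1 by linarith
      qed
      then have "\<not> (\<exists>i\<le>n. \<exists>l\<le>n. s i - s l > 1)" by blast
      then show ?thesis using 1(1,2) that(1) by metis
    next
      assume "\<exists>i\<le>n. \<exists>l\<le>n. s i - s l > 1" "odd (fst (?A n) + fst (?A' n))"
      then show ?thesis by (rule that(2))
    qed
  qed
  then show ?thesis by cases auto
qed

text \<open>Clamping at 0 only raises the level, so within one phase the level dominates the signed
  drop since any earlier time of that phase. As levels are at most 1, a sampled drop above 1 forces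
  a switch.\<close>

lemma chain_lower:
  fixes z s :: "nat \<Rightarrow> real"
  assumes s: "\<And>j. j < n \<Longrightarrow> s (Suc j) = s j + z j"
    and "i \<le> j" "j \<le> n" "fst (chain z i) = k" "fst (chain z j) = k"
  shows "(-1) ^ k * (s i - s j) \<le> snd (chain z j)"
  using \<open>i \<le> j\<close> \<open>j \<le> n\<close> \<open>fst (chain z j) = k\<close>
proof (induction j rule: dec_induct)
  case base
  then show ?case by (simp add: snd_chain_bounds)
next
  case (step j)
  have "k \<le> fst (chain z j)" using fst_chain_mono[OF step(1)] assms(4) by metis
  moreover have "fst (chain z j) \<le> k" using fst_chain_Suc(1)[of z j] step.prems(2) by simp
  ultimately have k: "fst (chain z j) = k" by simp
  have IH: "(-1) ^ k * (s i - s j) \<le> snd (chain z j)" using step k by auto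
  have "snd (chain z (Suc j)) \<ge> snd (chain z j) + (if even k then - z j else z j)"
    using step.prems(2) k by (auto simp: chain_step_def Let_def split: if_splits)
  moreover have "s (Suc j) = s j + z j" using s step by auto
  ultimately show ?case using IH by (auto simp: algebra_simps split: if_splits)
qed

subsection \<open>Switching times of a path\<close>

text \<open>Interleaves both families of times: even indices are the \<open>S\<close> times, odd
  ones the \<open>T\<close> times. The sign turns drawups into drawdowns of the reflected path, so
  one set of lemmas serves both phases.\<close>

primrec switch_time :: "(real \<Rightarrow> real) \<Rightarrow> real \<Rightarrow> nat \<Rightarrow> ereal" where
  "switch_time b \<epsilon> 0 = 0"
| "switch_time b \<epsilon> (Suc k) = drawdown_time (\<lambda>u. (-1) ^ k * b u) \<epsilon> (switch_time b \<epsilon> k)"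

lemma drawup_time_eq: "drawup_time b \<epsilon> s = drawdown_time (\<lambda>u. - b u) \<epsilon> s"
  unfolding drawup_time_def drawdown_time_def by (simp add: Inf_real_def image_image add.commute)

lemma S_time_eq_switch_time: "S_time b \<epsilon> k = switch_time b \<epsilon> (2 * k)"
  by (induction k) (simp_all add: drawup_time_eq)

lemma le_drawdown_time: "s \<le> drawdown_time b \<epsilon> s"
  unfolding drawdown_time_def by (rule INF_greatest) auto

lemma switch_time_mono: "i \<le> j \<Longrightarrow> switch_time b \<epsilon> i \<le> switch_time b \<epsilon> j"
  by (rule lift_Suc_mono_le[of "switch_time b \<epsilon>"]) (auto intro: le_drawdown_time)

lemma switch_time_nonneg: "0 \<le> switch_time b \<epsilon> j"
  using switch_time_mono[of 0 j] by simp

lemma ereal_window: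
  "{v. ereal s \<le> ereal v \<and> v \<le> u} = {s..u}" "{v. s \<le> v \<and> v \<le> u} = {s..u}"
  by auto

lemma drawdown_time_le:
  assumes b: "continuous_on {0..} b" and "0 \<le> s" "s \<le> ereal a" "a \<le> u" "b a - b u > \<epsilon>"
  shows "drawdown_time b \<epsilon> s \<le> ereal u"
proof -
  obtain r where s: "s = ereal r" using assms by (cases s) auto
  have "compact (b ` {r..u})" using assms s
    by (intro compact_continuous_image continuous_on_subset[OF b]) auto
  then have "bdd_above (b ` {r..u})" by (simp add: bounded_imp_bdd_above compact_imp_bounded)
  then have "b a \<le> (SUP v\<in>{r..u}. b v)" using assms s by (intro cSUP_upper) auto
  then show ?thesis unfolding drawdown_time_def using assms s
    by (intro INF_lower) (auto simp: ereal_window intro: order_trans)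
qed

text \<open>An infimum of strict crossings need not be a strict crossing; only the weak inequality
  survives at the limit. If it failed, continuity would keep the drawdown below
  \<open>\<epsilon>\<close> for a while after \<open>u\<close>, and the infimum would be
  larger.\<close>

lemma drawdown_time_attained:
  assumes b: "continuous_on {0..} b" and "0 \<le> s" and u: "drawdown_time b \<epsilon> (ereal s) = ereal u"
  shows "\<exists>a\<in>{s..u}. b a - b u \<ge> \<epsilon>"
proof (rule ccontr)
  assume "\<not> ?thesis"
  then have c: "\<And>a. a \<in> {s..u} \<Longrightarrow> b a - b u < \<epsilon>" by force
  have su: "s \<le> u" using le_drawdown_time[of "ereal s" b \<epsilon>] u by simp
  obtain m where m: "m \<in> {s..u}" "\<And>y. y \<in> {s..u} \<Longrightarrow> b y \<le> b m"
    using continuous_attains_sup[of "{s..u}" b] su continuous_on_subset[OF b, of "{s..u}"] assms by auto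
  \<comment> \<open>A third of the gap: within distance \<open>d\<close> after \<open>u\<close> the
    running maximum rises by at most \<open>g\<close> and the path falls by less than
    \<open>g\<close>, which still leaves a slack of \<open>g\<close>.\<close>
  define g where "g = (\<epsilon> - (b m - b u)) / 3"
  have g: "g > 0" using c[OF m(1)] by (simp add: g_def)
  obtain d where d: "d > 0" "\<And>w. w \<ge> 0 \<Longrightarrow> \<bar>w - u\<bar> < d \<Longrightarrow> \<bar>b w - b u\<bar> < g"
    using b g su assms unfolding continuous_on_iff dist_real_def by (metis atLeast_iff order_trans)
  have mu: "b m \<ge> b u" using m su by auto
  have "ereal (u + d) \<le> drawdown_time b \<epsilon> (ereal s)"
    unfolding drawdown_time_def ereal_window
  proof (rule INF_greatest, clarsimp)
    fix w assume w: "s \<le> w" "\<epsilon> < Sup (b ` {s..w}) - b w"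
    have wu: "u \<le> w"
    proof (rule ccontr)
      assume "\<not> u \<le> w"
      then have "drawdown_time b \<epsilon> (ereal s) \<le> ereal w"
        unfolding drawdown_time_def ereal_window using w by (intro INF_lower) auto
      then show False using u \<open>\<not> u \<le> w\<close> by simp
    qed
    show "u + d \<le> w"
    proof (rule ccontr)
      assume "\<not> u + d \<le> w"
      then have n: "\<bar>b v - b u\<bar> < g" if "v \<in> {u..w}" for v using d(2)[of v] that su assms by auto
      have "b v \<le> b m + g" if "v \<in> {s..w}" for v
        using m(2)[of v] n[of v] that g mu by (cases "v \<le> u") auto
      then have "Sup (b ` {s..w}) \<le> b m + g" using w by (intro cSUP_least) auto
      moreover have "b u - b w < g" using n[of w] wu by auto
      ultimately show False using w(2) g by (simp add: g_def field_simps)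
    qed
  qed
  then show False using u d by simp
qed

text \<open>Serves measurability: the strict condition is open, so the two times can be moved to
  nearby rationals.\<close>

lemma drawdown_time_less_iff:
  assumes b: "continuous_on {0..} b" and s: "0 \<le> s" and "\<epsilon> > 0"
  shows "drawdown_time b \<epsilon> s < ereal q \<longleftrightarrow>
     (\<exists>v\<in>\<rat>. \<exists>u\<in>\<rat>. s < ereal v \<and> v < u \<and> u < q \<and> b v - b u > \<epsilon>)" (is "?L = ?R")
proof
  assume ?R
  then obtain v u where "s < ereal v" "v < u" "u < q" "b v - b u > \<epsilon>" by auto
  then have "drawdown_time b \<epsilon> s \<le> ereal u" using assms by (intro drawdown_time_le[of _ _ v]) auto
  then show ?L using \<open>u < q\<close> by (meson less_ereal.simps(1) order_le_less_trans)
next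
  assume ?L
  then obtain u where u: "s \<le> ereal u" "u < q"
    and d: "(SUP v\<in>{v. s \<le> ereal v \<and> v \<le> u}. b v) - b u > \<epsilon>"
    unfolding drawdown_time_def by (auto simp: INF_less_iff)
  obtain r where r: "s = ereal r" using u s by (cases s) auto
  have "r \<le> u" "0 \<le> r" using u s r by auto
  have "b u + \<epsilon> < (SUP v\<in>{r..u}. b v)" using d by (simp add: r ereal_window)
  then obtain v where v: "v \<in> {r..u}" "b u + \<epsilon> < b v"
    by (rule less_cSupE[of _ "b ` {r..u}"]) (use \<open>r \<le> u\<close> in auto)
  have "v \<noteq> u" using v assms by auto
  then have "v < u" using v by auto
  define g where "g = (b v - b u - \<epsilon>) / 2"
  have g: "g > 0" using v by (simp add: g_def)
  have vu0: "0 \<le> v" "0 \<le> u" using v \<open>0 \<le> r\<close> by auto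
  obtain d1 where d1: "d1 > 0" "\<And>w. w \<ge> 0 \<Longrightarrow> \<bar>w - v\<bar> < d1 \<Longrightarrow> \<bar>b w - b v\<bar> < g"
    using b g vu0 unfolding continuous_on_iff dist_real_def by (metis atLeast_iff)
  obtain d2 where d2: "d2 > 0" "\<And>w. w \<ge> 0 \<Longrightarrow> \<bar>w - u\<bar> < d2 \<Longrightarrow> \<bar>b w - b u\<bar> < g"
    using b g vu0 unfolding continuous_on_iff dist_real_def by (metis atLeast_iff)
  \<comment> \<open>Both times move to the right. For \<open>v\<close> this yields the strict
    \<open>s < v'\<close> even if \<open>v = s\<close>; for \<open>u\<close> there is room because
    \<open>u < q\<close>.\<close>
  obtain v' where v': "v' \<in> \<rat>" "v < v'" "v' < min u (v + d1)"
    using Rats_dense_in_real[of v "min u (v + d1)"] d1 \<open>v < u\<close> by auto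
  obtain u' where u': "u' \<in> \<rat>" "u < u'" "u' < min q (u + d2)"
    using Rats_dense_in_real[of u "min q (u + d2)"] d2 \<open>u < q\<close> by auto
  have "\<bar>b v' - b v\<bar> < g" using d1(2)[of v'] v' vu0 by auto
  moreover have "\<bar>b u' - b u\<bar> < g" using d2(2)[of u'] u' vu0 by auto
  ultimately have "b v' - b u' > \<epsilon>" unfolding g_def abs_less_iff by argo
  moreover have "s < ereal v'" using r v v' by auto
  ultimately show ?R using v' u' by (intro bexI[of _ v'] bexI[of _ u']) auto
qed

lemma continuous_on_signed:
  "continuous_on A b \<Longrightarrow> continuous_on A (\<lambda>u. (-1::real) ^ k * b u)"
  by (intro continuous_intros)

section \<open>Sampling a path on a grid\<close>

definition grid_incr :: "(real \<Rightarrow> real) \<Rightarrow> real \<Rightarrow> real \<Rightarrow> nat \<Rightarrow> nat \<Rightarrow> real" where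
  "grid_incr b t \<epsilon> n j = (b (t * real (Suc j) / real n) - b (t * real j / real n)) / \<epsilon>"

lemma grid_incr_Suc:
  "b (t * real (Suc j) / real n) / \<epsilon> = b (t * real j / real n) / \<epsilon> + grid_incr b t \<epsilon> n j"
  by (simp add: grid_incr_def diff_divide_distrib)

text \<open>A swing seen on the grid is a swing of the path, so the chain never switches ahead of
  the path. The witness \<open>i\<close> is the grid index of the extremum from which the current
  level is measured; it restarts at each switch and each clamping.\<close>

lemma switch_time_chain_le:
  fixes n :: nat
  assumes b: "continuous_on {0..} b" and "0 \<le> t" "0 < \<epsilon>"
  defines "c \<equiv> chain (grid_incr b t \<epsilon> n)"
  shows "\<exists>i\<le>j. switch_time b \<epsilon> (fst (c j)) \<le> ereal (t * real i / real n) \<and>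
     snd (c j) = (-1) ^ fst (c j) * (b (t * real i / real n) - b (t * real j / real n)) / \<epsilon>"
proof (induction j)
  case 0
  then show ?case by (simp add: c_def)
next
  case (Suc j)
  let ?g = "\<lambda>j. t * real j / real n"
  obtain k x where kx: "c j = (k, x)" by (cases "c j")
  obtain i where i: "i \<le> j" "switch_time b \<epsilon> k \<le> ereal (?g i)"
    "x = (-1) ^ k * (b (?g i) - b (?g j)) / \<epsilon>"
    using Suc kx by auto
  define y where "y = (-1) ^ k * (b (?g i) - b (?g (Suc j))) / \<epsilon>"
  have mono: "?g i \<le> ?g (Suc j)"
    using i(1) assms by (intro divide_right_mono mult_left_mono) auto
  have step: "c (Suc j) = (if y > 1 then (Suc k, 0) else (k, max y 0))"
  proof -
    have "y = x + (if even k then - grid_incr b t \<epsilon> n j else grid_incr b t \<epsilon> n j)"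
      by (simp add: y_def i(3) grid_incr_def diff_divide_distrib algebra_simps)
    then show ?thesis using kx by (simp add: c_def chain_step_def)
  qed
  consider "y > 1" | "y < 0" | "0 \<le> y" "y \<le> 1" by linarith
  then show ?case
  proof cases
    case 1
    have "(-1) ^ k * b (?g i) - (-1) ^ k * b (?g (Suc j)) > \<epsilon>"
      using 1 assms by (simp add: y_def field_simps)
    then have "switch_time b \<epsilon> (Suc k) \<le> ereal (?g (Suc j))"
      unfolding switch_time.simps
      by (intro drawdown_time_le[of _ _ "?g i"] continuous_on_signed b switch_time_nonneg i mono)
    then show ?thesis using 1 by (intro exI[of _ "Suc j"]) (simp add: step)
  next
    case 2
    have "switch_time b \<epsilon> k \<le> ereal (?g (Suc j))" using i(2) mono by (meson ereal_less_eq(3) order_trans)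
    then show ?thesis using 2 by (intro exI[of _ "Suc j"]) (simp add: step)
  next
    case 3
    then show ?thesis using i by (intro exI[of _ i]) (simp add: step y_def)
  qed
qed

text \<open>The converse comparison costs a little of the threshold: on a grid finer than the
  modulus of uniform continuity, every swing of size \<open>\<epsilon>\<close> still shows as a
  sampled swing above \<open>\<epsilon>'\<close>. The mesh depends on the path.\<close>

lemma switch_time_le_chain:
  assumes b: "continuous_on {0..} b" and "0 < t" "0 < \<epsilon>'" "\<epsilon>' < \<epsilon>"
  shows "\<exists>n0>0. \<forall>n\<ge>n0. (\<forall>K. switch_time b \<epsilon> K \<le> ereal t \<longrightarrow>
      K \<le> fst (chain (grid_incr b t \<epsilon>' n) n)) \<and>
    (path_range b t \<ge> \<epsilon> \<longrightarrow> (\<exists>i\<le>n. \<exists>l\<le>n.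
      b (t * real i / real n) / \<epsilon>' - b (t * real l / real n) / \<epsilon>' > 1))"
proof -
  have cb: "continuous_on {0..t} b" using b by (rule continuous_on_subset) auto
  then have "uniformly_continuous_on {0..t} b" by (simp add: compact_uniformly_continuous)
  moreover have "(\<epsilon> - \<epsilon>') / 2 > 0" using assms by simp
  ultimately obtain d where d: "d > 0"
    "\<And>x y. x \<in> {0..t} \<Longrightarrow> y \<in> {0..t} \<Longrightarrow> dist y x < d \<Longrightarrow> dist (b y) (b x) < (\<epsilon> - \<epsilon>') / 2"
    unfolding uniformly_continuous_on_def by meson
  obtain n0 where n0: "real n0 > t / d" using reals_Archimedean2 by blast
  have "n0 > 0" using n0 assms d by (metis divide_pos_pos gr0I of_nat_0 order_less_asym)
  moreover {
    fix n assume n: "n \<ge> n0"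
    then have npos: "n > 0" using \<open>n0 > 0\<close> by simp
    let ?g = "\<lambda>j. t * real j / real n" and ?z = "grid_incr b t \<epsilon>' n"
    \<comment> \<open>The index of the last grid point not after \<open>x\<close>.\<close>
    define r where "r x = nat \<lfloor>x * real n / t\<rfloor>" for x
    have tn: "t / real n < d"
    proof -
      have "t / d < real n" using n0 n by (meson of_nat_le_iff order_less_le_trans)
      then show ?thesis using d npos by (simp add: field_simps)
    qed
    have r_le: "r x \<le> n" if "x \<in> {0..t}" for x
    proof -
      have "x * real n / t \<le> real n" using that assms by (simp add: field_simps mult_right_mono)
      then show ?thesis unfolding r_def by (metis floor_mono floor_of_nat nat_int nat_mono)
    qed
    have r_mono: "r x \<le> r y" if "x \<le> y" for x y
      unfolding r_def using that assms by (intro nat_mono floor_mono divide_right_mono mult_right_mono) auto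
    have rb: "?g (r x) \<in> {0..t} \<and> \<bar>b (?g (r x)) - b x\<bar> < (\<epsilon> - \<epsilon>') / 2" if x: "x \<in> {0..t}" for x
    proof -
      have "0 \<le> x * real n / t" using x assms by auto
      then have "real (r x) \<le> x * real n / t" "x * real n / t < real (r x) + 1"
        unfolding r_def by linarith+
      then have "t * real (r x) \<le> x * real n" "x * real n < t + t * real (r x)"
        using assms by (simp_all add: field_simps)
      then have "?g (r x) \<le> x" "x < (t + t * real (r x)) / real n"
        using npos by (simp_all add: pos_less_divide_eq pos_divide_le_eq)
      then have "?g (r x) \<le> x" "x - t / real n < ?g (r x)"
        by (simp_all add: add_divide_distrib)
      moreover from this have "?g (r x) \<in> {0..t}" using x assms by auto
      ultimately show ?thesis using d(2)[of x "?g (r x)"] x tn by (auto simp: dist_real_def)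
    qed
    \<comment> \<open>Each endpoint value changes by less than half of
      \<open>\<epsilon> - \<epsilon>'\<close> under rounding, so the drop remains above
      \<open>\<epsilon>'\<close>.\<close>
    have big: "(-1) ^ k * (b (?g (r x)) / \<epsilon>' - b (?g (r y)) / \<epsilon>') > 1"
      if "x \<in> {0..t}" "y \<in> {0..t}" "(-1) ^ k * b x - (-1) ^ k * b y \<ge> \<epsilon>" for x y and k :: nat
    proof -
      have "(-1) ^ k * (b (?g (r x)) - b (?g (r y))) > \<epsilon>'"
      proof -
        define h where "h = (\<epsilon> - \<epsilon>') / 2"
        have h: "2 * h = \<epsilon> - \<epsilon>'" by (simp add: h_def)
        have "b (?g (r x)) < b x + h" "b x - h < b (?g (r x))"
          "b (?g (r y)) < b y + h" "b y - h < b (?g (r y))"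
          using rb[OF that(1)] rb[OF that(2)] unfolding abs_less_iff h_def by linarith+
        then show ?thesis using that(3) h by (cases "even k") simp_all
      qed
      then show ?thesis using assms by (simp add: field_simps)
    qed
    have K: "\<forall>\<sigma>. switch_time b \<epsilon> K = ereal \<sigma> \<and> \<sigma> \<le> t \<longrightarrow> K \<le> fst (chain ?z (r \<sigma>))" for K
    proof (induction K)
      case (Suc K)
      show ?case
      proof (intro allI impI, elim conjE)
        fix u assume u: "switch_time b \<epsilon> (Suc K) = ereal u" "u \<le> t"
        have "switch_time b \<epsilon> K \<le> ereal u" using switch_time_mono[of K "Suc K" b \<epsilon>] u by simp
        then obtain \<sigma> where \<sigma>: "switch_time b \<epsilon> K = ereal \<sigma>" "\<sigma> \<le> u" "0 \<le> \<sigma>"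
          using switch_time_nonneg[of b \<epsilon> K] by (cases "switch_time b \<epsilon> K") auto
        obtain a where a: "a \<in> {\<sigma>..u}" "(-1) ^ K * b a - (-1) ^ K * b u \<ge> \<epsilon>"
          using drawdown_time_attained[OF continuous_on_signed[OF b], of \<sigma> K \<epsilon> u] u \<sigma> by auto
        have IH: "K \<le> fst (chain ?z (r \<sigma>))" using Suc \<sigma> u by auto
        \<comment> \<open>Otherwise the chain is in phase \<open>K\<close> at both rounded times,
          and \<open>chain_lower\<close> bounds by 1 a drop that \<open>big\<close> shows to exceed
          1.\<close>
        show "Suc K \<le> fst (chain ?z (r u))"
        proof (rule ccontr)
          assume "\<not> ?thesis"
          moreover have "r \<sigma> \<le> r a" "r a \<le> r u" using a r_mono by auto
          ultimately have k: "fst (chain ?z (r a)) = K" "fst (chain ?z (r u)) = K"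
            using IH fst_chain_mono[of "r \<sigma>" "r a" ?z] fst_chain_mono[of "r a" "r u" ?z] by auto
          have "(-1) ^ K * (b (?g (r a)) / \<epsilon>' - b (?g (r u)) / \<epsilon>') \<le> snd (chain ?z (r u))"
            using \<open>r a \<le> r u\<close> r_le[of u] u \<sigma> k
            by (intro chain_lower[where n = n and s = "\<lambda>j. b (?g j) / \<epsilon>'"] grid_incr_Suc) auto
          also have "\<dots> \<le> 1" by (rule snd_chain_bounds)
          finally show False using big[of a u K] a u \<sigma> by auto
        qed
      qed
    qed auto
    have "K \<le> fst (chain ?z n)" if Kt: "switch_time b \<epsilon> K \<le> ereal t" for K
    proof -
      obtain \<sigma> where \<sigma>: "switch_time b \<epsilon> K = ereal \<sigma>" "\<sigma> \<le> t" "0 \<le> \<sigma>"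
        using switch_time_nonneg[of b \<epsilon> K] Kt by (cases "switch_time b \<epsilon> K") auto
      have "K \<le> fst (chain ?z (r \<sigma>))" using K \<sigma> by blast
      also have "\<dots> \<le> fst (chain ?z n)" using r_le \<sigma> by (intro fst_chain_mono) auto
      finally show ?thesis .
    qed
    moreover have "\<exists>i\<le>n. \<exists>l\<le>n. b (?g i) / \<epsilon>' - b (?g l) / \<epsilon>' > 1" if R: "path_range b t \<ge> \<epsilon>"
    proof -
      obtain x where x: "x \<in> {0..t}" "\<And>y. y \<in> {0..t} \<Longrightarrow> b y \<le> b x"
        using continuous_attains_sup[OF _ _ cb] assms by auto
      obtain y where y: "y \<in> {0..t}" "\<And>w. w \<in> {0..t} \<Longrightarrow> b y \<le> b w"
        using continuous_attains_inf[OF _ _ cb] assms by auto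
      have "(SUP s\<in>{0..t}. b s) \<le> b x" using x assms by (intro cSUP_least) auto
      moreover have "(INF s\<in>{0..t}. b s) \<ge> b y" using y assms by (intro cINF_greatest) auto
      ultimately have "b x - b y \<ge> \<epsilon>" using R by (simp add: path_range_def)
      then show ?thesis using big[of x y 0] r_le x y by auto
    qed
    ultimately have "(\<forall>K. switch_time b \<epsilon> K \<le> ereal t \<longrightarrow> K \<le> fst (chain ?z n)) \<and>
      (path_range b t \<ge> \<epsilon> \<longrightarrow> (\<exists>i\<le>n. \<exists>l\<le>n. b (?g i) / \<epsilon>' - b (?g l) / \<epsilon>' > 1))" by blast }
  ultimately show ?thesis by blast
qed

text \<open>A single grid with half the threshold sees every switch up to time \<open>t\<close>, and
  an \<open>n\<close>-step chain has at most \<open>n\<close> switches. This makes the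
  \<open>Max\<close> in \<open>bar_count\<close> meaningful.\<close>

lemma finite_S_time_le:
  assumes "continuous_on {0..} b" "0 < t" "0 < \<epsilon>"
  shows "finite {k. S_time b \<epsilon> k \<le> ereal t}"
proof -
  obtain n where n: "\<And>K. switch_time b \<epsilon> K \<le> ereal t \<Longrightarrow> K \<le> fst (chain (grid_incr b t (\<epsilon> / 2) n) n)"
    using switch_time_le_chain[OF assms(1,2), of "\<epsilon> / 2" \<epsilon>] assms(3) by auto
  have "{k. S_time b \<epsilon> k \<le> ereal t} \<subseteq> {..n}"
  proof safe
    fix k assume "S_time b \<epsilon> k \<le> ereal t"
    then have "2 * k \<le> fst (chain (grid_incr b t (\<epsilon> / 2) n) n)" using n by (simp add: S_time_eq_switch_time)
    also have "\<dots> \<le> n" by (rule fst_chain_le)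
    finally show "k \<le> n" by simp
  qed
  then show ?thesis using finite_subset by blast
qed

lemma S_time_mono: "i \<le> j \<Longrightarrow> S_time b \<epsilon> i \<le> S_time b \<epsilon> j"
  by (simp add: S_time_eq_switch_time switch_time_mono)

definition grid_count :: "(real \<Rightarrow> real) \<Rightarrow> real \<Rightarrow> real \<Rightarrow> nat \<Rightarrow> nat" where
  "grid_count b t \<epsilon> n = fst (chain (grid_incr b t \<epsilon> n) n) div 2 +
     of_bool (\<exists>i\<le>n. \<exists>l\<le>n. b (t * real i / real n) / \<epsilon> - b (t * real l / real n) / \<epsilon> > 1)"

text \<open>Valid for every grid at the same threshold, because each event of the sampled chain is
  witnessed by the path itself.\<close>

lemma grid_count_le_bar_count:
  assumes b: "continuous_on {0..} b" and "0 < t" "0 < \<epsilon>" "0 < n"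
  shows "grid_count b t \<epsilon> n \<le> bar_count b \<epsilon> t"
proof -
  let ?k = "fst (chain (grid_incr b t \<epsilon> n) n)" and ?g = "\<lambda>j. t * real j / real n"
  have g: "?g i \<in> {0..t}" if "i \<le> n" for i using that assms by (auto simp: field_simps)
  obtain i where i: "i \<le> n" "switch_time b \<epsilon> ?k \<le> ereal (?g i)"
    using switch_time_chain_le[OF b, of t \<epsilon> n n] assms by auto
  have "S_time b \<epsilon> (?k div 2) \<le> switch_time b \<epsilon> ?k"
    unfolding S_time_eq_switch_time by (rule switch_time_mono) simp
  also have "\<dots> \<le> ereal (?g i)" by (rule i)
  also have "\<dots> \<le> ereal t" using g[OF i(1)] by simp
  finally have "?k div 2 \<le> Max {k. S_time b \<epsilon> k \<le> ereal t}"
    using finite_S_time_le[OF b assms(2,3)] by (intro Max_ge) auto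
  moreover have "path_range b t \<ge> \<epsilon>"
    if R: "i \<le> n" "l \<le> n" "b (?g i) / \<epsilon> - b (?g l) / \<epsilon> > 1" for i l
  proof -
    have "compact (b ` {0..t})"
      using b by (intro compact_continuous_image) (auto intro: continuous_on_subset)
    then have "bdd_above (b ` {0..t})" "bdd_below (b ` {0..t})"
      by (simp_all add: bounded_imp_bdd_above bounded_imp_bdd_below compact_imp_bounded)
    then have "b (?g i) \<le> (SUP s\<in>{0..t}. b s)" "(INF s\<in>{0..t}. b s) \<le> b (?g l)"
      using g R by (auto intro!: cSUP_upper cINF_lower)
    moreover have "b (?g i) - b (?g l) > \<epsilon>" using R assms by (simp add: field_simps)
    ultimately show ?thesis by (simp add: path_range_def)
  qed
  ultimately show ?thesis unfolding grid_count_def bar_count_def by auto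
qed

text \<open>Only eventual, with an index depending on the path; this is why expectations are later
  compared through Fatou.\<close>

lemma bar_count_le_grid_count:
  assumes b: "continuous_on {0..} b" and "0 < t" "0 < \<epsilon>'" "\<epsilon>' < \<epsilon>"
  shows "eventually (\<lambda>n. bar_count b \<epsilon> t \<le> grid_count b t \<epsilon>' n) sequentially"
proof -
  let ?A = "{k. S_time b \<epsilon> k \<le> ereal t}"
  obtain n0 where n0: "\<And>n. n \<ge> n0 \<Longrightarrow> (\<forall>K. switch_time b \<epsilon> K \<le> ereal t \<longrightarrow>
      K \<le> fst (chain (grid_incr b t \<epsilon>' n) n)) \<and>
    (path_range b t \<ge> \<epsilon> \<longrightarrow> (\<exists>i\<le>n. \<exists>l\<le>n.
      b (t * real i / real n) / \<epsilon>' - b (t * real l / real n) / \<epsilon>' > 1))"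
    using switch_time_le_chain[OF assms] by blast
  have "0 \<in> ?A" using assms by simp
  then have "?A \<noteq> {}" by blast
  then have "Max ?A \<in> ?A" using finite_S_time_le[OF b] assms by (intro Max_in) auto
  then have M: "switch_time b \<epsilon> (2 * Max ?A) \<le> ereal t" by (simp add: S_time_eq_switch_time)
  have "bar_count b \<epsilon> t \<le> grid_count b t \<epsilon>' n" if "n \<ge> n0" for n
  proof -
    have "2 * Max ?A \<le> fst (chain (grid_incr b t \<epsilon>' n) n)" using n0[OF that] M by blast
    then have "Max ?A \<le> fst (chain (grid_incr b t \<epsilon>' n) n) div 2" by linarith
    then show ?thesis using n0[OF that] unfolding grid_count_def bar_count_def by auto
  qed
  then show ?thesis unfolding eventually_sequentially by blast
qed

section \<open>Measurability of the bar count\<close>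

lemma bex_Rats:
  "(\<exists>x\<in>\<rat>. P (x::real)) \<longleftrightarrow> (\<exists>r::rat. P (of_rat r))"
  "(\<exists>x\<in>A \<inter> \<rat>. P (x::real)) \<longleftrightarrow> (\<exists>r::rat. of_rat r \<in> A \<and> P (of_rat r))"
  unfolding Rats_def by auto

lemma measurable_bar_count:
  assumes meas: "\<And>s. 0 \<le> s \<Longrightarrow> B s \<in> borel_measurable M"
    and cont: "\<And>\<omega>. \<omega> \<in> space M \<Longrightarrow> continuous_on {0..} (\<lambda>s. B s \<omega>)"
    and t: "0 < t" and \<epsilon>: "0 < \<epsilon>"
  shows "(\<lambda>\<omega>. real (bar_count (\<lambda>s. B s \<omega>) \<epsilon> t)) \<in> borel_measurable M"
proof -
  note [measurable] = meas
  let ?\<sigma> = "\<lambda>\<omega>. switch_time (\<lambda>s. B s \<omega>) \<epsilon>"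
  have lt[measurable]: "Measurable.pred M (\<lambda>\<omega>. ?\<sigma> \<omega> k < ereal q)" for k q
  proof (induction k arbitrary: q)
    case (Suc k)
    note [measurable] = Suc
    \<comment> \<open>Measurability of \<open>B\<close> is known only at nonnegative times. The
      \<open>max\<close> keeps the index there, and it changes nothing because \<open>v\<close> and
      \<open>u\<close> are positive.\<close>
    have "Measurable.pred M (\<lambda>\<omega>. \<exists>v\<in>\<rat>. \<exists>u\<in>\<rat>. 0 < v \<and> ?\<sigma> \<omega> k < ereal v \<and> v < u \<and> u < q \<and>
        (-1) ^ k * B (max v 0) \<omega> - (-1) ^ k * B (max u 0) \<omega> > \<epsilon>)"
      unfolding bex_Rats by measurable
    moreover have "?\<sigma> \<omega> (Suc k) < ereal q \<longleftrightarrow> (\<exists>v\<in>\<rat>. \<exists>u\<in>\<rat>. 0 < v \<and> ?\<sigma> \<omega> k < ereal v \<and> v < u \<and> u < q \<and>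
        (-1) ^ k * B (max v 0) \<omega> - (-1) ^ k * B (max u 0) \<omega> > \<epsilon>)" if "\<omega> \<in> space M" for \<omega>
    proof -
      have "0 < v" if "?\<sigma> \<omega> k < ereal v" for v
        using switch_time_nonneg[of "\<lambda>s. B s \<omega>" \<epsilon> k] that by (metis ereal_less(2) order_le_less_trans)
      moreover have "?\<sigma> \<omega> (Suc k) < ereal q \<longleftrightarrow> (\<exists>v\<in>\<rat>. \<exists>u\<in>\<rat>. ?\<sigma> \<omega> k < ereal v \<and> v < u \<and> u < q \<and>
          (-1) ^ k * B v \<omega> - (-1) ^ k * B u \<omega> > \<epsilon>)"
        unfolding switch_time.simps
        by (intro drawdown_time_less_iff continuous_on_signed cont that switch_time_nonneg \<epsilon>)
      ultimately show ?thesis by (smt (verit) max.absorb1)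
    qed
    ultimately show ?case by (subst measurable_cong) auto
  qed (auto simp: zero_ereal_def)
  have le: "?\<sigma> \<omega> k \<le> ereal t \<longleftrightarrow> (\<forall>j::nat. ?\<sigma> \<omega> k < ereal (t + 1 / real (Suc j)))" for \<omega> k
  proof
    assume "?\<sigma> \<omega> k \<le> ereal t"
    then show "\<forall>j::nat. ?\<sigma> \<omega> k < ereal (t + 1 / real (Suc j))"
      by (auto intro: order_le_less_trans)
  next
    assume *: "\<forall>j::nat. ?\<sigma> \<omega> k < ereal (t + 1 / real (Suc j))"
    then obtain u where u: "?\<sigma> \<omega> k = ereal u"
      using switch_time_nonneg[of "\<lambda>s. B s \<omega>" \<epsilon> k] by (cases "?\<sigma> \<omega> k") auto
    have "u \<le> t"
    proof (rule ccontr)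
      assume "\<not> u \<le> t"
      then obtain j where "1 / real (Suc j) < u - t" using nat_approx_posE[of "u - t"] by auto
      then show False using * u by (auto dest!: spec[of _ j])
    qed
    then show "?\<sigma> \<omega> k \<le> ereal t" using u by simp
  qed
  have [measurable]: "Measurable.pred M (\<lambda>\<omega>. S_time (\<lambda>s. B s \<omega>) \<epsilon> k \<le> ereal t)" for k
    unfolding S_time_eq_switch_time le by measurable
  have MM: "(\<lambda>\<omega>. Max {k. S_time (\<lambda>s. B s \<omega>) \<epsilon> k \<le> ereal t}) \<in> measurable M (count_space UNIV)"
  proof (subst measurable_count_space_eq2_countable, safe)
    fix k
    let ?S = "\<lambda>\<omega>. S_time (\<lambda>s. B s \<omega>) \<epsilon>"
    \<comment> \<open>By monotonicity of the \<open>S\<close> times the maximum is pinned down by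
      two comparisons with \<open>t\<close>.\<close>
    have "Max {k. ?S \<omega> k \<le> ereal t} = k \<longleftrightarrow> ?S \<omega> k \<le> ereal t \<and> \<not> ?S \<omega> (Suc k) \<le> ereal t"
      if "\<omega> \<in> space M" for \<omega>
    proof -
      have f: "finite {k. ?S \<omega> k \<le> ereal t}" by (intro finite_S_time_le cont that t \<epsilon>)
      have "0 \<in> {k. ?S \<omega> k \<le> ereal t}" using t by simp
      then have ne: "{k. ?S \<omega> k \<le> ereal t} \<noteq> {}" by blast
      show ?thesis
      proof
        assume k: "Max {k. ?S \<omega> k \<le> ereal t} = k"
        then show "?S \<omega> k \<le> ereal t \<and> \<not> ?S \<omega> (Suc k) \<le> ereal t"
          using Max_in[OF f ne] Max_ge[OF f, of "Suc k"] by auto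
      next
        assume k: "?S \<omega> k \<le> ereal t \<and> \<not> ?S \<omega> (Suc k) \<le> ereal t"
        have "j \<le> k" if "?S \<omega> j \<le> ereal t" for j
        proof (rule ccontr)
          assume "\<not> j \<le> k"
          then have "?S \<omega> (Suc k) \<le> ?S \<omega> j" by (intro S_time_mono) simp
          then show False using that k by (meson order_trans)
        qed
        then show "Max {k. ?S \<omega> k \<le> ereal t} = k" using k f by (intro Max_eqI) auto
      qed
    qed
    then have "(\<lambda>\<omega>. Max {k. ?S \<omega> k \<le> ereal t}) -` {k} \<inter> space M =
        {\<omega> \<in> space M. ?S \<omega> k \<le> ereal t \<and> \<not> ?S \<omega> (Suc k) \<le> ereal t}" by auto
    also have "\<dots> \<in> sets M" by measurable
    finally show "(\<lambda>\<omega>. Max {k. ?S \<omega> k \<le> ereal t}) -` {k} \<inter> space M \<in> sets M" .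
  qed auto
  \<comment> \<open>The extrema need not be attained at rational times, so the threshold is relaxed
    by \<open>1 / Suc j\<close> for every \<open>j\<close>.\<close>
  have "path_range (\<lambda>s. B s \<omega>) t \<ge> \<epsilon> \<longleftrightarrow>
     (\<forall>j::nat. \<exists>x\<in>{0..t} \<inter> \<rat>. \<exists>y\<in>{0..t} \<inter> \<rat>. B (max x 0) \<omega> - B (max y 0) \<omega> > \<epsilon> - 1 / real (Suc j))"
    (is "?L \<longleftrightarrow> ?R") if \<omega>: "\<omega> \<in> space M" for \<omega>
  proof -
    let ?b = "\<lambda>s. B s \<omega>"
    have cb: "continuous_on {0..t} ?b" using cont[OF \<omega>] by (rule continuous_on_subset) auto
    then have bd: "bdd_above (?b ` {0..t})" "bdd_below (?b ` {0..t})"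
      by (simp_all add: bounded_imp_bdd_above bounded_imp_bdd_below compact_imp_bounded compact_continuous_image)
    show ?thesis
    proof
      assume ?L
      show ?R
      proof
        fix j :: nat
        define e where "e = 1 / real (Suc j)"
        have e: "e > 0" by (simp add: e_def)
        have ap: "\<exists>x\<in>{0..t} \<inter> \<rat>. \<bar>?b x - ?b s\<bar> < e / 2" if s: "s \<in> {0..t}" for s
        proof -
          obtain d where d: "d > 0" "\<And>x. x \<in> {0..t} \<Longrightarrow> dist x s < d \<Longrightarrow> dist (?b x) (?b s) < e / 2"
            using cb e s unfolding continuous_on_iff by (metis half_gt_zero)
          have "max 0 (s - d) < min t (s + d)" using s d(1) t by auto
          then obtain x where "x \<in> \<rat>" "max 0 (s - d) < x" "x < min t (s + d)"
            using Rats_dense_in_real by blast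
          then have "x \<in> {0..t} \<inter> \<rat>" "dist x s < d" by (auto simp: dist_real_def)
          then show ?thesis using d(2)[of x] by (auto simp: dist_real_def)
        qed
        obtain x where x: "x \<in> {0..t}" "\<And>y. y \<in> {0..t} \<Longrightarrow> ?b y \<le> ?b x"
          using continuous_attains_sup[OF _ _ cb] t by auto
        obtain y where y: "y \<in> {0..t}" "\<And>w. w \<in> {0..t} \<Longrightarrow> ?b y \<le> ?b w"
          using continuous_attains_inf[OF _ _ cb] t by auto
        have "(SUP s\<in>{0..t}. ?b s) \<le> ?b x" using x t by (intro cSUP_least) auto
        moreover have "(INF s\<in>{0..t}. ?b s) \<ge> ?b y" using y t by (intro cINF_greatest) auto
        ultimately have "?b x - ?b y \<ge> \<epsilon>" using \<open>?L\<close> by (simp add: path_range_def)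
        moreover obtain x' where x': "x' \<in> {0..t} \<inter> \<rat>" "\<bar>?b x' - ?b x\<bar> < e / 2" using ap x by blast
        moreover obtain y' where y': "y' \<in> {0..t} \<inter> \<rat>" "\<bar>?b y' - ?b y\<bar> < e / 2" using ap y by blast
        ultimately have "?b x' - ?b y' > \<epsilon> - e" unfolding abs_less_iff by linarith
        then show "\<exists>x\<in>{0..t} \<inter> \<rat>. \<exists>y\<in>{0..t} \<inter> \<rat>. B (max x 0) \<omega> - B (max y 0) \<omega> > \<epsilon> - 1 / real (Suc j)"
          using x' y' unfolding e_def[symmetric] by (intro bexI[of _ x'] bexI[of _ y']) auto
      qed
    next
      assume R: ?R
      show ?L
      proof (rule ccontr)
        assume "\<not> ?L"
        then have "0 < \<epsilon> - path_range ?b t" by simp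
        then obtain j where j: "1 / real (Suc j) < \<epsilon> - path_range ?b t" by (rule nat_approx_posE)
        obtain x y where xy: "x \<in> {0..t}" "y \<in> {0..t}" "?b x - ?b y > \<epsilon> - 1 / real (Suc j)"
          using R[rule_format, of j] by (auto simp: max_def)
        then have "?b x \<le> (SUP s\<in>{0..t}. ?b s)" "(INF s\<in>{0..t}. ?b s) \<le> ?b y"
          using bd by (auto intro!: cSUP_upper cINF_lower)
        then show False using xy j by (simp add: path_range_def)
      qed
    qed
  qed
  moreover have "Measurable.pred M (\<lambda>\<omega>. \<forall>j::nat. \<exists>x\<in>{0..t} \<inter> \<rat>. \<exists>y\<in>{0..t} \<inter> \<rat>.
      B (max x 0) \<omega> - B (max y 0) \<omega> > \<epsilon> - 1 / real (Suc j))"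
    unfolding bex_Rats by measurable
  ultimately have [measurable]: "Measurable.pred M (\<lambda>\<omega>. path_range (\<lambda>s. B s \<omega>) t \<ge> \<epsilon>)"
    by (subst measurable_cong) auto
  show ?thesis unfolding bar_count_def using MM by measurable
qed

subsection \<open>Abel means of the limiting step function\<close>

text \<open>The Poisson kernel of the unit disc, as a function of the cosine \<open>c\<close> of the
  angle. In this form it is monotone in \<open>c\<close>, and a shift of the angle by pi is
  \<open>c\<close> to \<open>- c\<close>.\<close>

definition poisson_ker :: "real \<Rightarrow> real \<Rightarrow> real" where
  "poisson_ker r c = (1 - r\<^sup>2) / (1 - 2 * r * c + r\<^sup>2)"

lemma poisson_denom_ge:
  fixes r c :: real
  assumes "0 \<le> r" "c \<le> 1"
  shows "(1 - r)\<^sup>2 \<le> 1 - 2 * r * c + r\<^sup>2"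
proof -
  have "r * c \<le> r * 1" using assms by (intro mult_left_mono) auto
  then show ?thesis by (simp add: power2_eq_square algebra_simps)
qed

lemma poisson_denom_pos:
  fixes r c :: real
  assumes "0 \<le> r" "r < 1" "c \<le> 1"
  shows "0 < 1 - 2 * r * c + r\<^sup>2"
proof -
  have "0 < (1 - r)\<^sup>2" using assms by simp
  then show ?thesis using poisson_denom_ge[of r c] assms by linarith
qed

lemma poisson_ker_nonneg: "0 \<le> r \<Longrightarrow> r < 1 \<Longrightarrow> c \<le> 1 \<Longrightarrow> 0 \<le> poisson_ker r c"
  unfolding poisson_ker_def using poisson_denom_pos[of r c] by (simp add: power_le_one)

lemma poisson_ker_mono:
  fixes r c :: real
  assumes "0 \<le> r" "r < 1" "c \<le> c'" "c' \<le> 1"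
  shows "poisson_ker r c \<le> poisson_ker r c'"
proof -
  have "r * c \<le> r * c'" using assms by (intro mult_left_mono) auto
  then show ?thesis unfolding poisson_ker_def using poisson_denom_pos[of r c] poisson_denom_pos[of r c'] assms
    by (intro divide_left_mono) (auto simp: power_le_one)
qed

lemma poisson_ker_le:
  fixes r c :: real
  assumes "0 \<le> r" "r < 1" "c \<le> 1"
  shows "poisson_ker r c \<le> 1 / (1 - r)\<^sup>2"
proof -
  have "1 - r\<^sup>2 \<le> 1" by simp
  moreover have "0 < (1 - r)\<^sup>2" using assms by simp
  ultimately show ?thesis unfolding poisson_ker_def using poisson_denom_ge[of r c] assms
    by (intro frac_le) auto
qed

text \<open>Twice the real part of the geometric series in \<open>r * cis \<theta>\<close>, without
  its constant term.\<close>

lemma poisson_ker_series: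
  assumes "0 \<le> r" "r < 1"
  shows "(\<lambda>i. 2 * (r ^ Suc i * cos (real (Suc i) * \<theta>))) sums (poisson_ker r (cos \<theta>) - 1)"
proof -
  define w where "w = of_real r * cis \<theta>"
  have nw: "norm w < 1" using assms by (simp add: w_def norm_mult)
  then have "(\<lambda>i. w ^ Suc i) sums (1 / (1 - w) - 1)"
    using geometric_sums[OF nw] by (subst sums_Suc_iff) simp
  then have "(\<lambda>i. Re (w ^ Suc i)) sums Re (1 / (1 - w) - 1)" by (rule sums_Re)
  moreover have "w ^ n = of_real (r ^ n) * cis (real n * \<theta>)" for n
    unfolding w_def by (simp add: power_mult_distrib Complex.DeMoivre)
  then have "Re (w ^ Suc i) = r ^ Suc i * cos (real (Suc i) * \<theta>)" for i
    by (simp del: power_Suc of_nat_Suc of_real_power)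
  ultimately have "(\<lambda>i. 2 * (r ^ Suc i * cos (real (Suc i) * \<theta>))) sums (2 * Re (1 / (1 - w) - 1))"
    by (intro sums_mult) simp
  moreover have "2 * Re (1 / (1 - w) - 1) = poisson_ker r (cos \<theta>) - 1"
  proof -
    have n: "(cmod (1 - w))\<^sup>2 = 1 - 2 * r * cos \<theta> + r\<^sup>2"
      unfolding cmod_power2 w_def using sin_cos_squared_add[of \<theta>]
      by (simp add: power2_eq_square algebra_simps) (simp flip: distrib_left)
    have p: "0 < 1 - 2 * r * cos \<theta> + r\<^sup>2" using assms by (intro poisson_denom_pos) auto
    have "Re (1 / (1 - w)) = (1 - r * cos \<theta>) / (1 - 2 * r * cos \<theta> + r\<^sup>2)"
      unfolding Re_divide' n by (simp add: w_def)
    then show ?thesis using p unfolding poisson_ker_def by (simp add: field_simps)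
  qed
  ultimately show ?thesis by simp
qed

section \<open>The trigonometric profile and its derivative\<close>

definition wave_coeff :: "nat \<Rightarrow> real" where
  "wave_coeff k = 2 * (2 * (- 1) ^ k - 1)"

lemma abs_wave_coeff: "\<bar>wave_coeff k\<bar> \<le> 6"
  by (cases "even k") (auto simp: wave_coeff_def)

text \<open>\<open>wave\<close> is chosen so that its derivative is \<open>y * cos (pi * k * y)\<close>; the derivative of \<open>profile\<close>
  is then \<open>y\<close> times a combination of Poisson kernels.\<close>

definition wave :: "nat \<Rightarrow> real \<Rightarrow> real" where
  "wave k y = cos (pi * real k * y) / (pi * real k)\<^sup>2 + y * sin (pi * real k * y) / (pi * real k)"

text \<open>The term \<open>y\<^sup>2 / 2\<close> integrates \<open>y\<close> against the mean value
  1 of \<open>profile_ker\<close>; the constant \<open>2 / 3\<close> makes the value at 0 vanish in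
  the limit of \<open>r\<close> to 1.\<close>

definition profile :: "real \<Rightarrow> real \<Rightarrow> real" where
  "profile r y = y\<^sup>2 / 2 + 2 / 3 + (\<Sum>i. r ^ Suc i * wave_coeff (Suc i) * wave (Suc i) y)"

text \<open>As \<open>r\<close> tends to 1, the second kernel concentrates mass 2 at each even
  integer and the shifted one mass 2 at each odd integer. After multiplication by \<open>y\<close>
  this yields jumps \<open>4 * k\<close> at odd and \<open>- 2 * k\<close> at even
  \<open>k\<close>.\<close>

definition profile_ker :: "real \<Rightarrow> real \<Rightarrow> real" where
  "profile_ker r y = 2 * poisson_ker r (- cos (pi * y)) - poisson_ker r (cos (pi * y))"

lemma abs_wave_le: "\<bar>wave (Suc i) y\<bar> \<le> 1 + \<bar>y\<bar>"
proof -
  have p: "1 \<le> pi * real (Suc i)" using mult_mono[of 1 pi 1 "real (Suc i)"] pi_gt3 by simp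
  then have p2: "1 \<le> (pi * real (Suc i))\<^sup>2" by (rule one_le_power)
  have "\<bar>cos (pi * real (Suc i) * y) / (pi * real (Suc i))\<^sup>2\<bar> \<le> 1 / 1"
    unfolding abs_divide by (intro frac_le) (use p2 in auto)
  moreover have "\<bar>y * sin (pi * real (Suc i) * y) / (pi * real (Suc i))\<bar> \<le> \<bar>y\<bar> * 1 / 1"
    unfolding abs_divide abs_mult[of y] by (intro frac_le mult_left_mono mult_nonneg_nonneg) (use p in \<open>auto simp del: of_nat_Suc\<close>)
  ultimately show ?thesis unfolding wave_def by linarith
qed

lemma summable_profile:
  assumes "0 \<le> r" "r < 1"
  shows "summable (\<lambda>i. r ^ Suc i * wave_coeff (Suc i) * wave (Suc i) y)"
proof (rule summable_comparison_test)
  show "\<exists>N. \<forall>n\<ge>N. norm (r ^ Suc n * wave_coeff (Suc n) * wave (Suc n) y) \<le> r ^ Suc n * 6 * (1 + \<bar>y\<bar>)"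
    using assms abs_wave_coeff abs_wave_le
    by (auto simp: abs_mult simp del: power_Suc intro!: mult_mono)
  have "summable (\<lambda>n. r ^ Suc n)" using assms summable_geometric[of r]
    by (subst summable_Suc_iff) auto
  then show "summable (\<lambda>n. r ^ Suc n * 6 * (1 + \<bar>y\<bar>))" by (intro summable_mult2)
qed

lemma profile_ker_series:
  assumes "0 \<le> r" "r < 1"
  shows "(\<lambda>i. r ^ Suc i * wave_coeff (Suc i) * cos (pi * real (Suc i) * y)) sums (profile_ker r y - 1)"
proof -
  have c: "cos (real (Suc i) * (pi * y + pi)) = (- 1) ^ Suc i * cos (pi * real (Suc i) * y)" for i
    unfolding distrib_left cos_add by (simp add: mult_ac del: of_nat_Suc power_Suc)
  have "(\<lambda>i. 2 * (2 * (r ^ Suc i * cos (real (Suc i) * (pi * y + pi)))) -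
      2 * (r ^ Suc i * cos (real (Suc i) * (pi * y)))) sums
     (2 * (poisson_ker r (cos (pi * y + pi)) - 1) - (poisson_ker r (cos (pi * y)) - 1))"
    by (intro sums_diff sums_mult poisson_ker_series assms)
  then show ?thesis unfolding c
    by (simp add: profile_ker_def wave_coeff_def algebra_simps del: power_Suc of_nat_Suc)
qed

lemma DERIV_wave:
  assumes "k > 0"
  shows "(wave k has_real_derivative y * cos (pi * real k * y)) (at y within S)"
  unfolding wave_def[abs_def] using assms
  by (auto intro!: derivative_eq_intros simp: field_simps power2_eq_square)

lemma geometric_uniformly_convergent:
  fixes f :: "nat \<Rightarrow> real \<Rightarrow> real"
  assumes "0 \<le> r" "r < 1" "\<And>n x. x \<in> S \<Longrightarrow> \<bar>f n x\<bar> \<le> r ^ Suc n * C"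
  shows "uniformly_convergent_on S (\<lambda>n x. \<Sum>i<n. f i x)"
proof (rule Weierstrass_m_test')
  show "summable (\<lambda>n. r ^ Suc n * C)"
    using assms by (intro summable_mult2, subst summable_Suc_iff) (auto intro: summable_geometric)
qed (use assms in auto)

lemma DERIV_profile:
  assumes "0 \<le> r" "r < 1"
  shows "(profile r has_real_derivative y * profile_ker r y) (at y)"
proof -
  \<comment> \<open>The factor \<open>y\<close> in the differentiated terms is unbounded, so the
    uniform bound is taken on a bounded interval around the point.\<close>
  define R where "R = \<bar>y\<bar> + 1"
  let ?f = "\<lambda>i y. r ^ Suc i * wave_coeff (Suc i) * wave (Suc i) y"
  let ?f' = "\<lambda>i y. r ^ Suc i * wave_coeff (Suc i) * (y * cos (pi * real (Suc i) * y))"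
  have "((\<lambda>y. \<Sum>i. ?f i y) has_real_derivative (\<Sum>i. ?f' i y)) (at y)"
  proof (rule has_field_derivative_series'(2)[where S = "{- R..R}"])
    show "uniformly_convergent_on {- R..R} (\<lambda>n x. \<Sum>i<n. ?f' i x)"
    proof (rule geometric_uniformly_convergent[OF assms, where C = "6 * R"])
      fix n x assume x: "x \<in> {- R..R}"
      have "\<bar>x * cos (pi * real (Suc n) * x)\<bar> \<le> R * 1" unfolding abs_mult using x by (intro mult_mono) auto
      then have "\<bar>wave_coeff (Suc n) * (x * cos (pi * real (Suc n) * x))\<bar> \<le> 6 * R"
        unfolding abs_mult[of "wave_coeff (Suc n)"] using abs_wave_coeff by (intro mult_mono) auto
      then have "r ^ Suc n * \<bar>wave_coeff (Suc n) * (x * cos (pi * real (Suc n) * x))\<bar> \<le> r ^ Suc n * (6 * R)"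
        using assms by (intro mult_left_mono) auto
      then show "\<bar>?f' n x\<bar> \<le> r ^ Suc n * (6 * R)"
        unfolding mult.assoc abs_mult[of "r ^ Suc n"] using assms by simp
    qed
    show "((\<lambda>y. ?f n y) has_real_derivative ?f' n x) (at x within {- R..R})" for n x
      by (intro DERIV_cmult DERIV_wave) simp
    show "0 \<in> {- R..R}" "y \<in> interior {- R..R}" by (auto simp: R_def)
    show "summable (\<lambda>i. ?f i 0)" by (rule summable_profile[OF assms])
  qed simp
  moreover have "(\<lambda>i. ?f' i y) sums (y * (profile_ker r y - 1))"
    using sums_mult[OF profile_ker_series[OF assms], of y y] by (simp add: mult_ac)
  then have "(\<Sum>i. ?f' i y) = y * (profile_ker r y - 1)" by (rule sums_unique[symmetric])
  ultimately have "((\<lambda>y. \<Sum>i. ?f i y) has_real_derivative y * (profile_ker r y - 1)) (at y)"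
    by metis
  moreover have "((\<lambda>y. y\<^sup>2 / 2 + 2 / 3) has_real_derivative y) (at y)"
    by (auto intro!: derivative_eq_intros)
  ultimately have "((\<lambda>y. (y\<^sup>2 / 2 + 2 / 3) + (\<Sum>i. ?f i y)) has_real_derivative y + y * (profile_ker r y - 1)) (at y)"
    by (intro DERIV_add)
  then show ?thesis unfolding profile_def[abs_def] by (simp add: algebra_simps)
qed

text \<open>The antiderivative of the Poisson kernel vanishing at 0. Its sines vanish at integers,
  so the kernel has mass exactly 1 on each unit interval, whatever \<open>r\<close> is.\<close>

definition poisson_int :: "real \<Rightarrow> real \<Rightarrow> real" where
  "poisson_int r y = y + (\<Sum>i. 2 * r ^ Suc i * (sin (pi * real (Suc i) * y) / (pi * real (Suc i))))"

lemma DERIV_poisson_int: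
  assumes "0 \<le> r" "r < 1"
  shows "(poisson_int r has_real_derivative poisson_ker r (cos (pi * y))) (at y)"
proof -
  let ?f = "\<lambda>i y. 2 * r ^ Suc i * (sin (pi * real (Suc i) * y) / (pi * real (Suc i)))"
  let ?f' = "\<lambda>i y. 2 * r ^ Suc i * cos (pi * real (Suc i) * y)"
  have "((\<lambda>y. \<Sum>i. ?f i y) has_real_derivative (\<Sum>i. ?f' i y)) (at y)"
  proof (rule has_field_derivative_series'(2)[where S = UNIV])
    show "uniformly_convergent_on UNIV (\<lambda>n x. \<Sum>i<n. ?f' i x)"
    proof (rule geometric_uniformly_convergent[OF assms, where C = 2])
      fix n x show "\<bar>?f' n x\<bar> \<le> r ^ Suc n * 2"
        using assms mult_left_mono[of "\<bar>cos (pi * real (Suc n) * x)\<bar>" 1 "2 * r ^ Suc n"]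
        by (simp add: abs_mult mult_ac del: power_Suc of_nat_Suc)
    qed
    show "((\<lambda>y. ?f n y) has_real_derivative ?f' n x) (at x within UNIV)" for n x
      by (auto intro!: derivative_eq_intros simp: field_simps simp del: of_nat_Suc)
    show "summable (\<lambda>i. ?f i 0)" by simp
  qed auto
  moreover have "(\<lambda>i. ?f' i y) sums (poisson_ker r (cos (pi * y)) - 1)"
    using poisson_ker_series[OF assms, of "pi * y"] by (simp add: mult_ac)
  then have "(\<Sum>i. ?f' i y) = poisson_ker r (cos (pi * y)) - 1" by (rule sums_unique[symmetric])
  ultimately have "((\<lambda>y. y + (\<Sum>i. ?f i y)) has_real_derivative 1 + (poisson_ker r (cos (pi * y)) - 1)) (at y)"
    by (intro DERIV_add DERIV_ident) metis
  then show ?thesis unfolding poisson_int_def[abs_def] by simp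
qed

lemma poisson_int_of_nat: "poisson_int r (real n) = real n"
proof -
  have "sin (pi * real (Suc i) * real n) = 0" for i
    using sin_npi[of "Suc i * n"] unfolding of_nat_mult by (simp add: mult_ac del: of_nat_Suc)
  then show ?thesis by (simp add: poisson_int_def)
qed

lemma wave_minus: "wave k (- y) = wave k y"
  by (simp add: wave_def)

lemma wave_shift: "wave k (y + 2) + wave k (y - 2) = 2 * wave k y"
proof -
  have "sin (pi * real k * (y + 2)) = sin (pi * real k * y)"
    "cos (pi * real k * (y + 2)) = cos (pi * real k * y)"
    "sin (pi * real k * (y - 2)) = sin (pi * real k * y)"
    "cos (pi * real k * (y - 2)) = cos (pi * real k * y)"
    using sin_npi[of "2 * k"] cos_npi[of "2 * k"]
    by (simp_all add: sin_add cos_add sin_diff cos_diff distrib_left right_diff_distrib mult_ac)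
  then show ?thesis by (simp add: wave_def add_divide_distrib[symmetric] algebra_simps)
qed

lemma profile_minus: "profile r (- y) = profile r y"
  by (simp add: profile_def wave_minus)

text \<open>The waves are 2-periodic functions with coefficients affine in \<open>y\<close>, so
  their second difference of step 2 vanishes; the 4 stems from \<open>y\<^sup>2 / 2\<close>.\<close>

lemma profile_shift:
  assumes "0 \<le> r" "r < 1"
  shows "profile r (y + 2) + profile r (y - 2) = 2 * profile r y + 4"
proof -
  let ?f = "\<lambda>y i. r ^ Suc i * wave_coeff (Suc i) * wave (Suc i) y"
  have "suminf (?f (y + 2)) + suminf (?f (y - 2)) = (\<Sum>i. ?f (y + 2) i + ?f (y - 2) i)"
    by (intro suminf_add summable_profile assms)
  also have "\<dots> = (\<Sum>i. 2 * ?f y i)"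
    by (simp only: distrib_left[symmetric] wave_shift) (simp add: mult_ac)
  also have "\<dots> = 2 * suminf (?f y)" by (rule suminf_mult[OF summable_profile[OF assms]])
  finally have "suminf (?f (y + 2)) + suminf (?f (y - 2)) = 2 * suminf (?f y)" .
  moreover have "(y + 2)\<^sup>2 / 2 + (y - 2)\<^sup>2 / 2 = y\<^sup>2 + 4"
    by (simp add: power2_eq_square field_simps)
  moreover have "p + 2 / 3 + a + (q + 2 / 3 + b) = 2 * (w / 2 + 2 / 3 + c) + 4"
    if "a + b = 2 * c" "p + q = w + 4" for a b c p q w :: real
    using that by argo
  ultimately show ?thesis unfolding profile_def by blast
qed

section \<open>Estimates for the profile that are uniform in the radius\<close>

lemma abs_diff_le_DERIV:
  fixes f g :: "real \<Rightarrow> real"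
  assumes "a \<le> b"
    and f: "\<And>x. a \<le> x \<Longrightarrow> x \<le> b \<Longrightarrow> (f has_real_derivative f' x) (at x)"
    and g: "\<And>x. a \<le> x \<Longrightarrow> x \<le> b \<Longrightarrow> (g has_real_derivative g' x) (at x)"
    and le: "\<And>x. a \<le> x \<Longrightarrow> x \<le> b \<Longrightarrow> \<bar>f' x\<bar> \<le> g' x"
  shows "\<bar>f b - f a\<bar> \<le> g b - g a"
proof -
  have "g a - f a \<le> g b - f b"
    by (rule DERIV_nonneg_imp_nondecreasing[OF \<open>a \<le> b\<close>], rule exI, rule conjI, rule DERIV_diff, erule (1) g, erule (1) f)
      (use le in \<open>fastforce simp: abs_le_iff\<close>)
  moreover have "g a + f a \<le> g b + f b"
    by (rule DERIV_nonneg_imp_nondecreasing[OF \<open>a \<le> b\<close>], rule exI, rule conjI, rule DERIV_add, erule (1) g, erule (1) f)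
      (use le in \<open>fastforce simp: abs_le_iff\<close>)
  ultimately show ?thesis by (auto simp: abs_le_iff)
qed

lemma abs_diff_le_slope:
  fixes f :: "real \<Rightarrow> real"
  assumes "a \<le> b"
    and f: "\<And>x. a \<le> x \<Longrightarrow> x \<le> b \<Longrightarrow> (f has_real_derivative f' x) (at x)"
    and le: "\<And>x. a \<le> x \<Longrightarrow> x \<le> b \<Longrightarrow> \<bar>f' x\<bar> \<le> L"
  shows "\<bar>f b - f a\<bar> \<le> L * (b - a)"
proof -
  have "\<bar>f b - f a\<bar> \<le> L * b - L * a"
    by (rule abs_diff_le_DERIV[OF assms(1) f _ le]) (auto intro!: derivative_eq_intros)
  then show ?thesis by (simp add: algebra_simps)
qed

definition upper_profile :: "real \<Rightarrow> real \<Rightarrow> real" where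
  "upper_profile r x = (profile r (1 + x) + profile r (1 - x)) / 2"

text \<open>\<open>profile_ker\<close> takes the same value at \<open>1 + x\<close> and
  \<open>1 - x\<close>, so in the difference only the factor \<open>x\<close> remains; the shift by
  1 exchanges the two Poisson kernels.\<close>

lemma DERIV_upper_profile:
  assumes "0 \<le> r" "r < 1"
  shows "(upper_profile r has_real_derivative
    x * (2 * poisson_ker r (cos (pi * x)) - poisson_ker r (- cos (pi * x)))) (at x)"
proof -
  have c: "cos (pi * (1 + x)) = - cos (pi * x)" "cos (pi * (1 - x)) = - cos (pi * x)"
    by (simp_all add: distrib_left right_diff_distrib cos_add cos_diff)
  have i: "((\<lambda>x. 1 + x) has_real_derivative 1) (at x)" "((\<lambda>x. 1 - x) has_real_derivative - 1) (at x)"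
    by (auto intro!: derivative_eq_intros)
  have d: "((\<lambda>x. profile r (1 + x)) has_real_derivative ((1 + x) * profile_ker r (1 + x)) * 1) (at x)"
    "((\<lambda>x. profile r (1 - x)) has_real_derivative ((1 - x) * profile_ker r (1 - x)) * (- 1)) (at x)"
    by (rule DERIV_chain2[OF DERIV_profile[OF assms] i(1)], rule DERIV_chain2[OF DERIV_profile[OF assms] i(2)])
  have "((\<lambda>x. (profile r (1 + x) + profile r (1 - x)) / 2) has_real_derivative
     (((1 + x) * profile_ker r (1 + x)) * 1 + ((1 - x) * profile_ker r (1 - x)) * (- 1)) / 2) (at x)"
    by (intro DERIV_cdivide DERIV_add d)
  moreover have "(((1 + x) * profile_ker r (1 + x)) * 1 + ((1 - x) * profile_ker r (1 - x)) * (- 1)) / 2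
     = x * (2 * poisson_ker r (cos (pi * x)) - poisson_ker r (- cos (pi * x)))"
    unfolding profile_ker_def c by (simp add: field_simps)
  ultimately show ?thesis unfolding upper_profile_def[abs_def] by simp
qed

text \<open>On the unit interval each derivative is bounded by twice one Poisson kernel plus the
  other, and each kernel has mass 1 there: 2 + 1 = 3, with no dependence on
  \<open>r\<close>.\<close>

lemma profile_variation:
  assumes r: "0 \<le> r" "r < 1" and x: "0 \<le> x" "x \<le> 1"
  shows "\<bar>profile r x - profile r 0\<bar> \<le> 3" "\<bar>upper_profile r x - upper_profile r 0\<bar> \<le> 3"
proof -
  have q: "(poisson_int r has_real_derivative poisson_ker r (cos (pi * y))) (at y)"
    "((\<lambda>y. poisson_int r (1 + y)) has_real_derivative poisson_ker r (- cos (pi * y))) (at y)" for y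
  proof -
    show "(poisson_int r has_real_derivative poisson_ker r (cos (pi * y))) (at y)"
      by (rule DERIV_poisson_int[OF r])
    have "((\<lambda>y. poisson_int r (1 + y)) has_real_derivative poisson_ker r (cos (pi * (1 + y))) * 1) (at y)"
      by (rule DERIV_chain2[where f = "poisson_int r"], rule DERIV_poisson_int[OF r]) (auto intro!: derivative_eq_intros)
    then show "((\<lambda>y. poisson_int r (1 + y)) has_real_derivative poisson_ker r (- cos (pi * y))) (at y)"
      by (simp add: distrib_left cos_add)
  qed
  have n: "0 \<le> poisson_ker r (cos (pi * y))" "0 \<le> poisson_ker r (- cos (pi * y))" for y
    by (intro poisson_ker_nonneg r; simp)+
  have bd: "\<bar>y * (2 * p - p')\<bar> \<le> 2 * p + p'"
    if "0 \<le> y" "y \<le> 1" "0 \<le> p" "0 \<le> p'" for y p p' :: real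
  proof -
    have "\<bar>y * (2 * p - p')\<bar> \<le> 1 * (2 * p + p')" unfolding abs_mult using that by (intro mult_mono) auto
    then show ?thesis by simp
  qed
  have mono: "poisson_int r x \<le> 1" "poisson_int r (1 + x) \<le> 2"
    using DERIV_nonneg_imp_nondecreasing[of x 1 "poisson_int r"]
      DERIV_nonneg_imp_nondecreasing[of x 1 "\<lambda>y. poisson_int r (1 + y)"] x q n
      poisson_int_of_nat[of r 1] poisson_int_of_nat[of r 2] by (auto, blast+)
  have e: "poisson_int r 0 = 0" "poisson_int r 1 = 1"
    using poisson_int_of_nat[of r 0] poisson_int_of_nat[of r 1] by auto
  have "\<bar>profile r x - profile r 0\<bar> \<le> (2 * poisson_int r (1 + x) + poisson_int r x) - (2 * poisson_int r (1 + 0) + poisson_int r 0)"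
    by (rule abs_diff_le_DERIV[OF x(1) DERIV_profile[OF r] DERIV_add[OF DERIV_cmult[OF q(2)] q(1)]])
      (use x n in \<open>auto simp: profile_ker_def intro!: bd\<close>)
  then show "\<bar>profile r x - profile r 0\<bar> \<le> 3" using mono e by simp
  have "\<bar>upper_profile r x - upper_profile r 0\<bar> \<le> (2 * poisson_int r x + poisson_int r (1 + x)) - (2 * poisson_int r 0 + poisson_int r (1 + 0))"
    by (rule abs_diff_le_DERIV[OF x(1) DERIV_upper_profile[OF r] DERIV_add[OF DERIV_cmult[OF q(1)] q(2)]])
      (use x n in \<open>auto intro!: bd\<close>)
  then show "\<bar>upper_profile r x - upper_profile r 0\<bar> \<le> 3" using mono e by simp
qed

lemma sin_ge_half:
  assumes "0 \<le> u" "u \<le> pi / 3"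
  shows "u / 2 \<le> sin u"
proof -
  have "sin 0 - 0 / 2 \<le> sin u - u / 2"
  proof (rule DERIV_nonneg_imp_nondecreasing[OF assms(1)], intro exI conjI)
    fix x assume x: "0 \<le> x" "x \<le> u"
    show "((\<lambda>u. sin u - u / 2) has_real_derivative cos x - 1 / 2) (at x)"
      by (auto intro!: derivative_eq_intros)
    have "cos (pi / 3) \<le> cos x" using x assms pi_gt_zero by (intro cos_monotone_0_pi_le) auto
    then show "0 \<le> cos x - 1 / 2" by (simp add: cos_60)
  qed
  then show ?thesis by simp
qed

text \<open>The singularity of the Poisson kernel at an even integer is cancelled by the factor \<open>z\<close>
  (arithmetic-geometric mean in the denominator).\<close>

lemma poisson_ker_near_0:
  assumes r: "1 / 4 \<le> r" "r < 1" and z: "0 \<le> z" "z \<le> 1 / 2"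
  shows "z * poisson_ker r (cos (pi * z)) \<le> 2"
proof (cases "z = 0")
  case False
  have "z / 2 \<le> sin (pi * z / 2)"
  proof -
    have "pi * z / 2 / 2 \<le> sin (pi * z / 2)"
      using z pi_gt3 mult_left_mono[of z "1 / 2" pi] by (intro sin_ge_half) auto
    moreover have "z * 2 \<le> z * pi" using z pi_gt3 by (intro mult_left_mono) auto
    ultimately show ?thesis by (simp add: mult.commute)
  qed
  then have "(z / 2)\<^sup>2 \<le> (sin (pi * z / 2))\<^sup>2" using z by (intro power_mono) auto
  moreover have "cos (pi * z) = 1 - 2 * (sin (pi * z / 2))\<^sup>2"
    using cos_double_sin[of "pi * z / 2"] by simp
  ultimately have c: "z\<^sup>2 / 2 \<le> 1 - cos (pi * z)" by (simp add: power_divide)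
  have "r * (z\<^sup>2 / 2) \<le> r * (1 - cos (pi * z))" using c r by (intro mult_left_mono) auto
  \<comment> \<open>The bound \<open>1 / 4\<close> on \<open>r\<close> keeps just the multiple of
    \<open>z\<^sup>2\<close> that, with \<open>(1 - r)\<^sup>2\<close>, dominates
    \<open>(1 - r) * z\<close>.\<close>
  moreover have "1 / 4 * z\<^sup>2 \<le> r * z\<^sup>2" using r by (intro mult_right_mono) auto
  moreover have "1 - 2 * r * cos (pi * z) + r\<^sup>2 = (1 - r)\<^sup>2 + 2 * (r * (1 - cos (pi * z)))"
    by (simp add: power2_eq_square algebra_simps)
  moreover have "(1 - r) * z \<le> (1 - r)\<^sup>2 + 1 / 4 * z\<^sup>2"
  proof -
    have "0 \<le> ((1 - r) - z / 2)\<^sup>2" by simp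
    then show ?thesis by (simp add: power2_eq_square algebra_simps)
  qed
  ultimately have d: "(1 - r) * z \<le> 1 - 2 * r * cos (pi * z) + r\<^sup>2" by linarith
  have pos: "0 < (1 - r) * z" using r z False by auto
  have "poisson_ker r (cos (pi * z)) \<le> (1 - r\<^sup>2) / ((1 - r) * z)"
    unfolding poisson_ker_def using r pos d by (intro divide_left_mono) (auto simp: power_le_one)
  also have "\<dots> = (1 + r) / z" using r z False by (simp add: field_simps power2_eq_square)
  finally have "z * poisson_ker r (cos (pi * z)) \<le> z * ((1 + r) / z)" using z by (intro mult_left_mono) auto
  then show ?thesis using r False by simp
qed simp

text \<open>On \<open>[0, d]\<close> the derivative is at most \<open>4 + 2 * p\<close>, since the
  factor \<open>y\<close> tames the kernel singular at 0; on \<open>[d, 1 - d]\<close> both kernels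
  are at most \<open>p\<close>. For fixed \<open>d\<close>, \<open>p\<close> tends to 0 as
  \<open>r\<close> tends to 1, so the profile becomes flat away from the jump at 1.\<close>

lemma profile_near:
  assumes r: "1 / 4 \<le> r" "r < 1" and d: "0 < d" "d \<le> 1 / 2" and x: "0 \<le> x" "x \<le> 1 - d"
  defines "p \<equiv> poisson_ker r (cos (pi * d))"
  shows "\<bar>profile r x - profile r 0\<bar> \<le> 4 * d + 5 * p"
    "\<bar>upper_profile r x - upper_profile r 0\<bar> \<le> 4 * d + 5 * p"
proof -
  have r0: "0 \<le> r" using r by simp
  have n: "0 \<le> poisson_ker r (cos (pi * y))" "0 \<le> poisson_ker r (- cos (pi * y))" for y
    by (intro poisson_ker_nonneg r0 r; simp)+
  have p0: "0 \<le> p" unfolding p_def by (rule n)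
  have minus: "poisson_ker r (- cos (pi * y)) \<le> p" if "0 \<le> y" "y \<le> 1 - d" for y
  proof -
    have "cos (pi * (1 - d)) \<le> cos (pi * y)"
      using that d by (intro cos_monotone_0_pi_le) auto
    then show ?thesis unfolding p_def
      by (intro poisson_ker_mono r r0) (auto simp: right_diff_distrib cos_diff)
  qed
  have plus: "poisson_ker r (cos (pi * y)) \<le> p" if "d \<le> y" "y \<le> 1 - d" for y
    unfolding p_def using that d by (intro poisson_ker_mono r r0 cos_monotone_0_pi_le) auto
  have bd: "\<bar>y * (2 * a - b)\<bar> \<le> 2 * (y * a) + y * b" if "0 \<le> y" "0 \<le> a" "0 \<le> b" for y a b :: real
    using that by (auto simp: abs_le_iff right_diff_distrib)
  have le1: "y * a \<le> a" if "0 \<le> y" "y \<le> 1" "0 \<le> a" for y a :: real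
    using that mult_right_mono[of y 1 a] by simp
  have near: "\<bar>y * (2 * poisson_ker r (- cos (pi * y)) - poisson_ker r (cos (pi * y)))\<bar> \<le> 4 + 2 * p \<and>
      \<bar>y * (2 * poisson_ker r (cos (pi * y)) - poisson_ker r (- cos (pi * y)))\<bar> \<le> 4 + 2 * p"
    if y: "0 \<le> y" "y \<le> d" for y
  proof -
    have "y * poisson_ker r (cos (pi * y)) \<le> 2" using y d by (intro poisson_ker_near_0 r) auto
    moreover have "y * poisson_ker r (- cos (pi * y)) \<le> p"
      using le1[of y "poisson_ker r (- cos (pi * y))"] minus[of y] y d n by auto
    ultimately show ?thesis using bd[OF y(1) n(2) n(1)] bd[OF y(1) n(1) n(2)] p0 by (smt (verit))
  qed
  have far: "\<bar>y * (2 * poisson_ker r (- cos (pi * y)) - poisson_ker r (cos (pi * y)))\<bar> \<le> 3 * p \<and>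
      \<bar>y * (2 * poisson_ker r (cos (pi * y)) - poisson_ker r (- cos (pi * y)))\<bar> \<le> 3 * p"
    if y: "d \<le> y" "y \<le> 1 - d" for y
  proof -
    have "y * poisson_ker r (cos (pi * y)) \<le> p"
      using le1[of y "poisson_ker r (cos (pi * y))"] plus[of y] y d n by auto
    moreover have "y * poisson_ker r (- cos (pi * y)) \<le> p"
      using le1[of y "poisson_ker r (- cos (pi * y))"] minus[of y] y d n by auto
    moreover have "0 \<le> y" using y d by simp
    ultimately show ?thesis using bd[OF _ n(2) n(1)] bd[OF _ n(1) n(2)] p0 by (smt (verit))
  qed
  have fin: "\<bar>f x - f 0\<bar> \<le> 4 * d + 5 * p"
    if D: "\<And>y. (f has_real_derivative f' y) (at y)"
      and N: "\<And>y. 0 \<le> y \<Longrightarrow> y \<le> d \<Longrightarrow> \<bar>f' y\<bar> \<le> 4 + 2 * p"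
      and F: "\<And>y. d \<le> y \<Longrightarrow> y \<le> 1 - d \<Longrightarrow> \<bar>f' y\<bar> \<le> 3 * p" for f f'
  proof -
    define m where "m = min x d"
    have m: "0 \<le> m" "m \<le> d" "m \<le> x" "m < x \<Longrightarrow> m = d" using x d by (auto simp: m_def)
    have "\<bar>f m - f 0\<bar> \<le> (4 + 2 * p) * (m - 0)" using m by (intro abs_diff_le_slope[OF _ D]) (auto intro!: N)
    also have "\<dots> \<le> (4 + 2 * p) * d" using m p0 by (intro mult_left_mono) auto
    also have "\<dots> \<le> 4 * d + 2 * p"
      using mult_right_mono[of d 1 p] d p0 by (simp add: algebra_simps)
    finally have 1: "\<bar>f m - f 0\<bar> \<le> 4 * d + 2 * p" .
    have 2: "\<bar>f x - f m\<bar> \<le> 3 * p"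
    proof (cases "m < x")
      case True
      have "\<bar>f x - f m\<bar> \<le> 3 * p * (x - m)" using m True x by (intro abs_diff_le_slope[OF _ D]) (auto intro!: F)
      also have "\<dots> \<le> 3 * p * 1" using m x d p0 by (intro mult_left_mono) auto
      finally show ?thesis by simp
    qed (use m p0 in auto)
    show ?thesis using 1 2 by linarith
  qed
  show "\<bar>profile r x - profile r 0\<bar> \<le> 4 * d + 5 * p"
    by (rule fin[OF DERIV_profile[OF r0 r(2)]]) (use near far in \<open>auto simp: profile_ker_def\<close>)
  show "\<bar>upper_profile r x - upper_profile r 0\<bar> \<le> 4 * d + 5 * p"
    by (rule fin[OF DERIV_upper_profile[OF r0 r(2)]]) (use near far in auto)
qed

section \<open>Abel limits along a sequence of radii\<close>

definition radius :: "nat \<Rightarrow> real" where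
  "radius m = 1 - 1 / (real m + 4)"

text \<open>The shift by 4 in \<open>radius\<close> keeps every radius above the
  \<open>1 / 4\<close> demanded by \<open>poisson_ker_near_0\<close>, already from the first
  index.\<close>

lemma radius: "1 / 4 \<le> radius m" "0 \<le> radius m" "radius m < 1"
  by (auto simp: radius_def field_simps)

lemma radius_tendsto: "radius \<longlonglongrightarrow> 1"
  unfolding radius_def by real_asymp

text \<open>With absolute summability the Abel limit is plain dominated convergence for series
  (Tannery).\<close>

lemma radius_series:
  assumes "summable M" "\<And>i. \<bar>a i\<bar> \<le> M i"
  shows "(\<lambda>m. \<Sum>i. radius m ^ Suc i * a i) \<longlonglongrightarrow> (\<Sum>i. a i)"
proof -
  have "(\<lambda>m. radius m ^ Suc i * a i) \<longlonglongrightarrow> 1 ^ Suc i * a i" for i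
    by (intro tendsto_intros radius_tendsto)
  then have "(\<lambda>m. radius m ^ Suc i * a i) \<longlonglongrightarrow> a i" for i by simp
  moreover have "norm (radius m ^ Suc i * a i) \<le> M i" for m i
  proof -
    have "radius m ^ Suc i * \<bar>a i\<bar> \<le> 1 * M i"
      using assms(2) radius[of m] by (intro mult_mono power_le_one) auto
    then show ?thesis using radius[of m] by (simp add: abs_mult)
  qed
  then have "eventually (\<lambda>(i, m). norm (radius m ^ Suc i * a i) \<le> M i) (at_top \<times>\<^sub>F sequentially)"
    by (intro always_eventually) auto
  ultimately show ?thesis
    using tannerys_theorem[where a = "\<lambda>i m. radius m ^ Suc i * a i" and b = a and F = sequentially and M = M,
      OF _ _ assms(1) sequentially_bot] by blast
qed

lemma radius_poisson:
  assumes "c < 1"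
  shows "(\<lambda>m. poisson_ker (radius m) c) \<longlonglongrightarrow> 0"
proof -
  have "(\<lambda>m. poisson_ker (radius m) c) \<longlonglongrightarrow> (1 - 1\<^sup>2) / (1 - 2 * 1 * c + 1\<^sup>2)"
    unfolding poisson_ker_def using assms by (intro tendsto_intros radius_tendsto) auto
  then show ?thesis by simp
qed

lemma inverse_squares_sums_real: "(\<lambda>i. 1 / (real i + 1)\<^sup>2) sums (pi\<^sup>2 / 6)"
  using inverse_squares_sums by (simp add: add.commute)

lemma summable_inverse_squares_pi: "summable (\<lambda>i. 6 / (pi * real (Suc i))\<^sup>2)"
proof -
  have "(\<lambda>i. 6 / pi\<^sup>2 * (1 / (real i + 1)\<^sup>2)) sums (6 / pi\<^sup>2 * (pi\<^sup>2 / 6))"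
    by (intro sums_mult inverse_squares_sums_real)
  then show ?thesis by (auto simp: sums_iff power_mult_distrib add.commute)
qed

lemma alternating_inverse_squares_sums:
  "(\<lambda>i. (- 1) ^ Suc i / (real (Suc i))\<^sup>2) sums (- pi\<^sup>2 / 12)"
proof -
  \<comment> \<open>Adding the plain series kills the odd terms and doubles the even ones, which
    form half of the plain series again: pi squared over 12.\<close>
  let ?f = "\<lambda>i. (1 + (- 1) ^ Suc i) / (real (Suc i))\<^sup>2"
  have "(\<lambda>j. ?f (2 * j + 1)) sums (pi\<^sup>2 / 12)"
  proof -
    have "(\<lambda>j. 1 / 2 * (1 / (real j + 1)\<^sup>2)) sums (1 / 2 * (pi\<^sup>2 / 6))"
      by (intro sums_mult inverse_squares_sums_real)
    moreover have "?f (2 * j + 1) = 1 / 2 * (1 / (real j + 1)\<^sup>2)" for j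
    proof -
      have "real (Suc (2 * j + 1)) = 2 * (real j + 1)" by simp
      then have "(real (Suc (2 * j + 1)))\<^sup>2 = 4 * (real j + 1)\<^sup>2" by (simp only: power_mult_distrib) simp
      then show ?thesis by (simp add: field_simps del: of_nat_Suc)
    qed
    ultimately show ?thesis by simp
  qed
  moreover have "?f i = 0" if "i \<notin> range (\<lambda>j. 2 * j + 1)" for i
  proof -
    have "even i" using that by (metis oddE rangeI)
    then show ?thesis by simp
  qed
  ultimately have "?f sums (pi\<^sup>2 / 12)"
    by (subst (asm) sums_mono_reindex) (auto simp: strict_mono_def)
  then have "(\<lambda>i. ?f i - 1 / (real i + 1)\<^sup>2) sums (pi\<^sup>2 / 12 - pi\<^sup>2 / 6)"
    by (intro sums_diff inverse_squares_sums_real)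
  then show ?thesis by (simp add: add.commute diff_divide_distrib[symmetric])
qed

lemma profile_at_0_1:
  "profile r 0 = 2 / 3 + (\<Sum>i. r ^ Suc i * (wave_coeff (Suc i) / (pi * real (Suc i))\<^sup>2))"
  "profile r 1 = 7 / 6 + (\<Sum>i. r ^ Suc i * (wave_coeff (Suc i) * (- 1) ^ Suc i / (pi * real (Suc i))\<^sup>2))"
  by (simp_all add: profile_def wave_def mult.commute[of pi] mult.assoc del: power_Suc of_nat_Suc)

lemma coeff_bound:
  "\<bar>wave_coeff (Suc i) / (pi * real (Suc i))\<^sup>2\<bar> \<le> 6 / (pi * real (Suc i))\<^sup>2"
  "\<bar>wave_coeff (Suc i) * (- 1) ^ Suc i / (pi * real (Suc i))\<^sup>2\<bar> \<le> 6 / (pi * real (Suc i))\<^sup>2"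
  using abs_wave_coeff[of "Suc i"]
  by (auto simp: abs_divide abs_mult power_abs simp del: of_nat_Suc intro!: divide_right_mono)

text \<open>The series at 0 sums to -1/3 - 1/3 = -2/3, which is the origin of the constant in
  \<open>profile\<close>.\<close>

lemma profile_0_tendsto: "(\<lambda>m. profile (radius m) 0) \<longlonglongrightarrow> 0"
proof -
  have "(\<lambda>i. 4 / pi\<^sup>2 * ((- 1) ^ Suc i / (real (Suc i))\<^sup>2) - 2 / pi\<^sup>2 * (1 / (real i + 1)\<^sup>2)) sums
      (4 / pi\<^sup>2 * (- pi\<^sup>2 / 12) - 2 / pi\<^sup>2 * (pi\<^sup>2 / 6))"
    by (intro sums_diff sums_mult inverse_squares_sums_real alternating_inverse_squares_sums)
  moreover have "4 / pi\<^sup>2 * ((- 1) ^ Suc i / (real (Suc i))\<^sup>2) - 2 / pi\<^sup>2 * (1 / (real i + 1)\<^sup>2) =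
      wave_coeff (Suc i) / (pi * real (Suc i))\<^sup>2" for i
    unfolding wave_coeff_def power_mult_distrib of_nat_Suc by (simp add: field_simps)
  moreover have "4 / pi\<^sup>2 * (- pi\<^sup>2 / 12) - 2 / pi\<^sup>2 * (pi\<^sup>2 / 6) = - 2 / 3" by (simp add: field_simps)
  ultimately have "(\<Sum>i. wave_coeff (Suc i) / (pi * real (Suc i))\<^sup>2) = - 2 / 3" by (simp add: sums_iff)
  note L = this
  show ?thesis
    using tendsto_add[OF tendsto_const[of "2 / 3 :: real"] radius_series[OF summable_inverse_squares_pi coeff_bound(1)]]
    unfolding profile_at_0_1 L by simp
qed

text \<open>Here 7/6 + 5/6 = 2: the midpoint of the jump from 0 to 4, and also the odd-phase value
  at level 0.\<close>

lemma profile_1_tendsto: "(\<lambda>m. profile (radius m) 1) \<longlonglongrightarrow> 2"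
proof -
  have "(\<lambda>i. 4 / pi\<^sup>2 * (1 / (real i + 1)\<^sup>2) - 2 / pi\<^sup>2 * ((- 1) ^ Suc i / (real (Suc i))\<^sup>2)) sums
      (4 / pi\<^sup>2 * (pi\<^sup>2 / 6) - 2 / pi\<^sup>2 * (- pi\<^sup>2 / 12))"
    by (intro sums_diff sums_mult inverse_squares_sums_real alternating_inverse_squares_sums)
  moreover have "4 / pi\<^sup>2 * (1 / (real i + 1)\<^sup>2) - 2 / pi\<^sup>2 * ((- 1) ^ Suc i / (real (Suc i))\<^sup>2) =
      wave_coeff (Suc i) * (- 1) ^ Suc i / (pi * real (Suc i))\<^sup>2" for i
    unfolding wave_coeff_def power_mult_distrib of_nat_Suc
    by (cases "even i") (simp_all add: field_simps)
  moreover have "4 / pi\<^sup>2 * (pi\<^sup>2 / 6) - 2 / pi\<^sup>2 * (- pi\<^sup>2 / 12) = 5 / 6" by (simp add: field_simps)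
  ultimately have "(\<Sum>i. wave_coeff (Suc i) * (- 1) ^ Suc i / (pi * real (Suc i))\<^sup>2) = 5 / 6"
    by (simp only: sums_iff)
  note L = this
  show ?thesis
    using tendsto_add[OF tendsto_const[of "7 / 6 :: real"] radius_series[OF summable_inverse_squares_pi coeff_bound(2)]]
    unfolding profile_at_0_1 L by simp
qed

lemma abs_profile_0_1:
  assumes "0 \<le> r" "r < 1"
  shows "\<bar>profile r 0\<bar> \<le> 2" "\<bar>profile r 1\<bar> \<le> 3"
proof -
  have s: "(\<lambda>i. 6 / (pi * real (Suc i))\<^sup>2) sums 1"
    using sums_mult[OF inverse_squares_sums_real, of "6 / pi\<^sup>2"]
    by (simp add: power_mult_distrib add.commute)
  have b: "\<bar>\<Sum>i. r ^ Suc i * a i\<bar> \<le> 1" if "\<And>i. \<bar>a i\<bar> \<le> 6 / (pi * real (Suc i))\<^sup>2" for a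
  proof -
    have t: "\<bar>r ^ Suc i * a i\<bar> \<le> 6 / (pi * real (Suc i))\<^sup>2" for i
    proof -
      have "r ^ Suc i * \<bar>a i\<bar> \<le> 1 * \<bar>a i\<bar>" using assms by (intro mult_right_mono power_le_one) auto
      then show ?thesis using that[of i] assms by (simp add: abs_mult)
    qed
    have "summable (\<lambda>i. \<bar>r ^ Suc i * a i\<bar>)"
      by (rule summable_comparison_test[OF _ sums_summable[OF s]]) (use t in auto)
    then have "\<bar>\<Sum>i. r ^ Suc i * a i\<bar> \<le> (\<Sum>i. \<bar>r ^ Suc i * a i\<bar>)" by (rule summable_rabs)
    also have "\<dots> \<le> (\<Sum>i. 6 / (pi * real (Suc i))\<^sup>2)"
      by (rule suminf_le[OF t \<open>summable (\<lambda>i. \<bar>r ^ Suc i * a i\<bar>)\<close> sums_summable[OF s]])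
    also have "\<dots> = 1" using s by (rule sums_unique[symmetric])
    finally show ?thesis .
  qed
  show "\<bar>profile r 0\<bar> \<le> 2" "\<bar>profile r 1\<bar> \<le> 3"
    unfolding profile_at_0_1 using b[OF coeff_bound(1)] b[OF coeff_bound(2)] unfolding abs_le_iff by linarith+
qed

lemma abs_profile_le:
  assumes r: "0 \<le> r" "r < 1" and x: "0 \<le> x" "x \<le> 1"
  shows "\<bar>profile r x\<bar> \<le> 5" "\<bar>upper_profile r x\<bar> \<le> 6"
proof -
  have "upper_profile r 0 = profile r 1" by (simp add: upper_profile_def)
  then show "\<bar>profile r x\<bar> \<le> 5" "\<bar>upper_profile r x\<bar> \<le> 6"
    using profile_variation[OF assms] abs_profile_0_1[OF r] by linarith+
qed

lemma abs_profile_le_17: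
  assumes r: "0 \<le> r" "r < 1" and x: "0 \<le> x" "x \<le> 2"
  shows "\<bar>profile r x\<bar> \<le> 17"
proof (cases "x \<le> 1")
  case True then show ?thesis using abs_profile_le(1)[OF r x(1)] by simp
next
  case False
  \<comment> \<open>Reflection at 1, which gives 2 * 6 + 5 = 17.\<close>
  have "profile r x = 2 * upper_profile r (x - 1) - profile r (2 - x)"
    by (simp add: upper_profile_def add_divide_distrib)
  then show ?thesis using abs_profile_le(2)[OF r, of "x - 1"] abs_profile_le(1)[OF r, of "2 - x"] False x by simp
qed

text \<open>By \<open>profile_shift\<close> the differences of step 2 grow by at most 4 at a time,
  starting from 17 + 17, so the growth is quadratic with constants free of \<open>r\<close>. This is
  the dominating function for the limit in the radius.\<close>

lemma profile_growth:
  assumes r: "0 \<le> r" "r < 1"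
  shows "\<bar>profile r y\<bar> \<le> 60 * (1 + y\<^sup>2)"
proof -
  have P: "\<bar>profile r (x + 2 * real j) - profile r (x + 2 * real j - 2)\<bar> \<le> 34 + 4 * real j \<and>
      \<bar>profile r (x + 2 * real j)\<bar> \<le> 17 + (34 + 4 * real j) * real j"
    if x: "0 \<le> x" "x \<le> 2" for x j
  proof (induction j)
    case 0
    have "profile r (x - 2) = profile r (2 - x)" using profile_minus[of r "2 - x"] by simp
    then show ?case using abs_profile_le_17[OF r x] abs_profile_le_17[OF r, of "2 - x"] x by simp
  next
    case (Suc j)
    define a where "a = x + 2 * real j"
    have a: "x + 2 * real (Suc j) = a + 2" "x + 2 * real (Suc j) - 2 = a" by (simp_all add: a_def)
    have "profile r (a + 2) + profile r (a - 2) = 2 * profile r a + 4" by (rule profile_shift[OF r])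
    moreover have "\<bar>profile r a - profile r (a - 2)\<bar> \<le> 34 + 4 * real j"
       "\<bar>profile r a\<bar> \<le> 17 + (34 + 4 * real j) * real j" using Suc by (simp_all add: a_def)
    ultimately have "\<bar>profile r (a + 2) - profile r a\<bar> \<le> 34 + 4 * real j + 4"
      "\<bar>profile r (a + 2)\<bar> \<le> 17 + (34 + 4 * real j) * real j + (34 + 4 * real j + 4)"
      unfolding abs_le_iff by linarith+
    then show ?case unfolding a by (simp add: algebra_simps)
  qed
  have "\<bar>profile r y\<bar> \<le> 60 * (1 + y\<^sup>2)" if y: "0 \<le> y" for y
  proof -
    define j where "j = nat \<lfloor>y / 2\<rfloor>"
    have j: "2 * real j \<le> y" "y \<le> 2 * real j + 2" using y unfolding j_def by linarith+
    have "\<bar>profile r y\<bar> \<le> 17 + (34 + 4 * real j) * real j"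
    proof -
      have "\<bar>profile r (y - 2 * real j + 2 * real j)\<bar> \<le> 17 + (34 + 4 * real j) * real j"
        by (rule P[THEN conjunct2]) (use j in auto)
      then show ?thesis by simp
    qed
    also have "\<dots> \<le> 17 + (34 + 2 * y) * (y / 2)"
      by (rule add_left_mono, rule mult_mono) (use j y in auto)
    also have "\<dots> \<le> 60 * (1 + y\<^sup>2)"
    proof -
      have "0 \<le> (y - 1)\<^sup>2" by simp
      then have "2 * y \<le> 1 + y\<^sup>2" by (simp add: power2_eq_square algebra_simps)
      moreover have "(34 + 2 * y) * (y / 2) = 17 * y + y\<^sup>2"
        by (simp add: power2_eq_square algebra_simps)
      moreover have "0 \<le> y\<^sup>2" by simp
      ultimately show ?thesis by argo
    qed
    finally show ?thesis .
  qed
  from this[of "\<bar>y\<bar>"] show ?thesis using profile_minus[of r y] by (cases "y \<ge> 0") auto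
qed

text \<open>The jump of \<open>step_profile\<close> at \<open>\<bar>y\<bar> = k\<close> is \<open>4 * k\<close> if \<open>k\<close> is odd and \<open>- 2 * k\<close> if \<open>k\<close> is even.\<close>

definition step_value :: "nat \<Rightarrow> real" where
  "step_value l = (if even l then real l * (real l - 2) / 2 else (real l + 1) * (real l + 3) / 2)"

definition step_profile :: "real \<Rightarrow> real" where
  "step_profile y = step_value (nat \<lfloor>\<bar>y\<bar>\<rfloor>)"

lemma profile_tendsto_0:
  assumes x: "0 \<le> x" "x < 1"
  shows "(\<lambda>m. profile (radius m) x) \<longlonglongrightarrow> 0" "(\<lambda>m. upper_profile (radius m) x) \<longlonglongrightarrow> 2"
proof -
  have main: "f \<longlonglongrightarrow> L" if g: "g \<longlonglongrightarrow> L"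
    and fg: "\<And>d m. 0 < d \<Longrightarrow> d \<le> 1 / 2 \<Longrightarrow> x \<le> 1 - d \<Longrightarrow>
      \<bar>f m - g m\<bar> \<le> 4 * d + 5 * poisson_ker (radius m) (cos (pi * d))" for f g :: "nat \<Rightarrow> real" and L
  proof -
    have "(\<lambda>m. f m - g m) \<longlonglongrightarrow> 0"
    proof (rule tendstoI)
      fix e :: real assume e: "e > 0"
      \<comment> \<open>\<open>d\<close> is chosen first to make \<open>4 * d\<close> at most half
        of \<open>e\<close>; the radius then makes the kernel term less than the other half.\<close>
      define d where "d = min (min (1 / 2) (1 - x)) (e / 8)"
      have d: "0 < d" "d \<le> 1 / 2" "x \<le> 1 - d" "4 * d \<le> e / 2" using e x by (auto simp: d_def min_def)
      have "cos (pi * d) < 1" using d pi_gt_zero cos_monotone_0_pi[of 0 "pi * d"] mult_left_mono[of d 1 pi] by auto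
      then have "eventually (\<lambda>m. poisson_ker (radius m) (cos (pi * d)) < e / 10) sequentially"
        using radius_poisson e by (intro order_tendstoD(2)[where a = "e / 10"]) auto
      then show "eventually (\<lambda>m. dist (f m - g m) 0 < e) sequentially"
      proof eventually_elim
        case (elim m)
        have "\<bar>f m - g m\<bar> < e" using fg[OF d(1-3), of m] d(4) elim by argo
        then show ?case by (simp add: dist_real_def)
      qed
    qed
    from tendsto_add[OF this g] show ?thesis by simp
  qed
  show "(\<lambda>m. profile (radius m) x) \<longlonglongrightarrow> 0"
    by (rule main[OF profile_0_tendsto]) (use x profile_near(1) radius in auto)
  show "(\<lambda>m. upper_profile (radius m) x) \<longlonglongrightarrow> 2"
    by (rule main[where g = "\<lambda>m. upper_profile (radius m) 0"])
      (use x profile_near(2) radius profile_1_tendsto in \<open>auto simp: upper_profile_def\<close>)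
qed

lemma step_value_rec:
  assumes "l \<ge> 4" shows "step_value l + step_value (l - 4) = 2 * step_value (l - 2) + 4"
proof -
  obtain k where "l = k + 4" using assms by (metis le_add_diff_inverse2)
  then show ?thesis by (cases "even k") (auto simp: step_value_def field_simps)
qed

text \<open>Integers must be excluded: for \<open>y < 4\<close> the floor is applied to
  \<open>4 - y\<close>, and at an integer this lands on the other side of a jump.\<close>

lemma step_profile_shift:
  assumes "y \<ge> 2" "y \<notin> \<int>"
  shows "step_profile y = 2 * step_profile (y - 2) - step_profile (y - 4) + 4"
proof -
  define l where "l = nat \<lfloor>y\<rfloor>"
  have fl: "\<lfloor>y\<rfloor> = int l" using assms by (simp add: l_def)
  have l: "l \<ge> 2" using assms by (simp add: l_def le_nat_iff le_floor_iff)
  have y2: "step_profile y = step_value l" "step_profile (y - 2) = step_value (l - 2)"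
    using assms l by (auto simp: step_profile_def fl floor_diff_numeral nat_diff_distrib)
  consider "l = 2" | "l = 3" | "l \<ge> 4" using l by linarith
  then show ?thesis
  proof cases
    case 3
    then have "y \<ge> 4" using fl by linarith
    moreover have "nat (int l - 4) = l - 4" by arith
    ultimately have "step_profile (y - 4) = step_value (l - 4)"
      by (auto simp: step_profile_def fl floor_diff_numeral nat_diff_distrib)
    then show ?thesis using step_value_rec[OF 3] y2 by simp
  next
    case 1
    have "2 \<le> y" "y < 3" "y \<noteq> 2" using fl 1 assms by (auto simp: floor_eq_iff)
    then have "\<lfloor>\<bar>y - 4\<bar>\<rfloor> = 1" by (auto simp: floor_eq_iff)
    then show ?thesis unfolding y2 using 1 by (simp add: step_profile_def step_value_def)
  next
    case 2
    have "3 \<le> y" "y < 4" "y \<noteq> 3" using fl 2 assms by (auto simp: floor_eq_iff)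
    then have "\<lfloor>\<bar>y - 4\<bar>\<rfloor> = 0" by (auto simp: floor_eq_iff)
    then show ?thesis unfolding y2 using 2 by (simp add: step_profile_def step_value_def)
  qed
qed

text \<open>The recurrence reduces \<open>y\<close> to \<open>y - 2\<close> and, by evenness, to the
  modulus of \<open>y - 4\<close>; both have a smaller integer part. The intervals [0, 1) and (1, 2)
  are the base, the latter through \<open>upper_profile\<close>.\<close>

lemma profile_tendsto:
  assumes "y \<notin> \<int>"
  shows "(\<lambda>m. profile (radius m) y) \<longlonglongrightarrow> step_profile y"
proof -
  have "y \<ge> 0 \<Longrightarrow> y \<notin> \<int> \<Longrightarrow> (\<lambda>m. profile (radius m) y) \<longlonglongrightarrow> step_profile y" for y
  proof (induction "nat \<lfloor>y\<rfloor>" arbitrary: y rule: less_induct)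
    case less
    consider "y < 1" | "1 \<le> y" "y < 2" | "2 \<le> y" by linarith
    then show ?case
    proof cases
      case 1
      then have "\<lfloor>y\<rfloor> = 0" using less by (auto simp: floor_eq_iff)
      then show ?thesis using profile_tendsto_0(1)[of y] 1 less by (simp add: step_profile_def step_value_def)
    next
      case 2
      then have f: "\<lfloor>y\<rfloor> = 1" by (auto simp: floor_eq_iff)
      have "y \<noteq> 1" using less by auto
      then have "(\<lambda>m. 2 * upper_profile (radius m) (y - 1) - profile (radius m) (2 - y)) \<longlonglongrightarrow> 2 * 2 - 0"
        using 2 by (intro tendsto_intros profile_tendsto_0) auto
      then show ?thesis using f 2
        by (simp add: upper_profile_def step_profile_def step_value_def add_divide_distrib)
    next
      case 3
      have y2: "y - 2 \<notin> \<int>" and y4: "\<bar>y - 4\<bar> \<notin> \<int>"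
        using less(3) Ints_add[of "y - 2" 2] Ints_add[of "y - 4" 4] Ints_diff[of 4 "4 - y"]
        by (auto simp: abs_if split: if_splits)
      have l2: "nat \<lfloor>y - 2\<rfloor> < nat \<lfloor>y\<rfloor>" using 3 by (simp add: floor_diff_numeral)
      have l4: "nat \<lfloor>\<bar>y - 4\<bar>\<rfloor> < nat \<lfloor>y\<rfloor>"
      proof (cases "y \<ge> 4")
        case True then show ?thesis by (simp add: floor_diff_numeral)
      next
        case False
        have "y \<noteq> 2" using less by auto
        then have "\<bar>y - 4\<bar> < 2" "0 \<le> \<bar>y - 4\<bar>" using False 3 by auto
        then have "\<lfloor>\<bar>y - 4\<bar>\<rfloor> < 2" by linarith
        moreover have "\<lfloor>y\<rfloor> \<ge> 2" using 3 by linarith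
        ultimately show ?thesis by linarith
      qed
      have "(\<lambda>m. profile (radius m) (y - 2)) \<longlonglongrightarrow> step_profile (y - 2)"
        using less(1)[OF l2 _ y2] 3 by simp
      moreover have "(\<lambda>m. profile (radius m) \<bar>y - 4\<bar>) \<longlonglongrightarrow> step_profile \<bar>y - 4\<bar>"
        using less(1)[OF l4 _ y4] by simp
      then have "(\<lambda>m. profile (radius m) (y - 4)) \<longlonglongrightarrow> step_profile (y - 4)"
        using profile_minus[of _ "y - 4"] by (auto simp: step_profile_def abs_if split: if_splits)
      ultimately have "(\<lambda>m. 2 * profile (radius m) (y - 2) - profile (radius m) (y - 4) + 4) \<longlonglongrightarrow>
          2 * step_profile (y - 2) - step_profile (y - 4) + 4"
        by (intro tendsto_intros)
      moreover have "2 * profile (radius m) (y - 2) - profile (radius m) (y - 4) + 4 = profile (radius m) y" for m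
        using profile_shift[OF radius(2,3), of m "y - 2"] by simp
      ultimately show ?thesis using step_profile_shift[OF 3 less(3)] by simp
    qed
  qed
  from this[of "\<bar>y\<bar>"] have "(\<lambda>m. profile (radius m) \<bar>y\<bar>) \<longlonglongrightarrow> step_profile \<bar>y\<bar>"
    using assms by (simp add: abs_if)
  then show ?thesis using profile_minus[of _ y] by (auto simp: step_profile_def abs_if split: if_splits)
qed

subsection \<open>Gaussian expectations\<close>

definition gauss :: "real \<Rightarrow> real measure" where
  "gauss s = density lborel (\<lambda>x. ennreal (normal_density 0 s x))"

lemma sets_gauss[simp, measurable_cong]: "sets (gauss s) = sets borel"
  by (simp add: gauss_def)

lemma space_gauss[simp]: "space (gauss s) = UNIV"
  by (simp add: gauss_def)

lemma prob_space_gauss: "0 < s \<Longrightarrow> prob_space (gauss s)"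
  unfolding gauss_def by (rule prob_space_normal_density)

lemma distr_eq_gauss:
  assumes "distributed M lborel X (normal_density 0 s)"
  shows "distr M borel X = gauss s"
  using distributed_distr_eq_density[OF assms] distr_cong[of M M borel lborel X X] by (simp add: gauss_def)

lemma gauss_scale:
  assumes s: "0 < s" shows "gauss s = distr (gauss 1) borel (\<lambda>x. s * x)"
proof -
  interpret prob_space "gauss 1" by (rule prob_space_gauss) simp
  have "distributed (gauss 1) lborel (\<lambda>x. x) (normal_density 0 1)"
    unfolding distributed_def using distr_id2[of lborel "gauss 1"] by (auto simp: gauss_def)
  from normal_density_affine[OF this, of s 0] s
  have "distributed (gauss 1) lborel (\<lambda>x. s * x) (normal_density 0 s)" by simp
  then show ?thesis using distr_eq_gauss by metis
qed

lemma integral_gauss: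
  fixes f :: "real \<Rightarrow> real"
  assumes [measurable]: "f \<in> borel_measurable borel"
  shows "integral\<^sup>L (gauss s) f = (\<integral>x. normal_density 0 s x * f x \<partial>lborel)"
    "integrable (gauss s) f \<longleftrightarrow> integrable lborel (\<lambda>x. normal_density 0 s x * f x)"
  unfolding gauss_def by (auto simp: integral_density integrable_density)

lemma gauss_moments:
  assumes s: "0 < s"
  shows "integrable (gauss s) (\<lambda>x. x ^ k)" "integrable (gauss s) (\<lambda>x. \<bar>x\<bar> ^ k)"
    "(\<integral>x. x\<^sup>2 \<partial>gauss s) = s\<^sup>2" "(\<integral>x. x ^ 4 \<partial>gauss s) = 3 * s ^ 4" "(\<integral>x. x \<partial>gauss s) = 0"
proof -
  show "integrable (gauss s) (\<lambda>x. x ^ k)" "integrable (gauss s) (\<lambda>x. \<bar>x\<bar> ^ k)"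
    using integrable_normal_moment[OF s, of 0 k] integrable_normal_moment_abs[OF s, of 0 k]
    by (simp_all add: integral_gauss)
  show "(\<integral>x. x\<^sup>2 \<partial>gauss s) = s\<^sup>2" "(\<integral>x. x ^ 4 \<partial>gauss s) = 3 * s ^ 4" "(\<integral>x. x \<partial>gauss s) = 0"
    using integral_normal_moment_even[OF s, of 0 1] integral_normal_moment_even[OF s, of 0 2]
      integral_normal_moment_odd[OF s, of 0 0]
    by (simp_all add: integral_gauss fact_numeral power_mult_distrib divide_simps flip: power_mult)
qed

lemma gauss_minus:
  fixes f :: "real \<Rightarrow> real"
  assumes [measurable]: "f \<in> borel_measurable borel"
  shows "(\<integral>x. f (- x) \<partial>gauss s) = integral\<^sup>L (gauss s) f"
proof -
  have "(\<integral>x. f (- x) \<partial>gauss s) = (\<integral>x. normal_density 0 s x * f (- x) \<partial>lborel)"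
    by (rule integral_gauss) measurable
  also have "\<dots> = (\<integral>x. normal_density 0 s x * f x \<partial>lborel)"
    by (subst lborel_integral_real_affine[where c = "- 1" and t = 0]) (auto simp: normal_density_def)
  also have "\<dots> = integral\<^sup>L (gauss s) f" by (rule integral_gauss[symmetric]) measurable
  finally show ?thesis .
qed

lemma AE_gauss_not_Ints: "AE y in gauss s. y \<notin> \<int>"
proof -
  have "countable (\<int> :: real set)" by (simp add: Ints_def)
  then have "AE y in lborel. y \<notin> (\<int> :: real set)"
    using countable_imp_null_set_lborel AE_not_in by blast
  then show ?thesis unfolding gauss_def by (subst AE_density) auto
qed

lemma gauss_cos:
  assumes s: "0 < s" shows "(\<integral>x. cos (a * x) \<partial>gauss s) = exp (- (a * s)\<^sup>2 / 2)"
proof -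
  have std: "(\<integral>x. cos (b * x) \<partial>gauss 1) = exp (- b\<^sup>2 / 2)" for b
  proof -
    interpret prob_space "gauss 1" by (rule prob_space_gauss) simp
    have i: "integrable (gauss 1) (\<lambda>x. iexp (b * x))"
      by (rule integrable_const_bound[where B = 1]) auto
    have "char (gauss 1) b = complex_of_real (exp (- b\<^sup>2 / 2))"
      using char_std_normal_distribution by (simp add: gauss_def)
    then have "Re (\<integral>x. iexp (b * x) \<partial>gauss 1) = exp (- b\<^sup>2 / 2)" unfolding char_def by simp
    moreover have "Re (\<integral>x. iexp (b * x) \<partial>gauss 1) = (\<integral>x. Re (iexp (b * x)) \<partial>gauss 1)"
      using i by (rule integral_Re[symmetric])
    ultimately show ?thesis by (simp add: Re_exp)
  qed
  show ?thesis unfolding gauss_scale[OF s]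
    using std[of "a * s"] by (simp add: integral_distr mult.assoc)
qed

text \<open>Gaussian integration by parts (Stein's identity):
  \<open>std_normal_density x * sin (b * x)\<close> vanishes at both infinities, so its derivative
  integrates to 0 and the claim reduces to \<open>gauss_cos\<close>.\<close>

lemma gauss_mult_sin:
  assumes s: "0 < s" shows "(\<integral>x. x * sin (a * x) \<partial>gauss s) = a * s\<^sup>2 * exp (- (a * s)\<^sup>2 / 2)"
proof -
  have std: "(\<integral>x. x * sin (b * x) \<partial>gauss 1) = b * exp (- b\<^sup>2 / 2)" for b
  proof -
    interpret prob_space "gauss 1" by (rule prob_space_gauss) simp
    have i1: "integrable (gauss 1) (\<lambda>x. b * cos (b * x))"
      by (rule integrable_const_bound[where B = "\<bar>b\<bar>"]) (auto simp: abs_mult intro!: AE_I2 mult_left_le)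
    have i2: "integrable (gauss 1) (\<lambda>x. x * sin (b * x))"
      by (rule Bochner_Integration.integrable_bound[OF gauss_moments(2)[of 1 1]])
        (auto simp: abs_mult intro!: AE_I2 mult_left_le)
    let ?F = "\<lambda>x. std_normal_density x * sin (b * x)"
    let ?f = "\<lambda>x. std_normal_density x * (b * cos (b * x) - x * sin (b * x))"
    have d: "(?F has_real_derivative ?f x) (at x)" for x
    proof -
      define k where "k = 1 / sqrt (2 * pi)"
      show ?thesis unfolding std_normal_density_def k_def[symmetric]
        by (auto intro!: derivative_eq_intros simp: algebra_simps)
    qed
    have lim: "(std_normal_density \<longlongrightarrow> 0) at_top" "(std_normal_density \<longlongrightarrow> 0) at_bot"
      unfolding std_normal_density_def by real_asymp+
    have le: "norm (?F x) \<le> std_normal_density x" for x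
      using mult_left_mono[of "\<bar>sin (b * x)\<bar>" 1 "std_normal_density x"] by (simp add: abs_mult)
    have "(LBINT x=-\<infinity>..\<infinity>. ?f x) = 0 - 0"
    proof (rule interval_integral_FTC_integrable)
      show "(?F has_vector_derivative ?f x) (at x)" for x
        using d by (simp add: has_real_derivative_iff_has_vector_derivative)
      show "isCont ?f x" for x unfolding std_normal_density_def by (intro continuous_intros) auto
      have "integrable (gauss 1) (\<lambda>x. b * cos (b * x) - x * sin (b * x))"
        using i1 i2 by (rule Bochner_Integration.integrable_diff)
      then have "integrable lborel ?f" by (simp add: integral_gauss)
      then show "set_integrable lborel (einterval (-\<infinity>) \<infinity>) ?f" by (simp add: set_integrable_def)
      have "(?F \<longlongrightarrow> 0) at_bot" by (rule Lim_null_comparison[OF _ lim(2)]) (use le in auto)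
      then show "((?F \<circ> real_of_ereal) \<longlongrightarrow> 0) (at_right (-\<infinity>))"
        by (simp add: ereal_tendsto_simps)
      have "(?F \<longlongrightarrow> 0) at_top" by (rule Lim_null_comparison[OF _ lim(1)]) (use le in auto)
      then show "((?F \<circ> real_of_ereal) \<longlongrightarrow> 0) (at_left \<infinity>)"
        by (simp add: ereal_tendsto_simps)
    qed auto
    then have "integral\<^sup>L lborel ?f = 0"
      by (simp add: interval_lebesgue_integral_def set_lebesgue_integral_def)
    then have "(\<integral>x. b * cos (b * x) - x * sin (b * x) \<partial>gauss 1) = 0" by (simp add: integral_gauss)
    then have "b * (\<integral>x. cos (b * x) \<partial>gauss 1) - (\<integral>x. x * sin (b * x) \<partial>gauss 1) = 0"
      using i1 i2 by simp
    then show ?thesis by (simp add: gauss_cos)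
  qed
  have "(\<integral>x. x * sin (a * x) \<partial>gauss s) = s * (\<integral>x. x * sin (a * s * x) \<partial>gauss 1)"
    unfolding gauss_scale[OF s] by (simp add: integral_distr mult.assoc)
  then show ?thesis unfolding std by (simp add: power2_eq_square)
qed

section \<open>Two expansions of the Gaussian mean of the step function\<close>

definition series_term :: "real \<Rightarrow> nat \<Rightarrow> real" where
  "series_term s k = wave_coeff k * (exp (- (pi * real k * s)\<^sup>2 / 2) * (1 / (pi * real k)\<^sup>2 + s\<^sup>2))"

lemma borel_measurable_wave[measurable]: "wave k \<in> borel_measurable borel"
  unfolding wave_def[abs_def] by measurable

lemma borel_measurable_profile:
  assumes "0 \<le> r" "r < 1" shows "profile r \<in> borel_measurable borel"
  by (intro borel_measurable_continuous_onI continuous_at_imp_continuous_on ballI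
      DERIV_isCont[OF DERIV_profile[OF assms]])

lemma gauss_wave:
  assumes s: "0 < s"
  shows "integrable (gauss s) (wave (Suc i))"
    "wave_coeff (Suc i) * (\<integral>x. wave (Suc i) x \<partial>gauss s) = series_term s (Suc i)"
proof -
  interpret prob_space "gauss s" by (rule prob_space_gauss[OF s])
  let ?a = "pi * real (Suc i)"
  have i1: "integrable (gauss s) (\<lambda>x. cos (?a * x) / ?a\<^sup>2)"
    by (intro integrable_divide integrable_const_bound[where B = 1]) auto
  have i2: "integrable (gauss s) (\<lambda>x. x * sin (?a * x) / ?a)"
    by (intro integrable_divide, rule Bochner_Integration.integrable_bound[OF gauss_moments(2)[of s 1]])
      (use s in \<open>auto simp: abs_mult intro!: AE_I2 mult_left_le\<close>)
  show "integrable (gauss s) (wave (Suc i))"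
    unfolding wave_def[abs_def] using i1 i2 by (rule Bochner_Integration.integrable_add)
  have "(\<integral>x. wave (Suc i) x \<partial>gauss s) =
      (\<integral>x. cos (?a * x) \<partial>gauss s) / ?a\<^sup>2 + (\<integral>x. x * sin (?a * x) \<partial>gauss s) / ?a"
    unfolding wave_def using i1 i2 by (simp del: of_nat_Suc)
  also have "\<dots> = exp (- (?a * s)\<^sup>2 / 2) / ?a\<^sup>2 + ?a * s\<^sup>2 * exp (- (?a * s)\<^sup>2 / 2) / ?a"
    by (simp only: gauss_cos[OF s] gauss_mult_sin[OF s])
  also have "\<dots> = exp (- (?a * s)\<^sup>2 / 2) * (1 / ?a\<^sup>2 + s\<^sup>2)"
    by (simp add: distrib_left del: of_nat_Suc)
  finally show "wave_coeff (Suc i) * (\<integral>x. wave (Suc i) x \<partial>gauss s) = series_term s (Suc i)"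
    by (simp add: series_term_def del: of_nat_Suc)
qed

lemma gauss_profile:
  assumes s: "0 < s" and r: "0 \<le> r" "r < 1"
  shows "(\<integral>y. profile r y \<partial>gauss s) = s\<^sup>2 / 2 + 2 / 3 + (\<Sum>i. r ^ Suc i * series_term s (Suc i))"
proof -
  interpret prob_space "gauss s" by (rule prob_space_gauss[OF s])
  let ?f = "\<lambda>i y. r ^ Suc i * wave_coeff (Suc i) * wave (Suc i) y"
  have i: "integrable (gauss s) (?f i)" for i by (intro integrable_mult_right gauss_wave s)
  have i1: "integrable (gauss s) (\<lambda>y. 1 + \<bar>y\<bar>)"
    using gauss_moments(2)[OF s, of 1] by simp
  have b: "norm (?f i y) \<le> r ^ Suc i * (6 * (1 + \<bar>y\<bar>))" for i y
    unfolding real_norm_def abs_mult mult.assoc using r abs_wave_coeff[of "Suc i"] abs_wave_le[of i y]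
    by (intro mult_mono) (auto simp: power_abs)
  have g: "summable (\<lambda>i. r ^ Suc i)" using r by (subst summable_Suc_iff) (auto intro: summable_geometric)
  have "summable (\<lambda>i. \<integral>y. norm (?f i y) \<partial>gauss s)"
  proof (rule summable_comparison_test)
    have "(\<integral>y. norm (?f i y) \<partial>gauss s) \<le> (\<integral>y. r ^ Suc i * (6 * (1 + \<bar>y\<bar>)) \<partial>gauss s)" for i
      by (intro integral_mono integrable_norm i integrable_mult_right i1 b)
    then show "\<exists>N. \<forall>n\<ge>N. norm (\<integral>y. norm (?f n y) \<partial>gauss s) \<le> r ^ Suc n * (\<integral>y. 6 * (1 + \<bar>y\<bar>) \<partial>gauss s)"
      by simp
    show "summable (\<lambda>n. r ^ Suc n * (\<integral>y. 6 * (1 + \<bar>y\<bar>) \<partial>gauss s))" using g by (rule summable_mult2)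
  qed
  moreover have "AE y in gauss s. summable (\<lambda>i. norm (?f i y))"
  proof (rule AE_I2)
    fix y show "summable (\<lambda>i. norm (?f i y))"
      by (rule summable_comparison_test[OF _ summable_mult2[OF g, of "6 * (1 + \<bar>y\<bar>)"]])
        (use b in auto)
  qed
  ultimately have sm: "integrable (gauss s) (\<lambda>y. \<Sum>i. ?f i y)"
    "(\<integral>y. (\<Sum>i. ?f i y) \<partial>gauss s) = (\<Sum>i. \<integral>y. ?f i y \<partial>gauss s)"
    using integrable_suminf[OF i] integral_suminf[OF i] by auto
  have i2: "integrable (gauss s) (\<lambda>y. y\<^sup>2 / 2 + 2 / 3)" using gauss_moments(1)[OF s, of 2] by simp
  have "(\<integral>y. profile r y \<partial>gauss s) = (\<integral>y. y\<^sup>2 / 2 + 2 / 3 \<partial>gauss s) + (\<integral>y. (\<Sum>i. ?f i y) \<partial>gauss s)"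
    unfolding profile_def using i2 sm(1) by (rule Bochner_Integration.integral_add)
  also have "(\<integral>y. y\<^sup>2 / 2 + 2 / 3 \<partial>gauss s) = s\<^sup>2 / 2 + 2 / 3"
    using gauss_moments(1)[OF s, of 2] gauss_moments(3)[OF s] prob_space by simp
  also have "(\<integral>y. (\<Sum>i. ?f i y) \<partial>gauss s) = (\<Sum>i. r ^ Suc i * series_term s (Suc i))"
    unfolding sm(2) by (simp add: gauss_wave(2)[OF s, symmetric] mult.assoc)
  finally show ?thesis .
qed

text \<open>Uniform in \<open>s\<close>, because \<open>exp (- x) * x \<le> 1\<close> at
  \<open>x = (a * s)\<^sup>2 / 2\<close> absorbs the factor \<open>s\<^sup>2\<close>. One bound thus
  dominates both the Abel limit and the limit in \<open>s\<close>.\<close>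

lemma abs_series_term: "\<bar>series_term s (Suc i)\<bar> \<le> 3 * (6 / (pi * real (Suc i))\<^sup>2)"
proof -
  define a where "a = pi * real (Suc i)"
  have a: "a > 0" by (simp add: a_def)
  define x where "x = (a * s)\<^sup>2 / 2"
  have x: "0 \<le> x" by (simp add: x_def)
  have "exp (- x) * x \<le> 1"
  proof -
    have "x \<le> exp x" using exp_ge_add_one_self[of x] by linarith
    then show ?thesis by (simp add: exp_minus field_simps)
  qed
  then have "exp (- x) * s\<^sup>2 \<le> 2 / a\<^sup>2" using a by (simp add: x_def field_simps power_mult_distrib)
  moreover have "exp (- x) * (1 / a\<^sup>2) \<le> 1 * (1 / a\<^sup>2)" using x by (intro mult_right_mono) auto
  ultimately have "exp (- x) * (1 / a\<^sup>2 + s\<^sup>2) \<le> 3 / a\<^sup>2" by (simp add: distrib_left add_divide_distrib[symmetric])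
  moreover have "\<bar>series_term s (Suc i)\<bar> = \<bar>wave_coeff (Suc i)\<bar> * (exp (- x) * (1 / a\<^sup>2 + s\<^sup>2))"
    unfolding series_term_def a_def[symmetric] x_def by (simp add: abs_mult)
  ultimately have "\<bar>series_term s (Suc i)\<bar> \<le> 6 * (3 / a\<^sup>2)"
    using abs_wave_coeff[of "Suc i"] by (simp only:) (intro mult_mono; simp)
  then show ?thesis by (simp add: a_def)
qed

lemma summable_series_term: "summable (\<lambda>i. series_term s (Suc i))"
  by (rule summable_comparison_test[OF _ summable_mult[OF summable_inverse_squares_pi, of 3]])
    (use abs_series_term in auto)

lemma borel_measurable_step_profile[measurable]: "step_profile \<in> borel_measurable borel"
  unfolding step_profile_def[abs_def] by measurable

text \<open>The step function as the sum of its jumps up to the modulus of \<open>y\<close>, an odd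
  and an even one per index. The induction adds one jump at a time.\<close>

lemma step_profile_sums:
  "(\<lambda>i. 4 * ((2 * real i + 1) * of_bool (2 * real i + 1 \<le> \<bar>y\<bar>) - (real i + 1) * of_bool (2 * real i + 2 \<le> \<bar>y\<bar>)))
    sums step_profile y"
proof -
  have S: "(\<lambda>i. 4 * ((2 * real i + 1) * of_bool (2 * i + 1 \<le> l) - (real i + 1) * of_bool (2 * i + 2 \<le> l)))
    sums step_value l" for l
  proof (induction l)
    case (Suc l)
    have "(\<lambda>i. if 2 * i = l then 4 * (2 * real i + 1) else if 2 * i + 1 = l then - 4 * (real i + 1) else 0)
       sums (step_value (Suc l) - step_value l)"
    proof (cases "even l")
      case True
      then obtain j where j: "l = 2 * j" by blast
      have "(if 2 * i = l then 4 * (2 * real i + 1) else if 2 * i + 1 = l then - 4 * (real i + 1) else 0)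
         = (if i = j then 4 * (2 * real i + 1) else 0)" for i using j by (auto; presburger)
      moreover have "step_value (Suc l) - step_value l = 4 * (2 * real j + 1)"
        using j by (simp add: step_value_def field_simps)
      ultimately show ?thesis using sums_single[of j "\<lambda>i. 4 * (2 * real i + 1)"] by simp
    next
      case False
      then obtain j where j: "l = 2 * j + 1" using oddE by blast
      have "(if 2 * i = l then 4 * (2 * real i + 1) else if 2 * i + 1 = l then - 4 * (real i + 1) else 0)
         = (if i = j then - 4 * (real i + 1) else 0)" for i using j by (auto; presburger)
      moreover have "step_value (Suc l) - step_value l = - 4 * (real j + 1)"
        using j by (simp add: step_value_def field_simps)
      ultimately show ?thesis using sums_single[of j "\<lambda>i. - 4 * (real i + 1)"] by simp
    qed
    moreover have "4 * ((2 * real i + 1) * of_bool (2 * i + 1 \<le> l) - (real i + 1) * of_bool (2 * i + 2 \<le> l)) +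
        (if 2 * i = l then 4 * (2 * real i + 1) else if 2 * i + 1 = l then - 4 * (real i + 1) else 0) =
        4 * ((2 * real i + 1) * of_bool (2 * i + 1 \<le> Suc l) - (real i + 1) * of_bool (2 * i + 2 \<le> Suc l))" for i
      by (auto simp: of_bool_def le_Suc_eq)
    ultimately show ?case using sums_add[OF Suc] by fastforce
  qed (simp add: step_value_def)
  have "2 * real i + 1 \<le> \<bar>y\<bar> \<longleftrightarrow> 2 * i + 1 \<le> nat \<lfloor>\<bar>y\<bar>\<rfloor>"
    "2 * real i + 2 \<le> \<bar>y\<bar> \<longleftrightarrow> 2 * i + 2 \<le> nat \<lfloor>\<bar>y\<bar>\<rfloor>" for i
    by (simp_all add: le_nat_iff le_floor_iff add.commute)
  then show ?thesis unfolding step_profile_def using S[of "nat \<lfloor>\<bar>y\<bar>\<rfloor>"] by presburger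
qed

lemma gauss_tail:
  assumes s: "0 < s" and c: "0 < c"
  shows "(\<integral>y. of_bool (c \<le> \<bar>y\<bar>) \<partial>gauss s) = erfc (c / (s * sqrt 2))"
proof -
  interpret prob_space "gauss s" by (rule prob_space_gauss[OF s])
  have i: "integrable (gauss s) (\<lambda>y. of_bool (c \<le> y) :: real)" "integrable (gauss s) (\<lambda>y. of_bool (c \<le> - y) :: real)"
    by (auto intro!: integrable_const_bound[where B = 1])
  have "(of_bool (c \<le> \<bar>y\<bar>) :: real) = of_bool (c \<le> y) + of_bool (c \<le> - y)" for y using c by auto
  then have "(\<integral>y. of_bool (c \<le> \<bar>y\<bar>) \<partial>gauss s) = (\<integral>y. of_bool (c \<le> y) \<partial>gauss s) + (\<integral>y. (of_bool (c \<le> - y) :: real) \<partial>gauss s)"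
    using i by simp
  also have "(\<integral>y. (of_bool (c \<le> - y) :: real) \<partial>gauss s) = (\<integral>y. of_bool (c \<le> y) \<partial>gauss s)"
    by (rule gauss_minus) measurable
  also have "(\<integral>y. of_bool (c \<le> y) \<partial>gauss s) = (\<integral>y. normal_density 0 s y * of_bool (c \<le> y) \<partial>lborel)"
    by (rule integral_gauss) measurable
  also have "\<dots> = s * sqrt 2 * (\<integral>u. normal_density 0 s (s * sqrt 2 * u) * of_bool (c \<le> s * sqrt 2 * u) \<partial>lborel)"
    using s by (subst lborel_integral_real_affine[where c = "s * sqrt 2" and t = 0]) auto
  also have "(\<lambda>u. normal_density 0 s (s * sqrt 2 * u) * of_bool (c \<le> s * sqrt 2 * u)) =
      (\<lambda>u. 1 / (s * sqrt 2 * sqrt pi) * (indicator {c / (s * sqrt 2)..} u * exp (- u\<^sup>2)))"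
  proof
    fix u
    have "sqrt (2 * pi * s\<^sup>2) = s * sqrt 2 * sqrt pi" using s by (simp add: real_sqrt_mult)
    moreover have "(s * sqrt 2 * u)\<^sup>2 / (2 * s\<^sup>2) = u\<^sup>2" using s by (simp add: power_mult_distrib)
    moreover have "c \<le> s * sqrt 2 * u \<longleftrightarrow> c / (s * sqrt 2) \<le> u" using s by (simp add: pos_divide_le_eq mult_ac)
    ultimately show "normal_density 0 s (s * sqrt 2 * u) * of_bool (c \<le> s * sqrt 2 * u) =
       1 / (s * sqrt 2 * sqrt pi) * (indicator {c / (s * sqrt 2)..} u * exp (- u\<^sup>2))"
      unfolding normal_density_def by (simp add: indicator_def)
  qed
  finally show ?thesis using s by (simp add: erfc_def set_lebesgue_integral_def field_simps)
qed

lemma gauss_step_profile_sums: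
  assumes s: "0 < s"
  shows "(\<lambda>i. 4 * ((2 * real i + 1) * erfc ((2 * real i + 1) / (s * sqrt 2)) -
      (real i + 1) * erfc ((2 * real i + 2) / (s * sqrt 2)))) sums (\<integral>y. step_profile y \<partial>gauss s)"
    "integrable (gauss s) step_profile"
proof -
  interpret prob_space "gauss s" by (rule prob_space_gauss[OF s])
  let ?f = "\<lambda>i y. 4 * ((2 * real i + 1) * of_bool (2 * real i + 1 \<le> \<bar>y\<bar>) - (real i + 1) * of_bool (2 * real i + 2 \<le> \<bar>y\<bar>))"
  have ib: "integrable (gauss s) (\<lambda>y. of_bool (c \<le> \<bar>y\<bar>) :: real)" for c
    by (rule integrable_const_bound[where B = 1]) auto
  have i: "integrable (gauss s) (?f i)" for i
    by (intro integrable_mult_right Bochner_Integration.integrable_diff ib)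
  \<comment> \<open>A term is nonzero only where the modulus of \<open>y\<close> is at least
    \<open>i + 1\<close>, so a fourth moment pays for its linear size and leaves a summable inverse
    square.\<close>
  have b: "norm (?f i y) \<le> 12 / (real i + 1)\<^sup>2 * y ^ 4" for i y
  proof (cases "2 * real i + 1 \<le> \<bar>y\<bar>")
    case True
    have "(real i + 1) ^ 4 \<le> \<bar>y\<bar> ^ 4" using True by (intro power_mono) auto
    then have y: "(real i + 1) ^ 4 \<le> y ^ 4" by simp
    have "(real i + 1) * (real i + 1)\<^sup>2 \<le> (real i + 1) ^ 4"
      using power_increasing[of 3 4 "real i + 1"] by (simp add: power3_eq_cube power2_eq_square mult.assoc)
    then have "(real i + 1) * (real i + 1)\<^sup>2 \<le> y ^ 4" using y by linarith
    then have "real i + 1 \<le> y ^ 4 / (real i + 1)\<^sup>2" by (simp add: pos_le_divide_eq)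
    moreover have "norm (?f i y) \<le> 12 * (real i + 1)" using True by (auto simp: abs_le_iff algebra_simps)
    ultimately show ?thesis by simp
  next
    case False
    then have "?f i y = 0" by simp
    then show ?thesis by simp
  qed
  have i4: "integrable (gauss s) (\<lambda>y. y ^ 4)" by (rule gauss_moments(1)[OF s])
  have g: "summable (\<lambda>i. 12 / (real i + 1)\<^sup>2)"
    using summable_mult[OF sums_summable[OF inverse_squares_sums_real], of 12] by simp
  have sm: "summable (\<lambda>i. \<integral>y. norm (?f i y) \<partial>gauss s)"
  proof (rule summable_comparison_test)
    have "(\<integral>y. norm (?f i y) \<partial>gauss s) \<le> (\<integral>y. 12 / (real i + 1)\<^sup>2 * y ^ 4 \<partial>gauss s)" for i
      by (intro integral_mono integrable_norm i integrable_mult_right i4 b)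
    then show "\<exists>N. \<forall>n\<ge>N. norm (\<integral>y. norm (?f n y) \<partial>gauss s) \<le> 12 / (real n + 1)\<^sup>2 * (\<integral>y. y ^ 4 \<partial>gauss s)"
      by simp
    show "summable (\<lambda>n. 12 / (real n + 1)\<^sup>2 * (\<integral>y. y ^ 4 \<partial>gauss s))" using g by (rule summable_mult2)
  qed
  have ae: "AE y in gauss s. summable (\<lambda>i. norm (?f i y))"
  proof (rule AE_I2)
    fix y show "summable (\<lambda>i. norm (?f i y))"
      by (rule summable_comparison_test[OF _ summable_mult2[OF g, of "y ^ 4"]]) (use b in auto)
  qed
  have e: "(\<lambda>y. \<Sum>i. ?f i y) = step_profile" using step_profile_sums by (simp add: sums_iff fun_eq_iff)
  show "integrable (gauss s) step_profile" using integrable_suminf[OF i ae sm] unfolding e .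
  have "(\<lambda>i. integral\<^sup>L (gauss s) (?f i)) sums (\<integral>y. step_profile y \<partial>gauss s)"
    using sums_integral[OF i ae sm] unfolding e .
  moreover have "integral\<^sup>L (gauss s) (?f i) = 4 * ((2 * real i + 1) * erfc ((2 * real i + 1) / (s * sqrt 2)) -
      (real i + 1) * erfc ((2 * real i + 2) / (s * sqrt 2)))" for i
    using ib by (simp add: gauss_tail[OF s])
  ultimately show "(\<lambda>i. 4 * ((2 * real i + 1) * erfc ((2 * real i + 1) / (s * sqrt 2)) -
      (real i + 1) * erfc ((2 * real i + 2) / (s * sqrt 2)))) sums (\<integral>y. step_profile y \<partial>gauss s)" by simp
qed

lemma gauss_profile_tendsto:
  assumes s: "0 < s"
  shows "(\<lambda>m. \<integral>y. profile (radius m) y \<partial>gauss s) \<longlonglongrightarrow> (\<integral>y. step_profile y \<partial>gauss s)"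
proof (rule integral_dominated_convergence[where w = "\<lambda>y. 60 * (1 + y\<^sup>2)"])
  interpret prob_space "gauss s" by (rule prob_space_gauss[OF s])
  show "integrable (gauss s) (\<lambda>y. 60 * (1 + y\<^sup>2))" using gauss_moments(1)[OF s, of 2] by simp
  show "AE y in gauss s. (\<lambda>m. profile (radius m) y) \<longlonglongrightarrow> step_profile y"
    using AE_gauss_not_Ints by eventually_elim (rule profile_tendsto)
qed (use borel_measurable_profile[OF radius(2,3)] profile_growth[OF radius(2,3)] in auto)

text \<open>Here the two series meet: the Gaussian mean of \<open>profile\<close> has one limit by
  dominated convergence in \<open>y\<close> and another by Tannery in the series index.\<close>

lemma gauss_step_profile_eq:
  assumes s: "0 < s"
  shows "(\<integral>y. step_profile y \<partial>gauss s) = s\<^sup>2 / 2 + 2 / 3 + (\<Sum>i. series_term s (Suc i))"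
proof (rule LIMSEQ_unique[OF gauss_profile_tendsto[OF s]])
  show "(\<lambda>m. \<integral>y. profile (radius m) y \<partial>gauss s) \<longlonglongrightarrow> s\<^sup>2 / 2 + 2 / 3 + (\<Sum>i. series_term s (Suc i))"
    unfolding gauss_profile[OF s radius(2,3)]
    by (intro tendsto_intros radius_series[OF summable_mult[OF summable_inverse_squares_pi] abs_series_term])
qed

text \<open>Continuity in the scale is read off the trigonometric series, whose terms are continuous
  and dominated uniformly in \<open>s\<close>. It later closes the gap between
  \<open>\<epsilon>'\<close> and \<open>\<epsilon>\<close>.\<close>

lemma gauss_step_profile_continuous:
  assumes "S \<longlonglongrightarrow> s" "\<And>j. 0 < S j" "0 < s"
  shows "(\<lambda>j. \<integral>y. step_profile y \<partial>gauss (S j)) \<longlonglongrightarrow> (\<integral>y. step_profile y \<partial>gauss s)"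
proof -
  have "(\<lambda>j. series_term (S j) (Suc i)) \<longlonglongrightarrow> series_term s (Suc i)" for i
    unfolding series_term_def by (intro tendsto_intros assms(1)) auto
  moreover have "eventually (\<lambda>(i, j). norm (series_term (S j) (Suc i)) \<le> 3 * (6 / (pi * real (Suc i))\<^sup>2)) (at_top \<times>\<^sub>F sequentially)"
    using abs_series_term by (intro always_eventually) auto
  ultimately have "(\<lambda>j. \<Sum>i. series_term (S j) (Suc i)) \<longlonglongrightarrow> (\<Sum>i. series_term s (Suc i))"
    using tannerys_theorem[where a = "\<lambda>i j. series_term (S j) (Suc i)" and b = "\<lambda>i. series_term s (Suc i)"
        and F = sequentially, OF _ _ summable_mult[OF summable_inverse_squares_pi] sequentially_bot] by blast
  then show ?thesis unfolding gauss_step_profile_eq[OF assms(2)] gauss_step_profile_eq[OF assms(3)]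
    by (intro tendsto_intros assms(1)) auto
qed

subsection \<open>Compatible value functions\<close>

text \<open>The value functions of the chain: in even phases the value at \<open>x\<close> is \<open>f x\<close>, in odd phases
  the average of \<open>f\<close> at \<open>1 + x\<close> and \<open>1 - x\<close>. Evenness of \<open>f\<close> makes reflection at 0 a
  second-order effect, and the recurrence makes the value continuous across a switch, where
  \<open>c\<close> is gained at every second switch.\<close>

definition compatible :: "real \<Rightarrow> real \<Rightarrow> (real \<Rightarrow> real) \<Rightarrow> bool" where
  "compatible c C f \<longleftrightarrow> f \<in> borel_measurable borel \<and> (\<forall>y. f (- y) = f y) \<and>
     (\<forall>y. f (y + 2) + f (y - 2) = 2 * f y + 4 * c) \<and>
     (\<forall>x d. \<bar>f (x + d) - f x\<bar> \<le> C * (\<bar>d\<bar> * (1 + x\<^sup>2 + d\<^sup>2))) \<and>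
     (\<forall>x d. \<bar>f (x + d) + f (x - d) - 2 * f x\<bar> \<le> C * (d\<^sup>2 * (1 + x\<^sup>2 + d\<^sup>2)))"

definition chain_value :: "(real \<Rightarrow> real) \<Rightarrow> nat \<Rightarrow> real \<Rightarrow> real" where
  "chain_value f k x = (if even k then f x else (f (1 + x) + f (1 - x)) / 2)"

lemma compatibleD:
  assumes "compatible c C f"
  shows "f \<in> borel_measurable borel" "f (- y) = f y" "f (y + 2) + f (y - 2) = 2 * f y + 4 * c"
    "\<bar>f (x + d) - f x\<bar> \<le> C * (\<bar>d\<bar> * (1 + x\<^sup>2 + d\<^sup>2))"
    "\<bar>f (x + d) + f (x - d) - 2 * f x\<bar> \<le> C * (d\<^sup>2 * (1 + x\<^sup>2 + d\<^sup>2))"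
  using assms unfolding compatible_def by blast+

lemma compatible_nonneg: "compatible c C f \<Longrightarrow> 0 \<le> C"
  using compatibleD(4)[of c C f 0 1] by simp

lemma compatible_const: "compatible 0 0 (\<lambda>_. k)"
  by (simp add: compatible_def)

lemma square_add_le: "(a + b)\<^sup>2 \<le> 2 * (a\<^sup>2 + b\<^sup>2)" for a b :: real
proof -
  have "0 \<le> (a - b)\<^sup>2" by simp
  then show ?thesis by (simp add: power2_eq_square algebra_simps)
qed

lemma fourth_power_add_le: "(a + b) ^ 4 \<le> 8 * (a ^ 4 + b ^ 4)" for a b :: real
proof -
  have "((a + b)\<^sup>2)\<^sup>2 \<le> (2 * (a\<^sup>2 + b\<^sup>2))\<^sup>2" by (intro power_mono square_add_le) simp
  also have "\<dots> = 4 * (a\<^sup>2 + b\<^sup>2)\<^sup>2" unfolding power_mult_distrib by simp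
  also have "\<dots> \<le> 4 * (2 * ((a\<^sup>2)\<^sup>2 + (b\<^sup>2)\<^sup>2))" by (intro mult_left_mono square_add_le) simp
  finally show ?thesis by (simp flip: power_mult)
qed

text \<open>The mean value inequality for \<open>f\<close> and for \<open>f'\<close>. In the 4, one
  factor 2 compares \<open>1 + z\<^sup>2\<close> with \<open>1 + x\<^sup>2 + d\<^sup>2\<close>, the
  other is the length \<open>2 * d\<close> of the interval of the second difference.\<close>

lemma compatible_of_DERIV:
  assumes even: "\<And>y. f (- y) = f y" and rec: "\<And>y. f (y + 2) + f (y - 2) = 2 * f y + 4 * c"
    and f': "\<And>y. (f has_real_derivative f' y) (at y)"
    and f'': "\<And>y. (f' has_real_derivative f'' y) (at y)"
    and b: "\<And>y. \<bar>f' y\<bar> \<le> A * (1 + y\<^sup>2)" "\<And>y. \<bar>f'' y\<bar> \<le> A * (1 + y\<^sup>2)"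
  shows "compatible c (4 * A) f"
proof -
  have A: "0 \<le> A" using b(1)[of 0] by simp
  have near: "1 + z\<^sup>2 \<le> 2 * (1 + x\<^sup>2 + d\<^sup>2)" if "\<bar>z - x\<bar> \<le> \<bar>d\<bar>" for x d z :: real
  proof -
    have "(z - x)\<^sup>2 \<le> d\<^sup>2" using that by (simp add: abs_le_square_iff)
    then show ?thesis using square_add_le[of x "z - x"] by simp
  qed
  have lip: "\<bar>g y - g x\<bar> \<le> L * \<bar>y - x\<bar>"
    if "\<And>z. min x y \<le> z \<Longrightarrow> z \<le> max x y \<Longrightarrow> (g has_real_derivative g' z) (at z)"
      "\<And>z. min x y \<le> z \<Longrightarrow> z \<le> max x y \<Longrightarrow> \<bar>g' z\<bar> \<le> L" for g g' :: "real \<Rightarrow> real" and x y L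
  proof (cases "x \<le> y")
    case True
    have "\<bar>g y - g x\<bar> \<le> L * (y - x)" by (rule abs_diff_le_slope[OF True, where f' = g']) (use that True in auto)
    then show ?thesis using True by simp
  next
    case False
    have "\<bar>g x - g y\<bar> \<le> L * (x - y)" by (rule abs_diff_le_slope[where f' = g']) (use that False in auto)
    then show ?thesis using False by (simp add: abs_minus_commute)
  qed
  show ?thesis unfolding compatible_def
  proof (intro conjI allI)
    show "f \<in> borel_measurable borel"
      by (intro borel_measurable_continuous_onI continuous_at_imp_continuous_on ballI DERIV_isCont[OF f'])
    show "\<bar>f (x + d) - f x\<bar> \<le> 4 * A * (\<bar>d\<bar> * (1 + x\<^sup>2 + d\<^sup>2))" for x d
    proof -
      have "\<bar>f (x + d) - f x\<bar> \<le> A * (2 * (1 + x\<^sup>2 + d\<^sup>2)) * \<bar>x + d - x\<bar>"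
      proof (rule lip[where g' = f'])
        fix z assume "min x (x + d) \<le> z" "z \<le> max x (x + d)"
        then have "\<bar>z - x\<bar> \<le> \<bar>d\<bar>" by (auto simp: min_def max_def split: if_splits)
        then show "\<bar>f' z\<bar> \<le> A * (2 * (1 + x\<^sup>2 + d\<^sup>2))"
          using order_trans[OF b(1)[of z] mult_left_mono[OF near A, of z x d]] by simp
      qed (rule f')
      also have "\<dots> \<le> 4 * A * (\<bar>d\<bar> * (1 + x\<^sup>2 + d\<^sup>2))"
        using mult_nonneg_nonneg[OF A, of "\<bar>d\<bar> * (1 + x\<^sup>2 + d\<^sup>2)"] by (simp add: algebra_simps)
      finally show ?thesis .
    qed
    show "\<bar>f (x + d) + f (x - d) - 2 * f x\<bar> \<le> 4 * A * (d\<^sup>2 * (1 + x\<^sup>2 + d\<^sup>2))" for x d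
    proof -
      have D: "((\<lambda>e. f (x + e) + f (x - e)) has_real_derivative f' (x + e) - f' (x - e)) (at e)" for e
        by (auto intro!: derivative_eq_intros DERIV_chain2[OF f'])
      have L: "\<bar>f' (x + e) - f' (x - e)\<bar> \<le> A * (2 * (1 + x\<^sup>2 + d\<^sup>2)) * (2 * \<bar>d\<bar>)" if e: "\<bar>e\<bar> \<le> \<bar>d\<bar>" for e
      proof -
        have "\<bar>f' (x + e) - f' (x - e)\<bar> \<le> A * (2 * (1 + x\<^sup>2 + d\<^sup>2)) * \<bar>x + e - (x - e)\<bar>"
        proof (rule lip[where g' = f''])
          fix z assume "min (x - e) (x + e) \<le> z" "z \<le> max (x - e) (x + e)"
          then have "\<bar>z - x\<bar> \<le> \<bar>d\<bar>" using e by (auto simp: min_def max_def split: if_splits)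
          then show "\<bar>f'' z\<bar> \<le> A * (2 * (1 + x\<^sup>2 + d\<^sup>2))"
            using order_trans[OF b(2)[of z] mult_left_mono[OF near A, of z x d]] by simp
        qed (rule f'')
        also have "\<dots> \<le> A * (2 * (1 + x\<^sup>2 + d\<^sup>2)) * (2 * \<bar>d\<bar>)"
          using e A by (intro mult_left_mono) auto
        finally show ?thesis .
      qed
      have "\<bar>(f (x + d) + f (x - d)) - (f (x + 0) + f (x - 0))\<bar> \<le> A * (2 * (1 + x\<^sup>2 + d\<^sup>2)) * (2 * \<bar>d\<bar>) * \<bar>d - 0\<bar>"

        by (rule lip[OF D], rule L) (auto simp: min_def max_def split: if_splits)
      also have "\<dots> = 4 * A * ((\<bar>d\<bar> * \<bar>d\<bar>) * (1 + x\<^sup>2 + d\<^sup>2))"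
        by (simp only: diff_zero mult_ac)
      also have "\<bar>d\<bar> * \<bar>d\<bar> = d\<^sup>2" by (simp add: power2_eq_square)
      finally show ?thesis by simp
    qed
  qed (fact even rec)+
qed

definition gauss_conv :: "real \<Rightarrow> (real \<Rightarrow> real) \<Rightarrow> real \<Rightarrow> real" where
  "gauss_conv s f x = (\<integral>z. f (x + z) \<partial>gauss s)"

lemma compatible_growth:
  assumes "compatible c C f"
  shows "\<bar>f u\<bar> \<le> (\<bar>f 0\<bar> + 2 * C) * (1 + u ^ 4)"
proof -
  have C: "0 \<le> C" by (rule compatible_nonneg[OF assms])
  have u: "\<bar>u\<bar> * (1 + u\<^sup>2) \<le> 2 * (1 + u ^ 4)"
  proof (cases "\<bar>u\<bar> \<le> 1")
    case True
    have "u\<^sup>2 \<le> 1" using True abs_square_le_1 by blast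
    then have "\<bar>u\<bar> * (1 + u\<^sup>2) \<le> 1 * (1 + 1)" using True by (intro mult_mono) auto
    moreover have "0 \<le> u ^ 4" by simp
    ultimately show ?thesis by argo
  next
    case False
    have "\<bar>u\<bar> ^ 1 \<le> \<bar>u\<bar> ^ 4" "\<bar>u\<bar> ^ 3 \<le> \<bar>u\<bar> ^ 4" using False by (intro power_increasing; simp)+
    then show ?thesis by (simp add: distrib_left power2_eq_square power3_eq_cube flip: abs_mult)
  qed
  have "\<bar>f u\<bar> \<le> \<bar>f 0\<bar> + C * (\<bar>u\<bar> * (1 + u\<^sup>2))"
    using compatibleD(4)[OF assms, of 0 u] by simp
  also have "\<dots> \<le> \<bar>f 0\<bar> * (1 + u ^ 4) + C * (2 * (1 + u ^ 4))"
    using mult_left_mono[of 1 "1 + u ^ 4" "\<bar>f 0\<bar>"] by (intro add_mono mult_left_mono u C) simp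
  finally show ?thesis by (simp add: algebra_simps)
qed

lemma compatible_growth_shift:
  assumes "compatible c C f"
  shows "\<bar>f (a + z)\<bar> \<le> 8 * (\<bar>f 0\<bar> + 2 * C) * ((1 + a ^ 4) + z ^ 4)"
proof -
  have "\<bar>f (a + z)\<bar> \<le> (\<bar>f 0\<bar> + 2 * C) * (1 + (a + z) ^ 4)" by (rule compatible_growth[OF assms])
  also have "\<dots> \<le> (\<bar>f 0\<bar> + 2 * C) * (8 * ((1 + a ^ 4) + z ^ 4))"
    using fourth_power_add_le[of a z] compatible_nonneg[OF assms] by (intro mult_left_mono) auto
  finally show ?thesis by (simp add: algebra_simps)
qed

lemma compatible_integrable:
  assumes f: "compatible c C f" and s: "0 < s"
  shows "integrable (gauss s) (\<lambda>z. f (x + z))"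
proof (rule Bochner_Integration.integrable_bound)
  interpret prob_space "gauss s" by (rule prob_space_gauss[OF s])
  show "integrable (gauss s) (\<lambda>z. 8 * (\<bar>f 0\<bar> + 2 * C) * ((1 + x ^ 4) + z ^ 4))"
    using gauss_moments(1)[OF s, of 4] by simp
  show "(\<lambda>z. f (x + z)) \<in> borel_measurable (gauss s)" using compatibleD(1)[OF f] by measurable
  show "AE z in gauss s. norm (f (x + z)) \<le> norm (8 * (\<bar>f 0\<bar> + 2 * C) * ((1 + x ^ 4) + z ^ 4))"
    using compatible_growth_shift[OF f] compatible_nonneg[OF f] by (intro AE_I2) (force intro: order_trans[OF _ abs_ge_self])
qed

text \<open>Evenness, recurrence and differences pass through the average. Only the quadratic weight
  grows, since the mean of \<open>(x + z)\<^sup>2\<close> is \<open>x\<^sup>2 + s\<^sup>2\<close>;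
  over \<open>n\<close> steps the factors stay below \<open>exp (n * s\<^sup>2)\<close>.\<close>

lemma compatible_conv:
  assumes f: "compatible c C f" and s: "0 < s"
  shows "compatible c (C * (1 + s\<^sup>2)) (gauss_conv s f)"
proof -
  interpret prob_space "gauss s" by (rule prob_space_gauss[OF s])
  have [measurable]: "f \<in> borel_measurable borel" by (rule compatibleD(1)[OF f])
  have C: "0 \<le> C" by (rule compatible_nonneg[OF f])
  note i = compatible_integrable[OF f s]
  have i2: "integrable (gauss s) (\<lambda>z. z\<^sup>2)" by (rule gauss_moments(1)[OF s])
  have bd: "\<bar>\<integral>z. g z \<partial>gauss s\<bar> \<le> C * (1 + s\<^sup>2) * (m * (1 + x\<^sup>2 + d\<^sup>2))"
    if g: "integrable (gauss s) g" and m: "0 \<le> m"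
      and "\<And>z. \<bar>g z\<bar> \<le> C * (m * (1 + (x + z)\<^sup>2 + d\<^sup>2))" for g m x d
  proof -
    have e: "C * (m * (1 + (x + z)\<^sup>2 + d\<^sup>2)) = C * m * (1 + x\<^sup>2 + d\<^sup>2) + C * m * (2 * x * z) + C * m * z\<^sup>2" for z
      by (simp add: power2_eq_square algebra_simps)
    have iz: "integrable (gauss s) (\<lambda>z. z)" using gauss_moments(1)[OF s, of 1] by simp
    have "\<bar>\<integral>z. g z \<partial>gauss s\<bar> \<le> (\<integral>z. \<bar>g z\<bar> \<partial>gauss s)" by (rule integral_abs_bound)
    also have "\<dots> \<le> (\<integral>z. C * m * (1 + x\<^sup>2 + d\<^sup>2) + C * m * (2 * x * z) + C * m * z\<^sup>2 \<partial>gauss s)"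
      using that(3) g i2 iz unfolding e[symmetric] by (intro integral_mono) (auto simp: e)
    also have "\<dots> = C * m * (1 + x\<^sup>2 + d\<^sup>2) + C * m * s\<^sup>2"
      using i2 iz gauss_moments(3,5)[OF s] prob_space by simp
    also have "\<dots> \<le> C * (1 + s\<^sup>2) * (m * (1 + x\<^sup>2 + d\<^sup>2))"
    proof -
      have "0 \<le> C * m * s\<^sup>2 * (x\<^sup>2 + d\<^sup>2)" using C m by simp
      then show ?thesis by (simp add: algebra_simps)
    qed
    finally show ?thesis .
  qed
  show ?thesis unfolding compatible_def
  proof (intro conjI allI)
    show "gauss_conv s f \<in> borel_measurable borel" unfolding gauss_conv_def[abs_def] by measurable
    show "gauss_conv s f (- y) = gauss_conv s f y" for y
    proof -
      have "gauss_conv s f (- y) = (\<integral>z. f (- y + (- z)) \<partial>gauss s)"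
        unfolding gauss_conv_def by (rule gauss_minus[symmetric]) measurable
      also have "\<dots> = (\<integral>z. f (- (y + z)) \<partial>gauss s)" by (simp add: algebra_simps)
      finally show ?thesis unfolding compatibleD(2)[OF f] gauss_conv_def .
    qed
    show "gauss_conv s f (y + 2) + gauss_conv s f (y - 2) = 2 * gauss_conv s f y + 4 * c" for y
    proof -
      have shift: "f (y + 2 + z) + f (y - 2 + z) = 2 * f (y + z) + 4 * c" for z
        using compatibleD(3)[OF f, of "y + z"] by (simp add: algebra_simps)
      have "gauss_conv s f (y + 2) + gauss_conv s f (y - 2) = (\<integral>z. f (y + 2 + z) + f (y - 2 + z) \<partial>gauss s)"
        unfolding gauss_conv_def by (rule Bochner_Integration.integral_add[symmetric]; rule i)
      also have "\<dots> = (\<integral>z. 2 * f (y + z) + 4 * c \<partial>gauss s)"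
        unfolding shift ..
      also have "\<dots> = 2 * gauss_conv s f y + 4 * c" unfolding gauss_conv_def using i prob_space by simp
      finally show ?thesis .
    qed
    show "\<bar>gauss_conv s f (x + d) - gauss_conv s f x\<bar> \<le> C * (1 + s\<^sup>2) * (\<bar>d\<bar> * (1 + x\<^sup>2 + d\<^sup>2))" for x d
    proof -
      have "gauss_conv s f (x + d) - gauss_conv s f x = (\<integral>z. f (x + d + z) - f (x + z) \<partial>gauss s)"
        unfolding gauss_conv_def using i by simp
      also have "\<bar>\<dots>\<bar> \<le> C * (1 + s\<^sup>2) * (\<bar>d\<bar> * (1 + x\<^sup>2 + d\<^sup>2))"
        using compatibleD(4)[OF f, of "x + z" d for z]
        by (intro bd Bochner_Integration.integrable_diff i) (simp_all add: algebra_simps)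
      finally show ?thesis .
    qed
    show "\<bar>gauss_conv s f (x + d) + gauss_conv s f (x - d) - 2 * gauss_conv s f x\<bar> \<le> C * (1 + s\<^sup>2) * (d\<^sup>2 * (1 + x\<^sup>2 + d\<^sup>2))" for x d
    proof -
      have "gauss_conv s f (x + d) + gauss_conv s f (x - d) - 2 * gauss_conv s f x =
          (\<integral>z. f (x + d + z) + f (x - d + z) - 2 * f (x + z) \<partial>gauss s)"
        unfolding gauss_conv_def using i by simp
      also have "\<bar>\<dots>\<bar> \<le> C * (1 + s\<^sup>2) * (d\<^sup>2 * (1 + x\<^sup>2 + d\<^sup>2))"
        using compatibleD(5)[OF f, of "x + z" d for z]
        by (intro bd Bochner_Integration.integrable_diff Bochner_Integration.integrable_add integrable_mult_right i)
          (simp_all add: algebra_simps)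
      finally show ?thesis .
    qed
  qed
qed

text \<open>Before clamping and switching, a step of the chain acts on values exactly as Gaussian
  averaging of \<open>f\<close>; the symmetry of the Gaussian absorbs the signs of both
  phases.\<close>

lemma chain_value_conv:
  assumes f: "compatible c C f" and s: "0 < s"
  shows "chain_value (gauss_conv s f) k x = (\<integral>z. chain_value f k (x + (if even k then - z else z)) \<partial>gauss s)"
proof (cases "even k")
  case True
  have [measurable]: "f \<in> borel_measurable borel" by (rule compatibleD(1)[OF f])
  have "(\<integral>z. f (x + - z) \<partial>gauss s) = (\<integral>z. f (x + z) \<partial>gauss s)" by (rule gauss_minus) measurable
  then show ?thesis using True by (simp add: chain_value_def gauss_conv_def)
next
  case False
  have [measurable]: "f \<in> borel_measurable borel" by (rule compatibleD(1)[OF f])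
  have "(\<integral>z. f (1 - x + - z) \<partial>gauss s) = (\<integral>z. f (1 - x + z) \<partial>gauss s)" by (rule gauss_minus) measurable
  moreover have "(\<integral>z. f (1 - x + - z) \<partial>gauss s) = (\<integral>z. f (1 - (x + z)) \<partial>gauss s)"
    by (simp add: algebra_simps)
  moreover have "integrable (gauss s) (\<lambda>z. f (1 - (x + z)))"
  proof -
    have "f (1 - (x + z)) = f (x - 1 + z)" for z using compatibleD(2)[OF f, of "x - 1 + z"] by (simp add: algebra_simps)
    then show ?thesis using compatible_integrable[OF f s, of "x - 1"] by simp
  qed
  moreover have "integrable (gauss s) (\<lambda>z. f (1 + (x + z)))"
    using compatible_integrable[OF f s, of "1 + x"] by (simp add: add.assoc)
  ultimately show ?thesis using False by (simp add: chain_value_def gauss_conv_def add.assoc)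
qed

text \<open>The local time at the reflecting boundary and the number of switches are controlled by
  the increments of \<open>7 * x\<^sup>2 - x\<close>.\<close>

definition lyapunov :: "real \<Rightarrow> real" where
  "lyapunov x = 7 * x\<^sup>2 - x"

text \<open>Only clamping and switching make errors. Clamping by \<open>a\<close> costs order
  \<open>a\<^sup>2\<close>, while the Lyapunov function drops by at least \<open>a\<close>. A switch
  costs the order of its overshoot, while the Lyapunov function drops by at least 6. Hence the small
  factor \<open>\<delta>\<close> in front of the drop.\<close>

lemma chain_step_value:
  fixes k :: nat
  assumes f: "compatible c C f" and x: "0 \<le> x" "x \<le> 1" and \<delta>: "0 < \<delta>" "\<delta> \<le> 1"
  defines "y \<equiv> \<lambda>z. x + (if even k then - z else z)"
  shows "\<bar>(c * real (fst (chain_step (k, x) z) div 2) +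
        chain_value f (fst (chain_step (k, x) z)) (snd (chain_step (k, x) z)))
      - (c * real (k div 2) + chain_value f k (y z))\<bar>
    \<le> C * (\<delta> * (lyapunov (y z) - lyapunov (snd (chain_step (k, x) z))) + 6 / \<delta> ^ 3 * z ^ 4)"
proof -
  have C: "0 \<le> C" by (rule compatible_nonneg[OF f])
  define w where "w = y z"
  \<comment> \<open>Pays for rare large steps: any \<open>e\<close> between \<open>\<delta>\<close>
    and the modulus of \<open>z\<close> satisfies
    \<open>e \<le> e ^ 4 / \<delta> ^ 3 \<le> q\<close>.\<close>
  define q where "q = z ^ 4 / \<delta> ^ 3"
  have q: "0 \<le> q" using \<delta> by (simp add: q_def)
  have d3: "\<delta> ^ 3 \<le> \<delta>\<^sup>2" "\<delta> ^ 3 \<le> \<delta>" "\<delta> ^ 3 \<le> 1" "0 < \<delta> ^ 3"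
    using power_decreasing[of 2 3 \<delta>] power_decreasing[of 1 3 \<delta>] power_le_one[of \<delta> 3] \<delta> by auto
  have small: "e ^ 4 \<le> q * \<delta> ^ 3" if "\<bar>e\<bar> \<le> \<bar>z\<bar>" for e
    using power_mono[OF that, of 4] \<delta> by (simp add: q_def)
  have step: "chain_step (k, x) z = (if w > 1 then (Suc k, 0) else (k, max w 0))"
    by (simp add: chain_step_def w_def y_def)
  have D: "C * (\<delta> * (lyapunov w - lyapunov x') + 6 / \<delta> ^ 3 * z ^ 4) = C * (\<delta> * (lyapunov w - lyapunov x') + 6 * q)" for x'
    by (simp add: q_def)
  consider "w < 0" | "0 \<le> w" "w \<le> 1" | "w > 1" by linarith
  then show ?thesis
  proof cases
    case 1
    define a where "a = - w"
    have a: "0 \<le> a" "a \<le> \<bar>z\<bar>" using 1 x by (auto simp: a_def w_def y_def split: if_splits)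
    have sq: "a\<^sup>2 * (1 + a\<^sup>2) \<le> \<delta> * a + 2 * q"
    proof -
      have a4: "a ^ 4 \<le> q * \<delta> ^ 3" using a by (intro small) auto
      have "a ^ 4 \<le> q" using a4 mult_left_mono[OF d3(3) q] by simp
      moreover have "a\<^sup>2 \<le> \<delta> * a + q"
      proof (cases "a \<le> \<delta>")
        case True
        then show ?thesis using a q mult_right_mono[of a \<delta> a] by (simp add: power2_eq_square)
      next
        case False
        then have "\<delta>\<^sup>2 \<le> a\<^sup>2" using \<delta> by (intro power_mono) auto
        then have "\<delta>\<^sup>2 * a\<^sup>2 \<le> a\<^sup>2 * a\<^sup>2" by (intro mult_right_mono) auto
        also have "\<dots> \<le> q * \<delta>\<^sup>2" using a4 mult_left_mono[OF d3(1) q] by (simp flip: power_add)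
        finally have "a\<^sup>2 \<le> q" using \<delta> by (simp add: mult.commute)
        moreover have "0 \<le> \<delta> * a" using \<delta> a by simp
        ultimately show ?thesis by linarith
      qed
      ultimately show ?thesis by (simp add: distrib_left flip: power_add)
    qed
    \<comment> \<open>In both phases the value is even in the level, so the error is half a
      symmetric second difference of \<open>f\<close>, taken at 0 or at 1.\<close>
    have val: "\<bar>chain_value f k 0 - chain_value f k w\<bar> \<le> C * (a\<^sup>2 * (1 + a\<^sup>2))"
    proof (cases "even k")
      case True
      have "\<bar>f (0 + a) + f (0 - a) - 2 * f 0\<bar> \<le> C * (a\<^sup>2 * (1 + 0\<^sup>2 + a\<^sup>2))" by (rule compatibleD(5)[OF f])
      moreover have "f (0 + a) + f (0 - a) - 2 * f 0 = 2 * (f w - f 0)"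
        using compatibleD(2)[OF f, of w] by (simp add: a_def)
      moreover have "\<bar>2 * (f w - f 0)\<bar> = 2 * \<bar>f 0 - f w\<bar>"
        unfolding abs_mult by (simp add: abs_minus_commute)
      ultimately have "2 * \<bar>f 0 - f w\<bar> \<le> C * (a\<^sup>2 * (1 + a\<^sup>2))" by simp
      then have "\<bar>f 0 - f w\<bar> \<le> C * (a\<^sup>2 * (1 + a\<^sup>2))" using abs_ge_zero[of "f 0 - f w"] by argo
      then show ?thesis using True by (simp add: chain_value_def)
    next
      case False
      have "\<bar>f (1 + a) + f (1 - a) - 2 * f 1\<bar> \<le> C * (a\<^sup>2 * (1 + 1\<^sup>2 + a\<^sup>2))" by (rule compatibleD(5)[OF f])
      also have "\<dots> \<le> C * (a\<^sup>2 * (2 * (1 + a\<^sup>2)))" using C by (intro mult_left_mono) auto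
      also have "C * (a\<^sup>2 * (2 * (1 + a\<^sup>2))) = 2 * (C * (a\<^sup>2 * (1 + a\<^sup>2)))" by (simp only: mult_ac)
      finally have "\<bar>f (1 + a) + f (1 - a) - 2 * f 1\<bar> \<le> 2 * (C * (a\<^sup>2 * (1 + a\<^sup>2)))" .
      moreover have "f 1 - (f (1 + w) + f (1 - w)) / 2 = - (f (1 + a) + f (1 - a) - 2 * f 1) / 2"
        by (simp add: a_def field_simps)
      ultimately have "\<bar>f 1 - (f (1 + w) + f (1 - w)) / 2\<bar> \<le> C * (a\<^sup>2 * (1 + a\<^sup>2))"
        by (simp only: abs_divide abs_minus_cancel) simp
      then show ?thesis using False by (simp add: chain_value_def)
    qed
    have L: "a \<le> lyapunov w - lyapunov 0" by (simp add: lyapunov_def a_def)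
    have "C * (a\<^sup>2 * (1 + a\<^sup>2)) \<le> C * (\<delta> * (lyapunov w - lyapunov 0) + 6 * q)"
      using sq mult_left_mono[OF L, of \<delta>] \<delta> q by (intro mult_left_mono C) linarith
    then show ?thesis using val 1 unfolding w_def[symmetric] step D by simp
  next
    case 2
    then show ?thesis unfolding w_def[symmetric] step D using C q by simp
  next
    case 3
    define h where "h = w - 1"
    have h: "0 \<le> h" "h \<le> \<bar>z\<bar>" "w = 1 + h" using 3 x by (auto simp: h_def w_def y_def split: if_splits)
    have sq: "h * (1 + h\<^sup>2) \<le> 2 * \<delta> + 2 * q"
    proof (cases "h \<le> \<delta>")
      case True
      then have "h * (1 + h\<^sup>2) \<le> \<delta> * (1 + 1)" using \<delta> h by (intro mult_mono) (auto simp: abs_square_le_1)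
      then show ?thesis using q by simp
    next
      case False
      have o4: "h ^ 4 \<le> q * \<delta> ^ 3" using h by (intro small) auto
      have "\<delta> ^ 3 * h \<le> h ^ 3 * h" using False h \<delta> by (intro mult_right_mono power_mono) auto
      also have "\<dots> \<le> q * \<delta> ^ 3" using o4 by (simp add: numeral_eq_Suc mult_ac)
      finally have 1: "h \<le> q" using d3 by (simp add: mult.commute)
      have "\<delta> * h ^ 3 \<le> h * h ^ 3" using False h \<delta> by (intro mult_right_mono) auto
      also have "\<dots> \<le> q * \<delta>" using o4 mult_left_mono[OF d3(2) q] by (simp add: numeral_eq_Suc)
      finally have "h ^ 3 \<le> q" using \<delta> by (simp add: mult.commute)
      then show ?thesis using 1 \<delta> by (simp add: distrib_left power2_eq_square power3_eq_cube)
    qed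
    have val: "\<bar>(c * real (Suc k div 2) + chain_value f (Suc k) 0) - (c * real (k div 2) + chain_value f k w)\<bar>
        \<le> C * (3 * (h * (1 + h\<^sup>2)))"
    proof (cases "even k")
      case True
      have "\<bar>f (1 + h) - f 1\<bar> \<le> C * (\<bar>h\<bar> * (1 + 1\<^sup>2 + h\<^sup>2))" by (rule compatibleD(4)[OF f])
      also have "\<dots> \<le> C * (h * (3 * (1 + h\<^sup>2)))" using h C by (intro mult_left_mono mult_mono) auto
      finally have "\<bar>f 1 - f w\<bar> \<le> C * (3 * (h * (1 + h\<^sup>2)))" using h by (simp add: abs_minus_commute mult_ac)
      then show ?thesis using True by (simp add: chain_value_def)
    next
      case False
      \<comment> \<open>At the threshold the mean of \<open>f 2\<close> and \<open>f 0\<close> is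
        \<open>f 0 + c\<close>, so the gained \<open>c\<close> exactly offsets the change of value.
        What remains is the overshoot on both arms of the fold.\<close>
      have r: "f 2 = f 0 + 2 * c" using compatibleD(3)[OF f, of 0] compatibleD(2)[OF f, of 2] by simp
      have k2: "real (Suc k div 2) = real (k div 2) + 1" using False by (auto elim!: oddE)
      have 1: "\<bar>f (2 + h) - f 2\<bar> \<le> C * (\<bar>h\<bar> * (1 + 2\<^sup>2 + h\<^sup>2))" by (rule compatibleD(4)[OF f])
      have 2: "\<bar>f (0 + h) - f 0\<bar> \<le> C * (\<bar>h\<bar> * (1 + 0\<^sup>2 + h\<^sup>2))" by (rule compatibleD(4)[OF f])
      have "C * (\<bar>h\<bar> * (1 + 2\<^sup>2 + h\<^sup>2)) + C * (\<bar>h\<bar> * (1 + 0\<^sup>2 + h\<^sup>2)) = C * (h * (6 + 2 * h\<^sup>2))"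
        using h by (simp add: algebra_simps)
      also have "\<dots> \<le> C * (h * (6 * (1 + h\<^sup>2)))" using h C by (intro mult_left_mono) auto
      finally have fin: "\<bar>f (2 + h) - f 2\<bar> + \<bar>f (0 + h) - f 0\<bar> \<le> C * (h * (6 * (1 + h\<^sup>2)))" using 1 2 by linarith
      have "f (1 - w) = f h" using compatibleD(2)[OF f, of h] h by simp
      moreover have "1 + w = 2 + h" using h by simp
      ultimately have e: "c + f 0 - (f (1 + w) + f (1 - w)) / 2 = - ((f (2 + h) - f 2) + (f (0 + h) - f 0)) / 2"
        unfolding r by (simp add: field_simps)
      have "\<bar>(f (2 + h) - f 2) + (f (0 + h) - f 0)\<bar> \<le> C * (h * (6 * (1 + h\<^sup>2)))"
        by (rule order_trans[OF abs_triangle_ineq fin])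
      also have "\<dots> = 2 * (C * (3 * (h * (1 + h\<^sup>2))))" by simp
      finally have "\<bar>c + f 0 - (f (1 + w) + f (1 - w)) / 2\<bar> \<le> C * (3 * (h * (1 + h\<^sup>2)))"
        unfolding e abs_divide abs_minus_cancel by simp
      then show ?thesis using False unfolding k2 by (simp add: chain_value_def algebra_simps)
    qed
    \<comment> \<open>The coefficient 7 of \<open>lyapunov\<close> makes the drop at a switch at
      least 6, which matches the cost 3 * (2 * \<open>\<delta>\<close>) of an overshoot up to
      \<open>\<delta>\<close>.\<close>
    have "w * 1 \<le> w * w" using 3 by (intro mult_left_mono) auto
    then have "6 \<le> 7 * (w * w) - w" using 3 by argo
    then have L: "6 \<le> lyapunov w - lyapunov 0" by (simp add: lyapunov_def power2_eq_square)
    have "C * (3 * (h * (1 + h\<^sup>2))) \<le> C * (\<delta> * (lyapunov w - lyapunov 0) + 6 * q)"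
      using sq mult_left_mono[OF L, of \<delta>] \<delta> q by (intro mult_left_mono C) linarith
    then show ?thesis using val 3 unfolding w_def[symmetric] step D by simp
  qed
qed

subsection \<open>The chain driven by a Gaussian walk\<close>

lemma chain_cong: "(\<And>i. i < j \<Longrightarrow> z i = z' i) \<Longrightarrow> chain z j = chain z' j"
  by (induction j) auto

lemma measurable_chain_step:
  "(\<lambda>p. chain_step (fst p) (snd p)) \<in> (count_space UNIV \<Otimes>\<^sub>M borel) \<Otimes>\<^sub>M borel \<rightarrow>\<^sub>M count_space UNIV \<Otimes>\<^sub>M borel"
  unfolding chain_step_def Let_def by measurable

lemma measurable_chain:
  assumes "{..<j} \<subseteq> I"
  shows "(\<lambda>z. chain z j) \<in> PiM I (\<lambda>_. borel) \<rightarrow>\<^sub>M count_space UNIV \<Otimes>\<^sub>M borel"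
  using assms
proof (induction j)
  case (Suc j)
  have "{..<j} \<subseteq> I" using Suc.prems by auto
  then have "(\<lambda>z. chain z j) \<in> PiM I (\<lambda>_. borel) \<rightarrow>\<^sub>M count_space UNIV \<Otimes>\<^sub>M borel" by (rule Suc.IH)
  moreover have "(\<lambda>z. z j) \<in> PiM I (\<lambda>_. borel) \<rightarrow>\<^sub>M borel"
    using Suc by (intro measurable_component_singleton) auto
  ultimately have "(\<lambda>z. (chain z j, z j)) \<in> PiM I (\<lambda>_. borel) \<rightarrow>\<^sub>M (count_space UNIV \<Otimes>\<^sub>M borel) \<Otimes>\<^sub>M borel"
    by (rule measurable_Pair)
  from measurable_compose[OF this measurable_chain_step] show ?case by simp
qed simp

locale gaussian_walk = prob_space M for M :: "'a measure" +
  fixes \<xi> :: "nat \<Rightarrow> 'a \<Rightarrow> real" and n :: nat and s :: real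
  assumes s: "0 < s"
    and indep: "indep_vars (\<lambda>_. borel) \<xi> {..<n}"
    and law: "\<And>i. i < n \<Longrightarrow> distr M borel (\<xi> i) = gauss s"
begin

lemma measurable_\<xi>: "i < n \<Longrightarrow> \<xi> i \<in> borel_measurable M"
  using indep by (auto simp: indep_vars_def)

lemma integral_\<xi>:
  fixes f :: "real \<Rightarrow> real"
  assumes "i < n" and [measurable]: "f \<in> borel_measurable borel"
  shows "(\<integral>\<omega>. f (\<xi> i \<omega>) \<partial>M) = (\<integral>z. f z \<partial>gauss s)"
    "integrable M (\<lambda>\<omega>. f (\<xi> i \<omega>)) \<longleftrightarrow> integrable (gauss s) f"
  unfolding law[OF assms(1), symmetric] using measurable_\<xi>[OF assms(1)]
  by (simp_all add: integral_distr integrable_distr_eq)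

abbreviation past :: "nat \<Rightarrow> 'a \<Rightarrow> nat \<Rightarrow> real" where
  "past j \<omega> \<equiv> \<lambda>i\<in>{..<j}. \<xi> i \<omega>"

text \<open>Fubini for the product law of past and next step. The past enters through an arbitrary
  statistic \<open>T\<close>, so that the lemma serves both the chain and the partial sums.\<close>

lemma indep_step:
  fixes H :: "_ \<Rightarrow> real"
  assumes j: "j < n" and T: "T \<in> PiM {..<j} (\<lambda>_. borel) \<rightarrow>\<^sub>M N"
    and H: "H \<in> borel_measurable (N \<Otimes>\<^sub>M borel)"
    and i: "integrable M (\<lambda>\<omega>. H (T (past j \<omega>), \<xi> j \<omega>))"
  shows "(\<integral>\<omega>. H (T (past j \<omega>), \<xi> j \<omega>) \<partial>M) = (\<integral>\<omega>. (\<integral>z. H (T (past j \<omega>), z) \<partial>gauss s) \<partial>M)"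
proof -
  let ?P = "PiM {..<j} (\<lambda>_. borel) :: (nat \<Rightarrow> real) measure" and ?Q = "PiM {j} (\<lambda>_. borel) :: (nat \<Rightarrow> real) measure"
  let ?Y = "\<lambda>\<omega>. \<lambda>i\<in>{j}. \<xi> i \<omega>"
  have iv: "indep_var ?P (\<lambda>\<omega>. past j \<omega>) ?Q ?Y"
    using j by (intro indep_var_restrict[OF indep]) auto
  note rv1 = indep_var_rv1[OF iv] and rv2 = indep_var_rv2[OF iv]
  have D: "distr M ?P (\<lambda>\<omega>. past j \<omega>) \<Otimes>\<^sub>M distr M ?Q ?Y = distr M (?P \<Otimes>\<^sub>M ?Q) (\<lambda>\<omega>. (past j \<omega>, ?Y \<omega>))"
    using iv unfolding indep_var_distribution_eq by blast
  interpret D1: prob_space "distr M ?P (\<lambda>\<omega>. past j \<omega>)" by (rule prob_space_distr[OF rv1])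
  interpret D2: prob_space "distr M ?Q ?Y" by (rule prob_space_distr[OF rv2])
  interpret PP: pair_prob_space "distr M ?P (\<lambda>\<omega>. past j \<omega>)" "distr M ?Q ?Y" ..
  interpret G: prob_space "gauss s" by (rule prob_space_gauss[OF s])
  define H' where "H' = (\<lambda>p. H (T (fst p), snd p j))"
  have comp: "(\<lambda>w. w j) \<in> ?Q \<rightarrow>\<^sub>M borel" by (intro measurable_component_singleton) simp
  have "(\<lambda>p. (T (fst p), snd p j)) \<in> ?P \<Otimes>\<^sub>M ?Q \<rightarrow>\<^sub>M N \<Otimes>\<^sub>M borel"
    by (intro measurable_Pair measurable_compose[OF measurable_fst T] measurable_compose[OF measurable_snd comp])
  from measurable_compose[OF this H] have H': "H' \<in> borel_measurable (?P \<Otimes>\<^sub>M ?Q)" by (simp add: H'_def)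
  have pm: "(\<lambda>\<omega>. (past j \<omega>, ?Y \<omega>)) \<in> M \<rightarrow>\<^sub>M ?P \<Otimes>\<^sub>M ?Q" using rv1 rv2 by (rule measurable_Pair)
  have e: "H' (past j \<omega>, ?Y \<omega>) = H (T (past j \<omega>), \<xi> j \<omega>)" for \<omega> by (simp add: H'_def)
  have inner: "(\<integral>y. H' (x, y) \<partial>distr M ?Q ?Y) = (\<integral>z. H (T x, z) \<partial>gauss s)" if x: "x \<in> space ?P" for x
  proof -
    have Tx: "T x \<in> space N" using T x by (rule measurable_space)
    have m: "(\<lambda>z. H (T x, z)) \<in> borel_measurable borel"
      using measurable_compose[OF measurable_Pair1'[OF Tx] H] by simp
    have "(\<integral>y. H' (x, y) \<partial>distr M ?Q ?Y) = (\<integral>\<omega>. H' (x, ?Y \<omega>) \<partial>M)"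
      by (rule integral_distr[OF rv2 measurable_compose[OF measurable_Pair1'[OF x] H']])
    also have "\<dots> = (\<integral>\<omega>. H (T x, \<xi> j \<omega>) \<partial>M)" by (simp add: H'_def)
    also have "\<dots> = (\<integral>z. H (T x, z) \<partial>gauss s)" by (rule integral_\<xi>(1)[OF j m])
    finally show ?thesis .
  qed
  have "(\<integral>\<omega>. H (T (past j \<omega>), \<xi> j \<omega>) \<partial>M) = integral\<^sup>L (distr M (?P \<Otimes>\<^sub>M ?Q) (\<lambda>\<omega>. (past j \<omega>, ?Y \<omega>))) H'"
    unfolding integral_distr[OF pm H'] e ..
  also have "\<dots> = integral\<^sup>L (distr M ?P (\<lambda>\<omega>. past j \<omega>) \<Otimes>\<^sub>M distr M ?Q ?Y) H'" unfolding D ..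
  also have "\<dots> = (\<integral>x. (\<integral>y. H' (x, y) \<partial>distr M ?Q ?Y) \<partial>distr M ?P (\<lambda>\<omega>. past j \<omega>))"
  proof (rule PP.integral_fst'[symmetric])
    show "integrable (distr M ?P (\<lambda>\<omega>. past j \<omega>) \<Otimes>\<^sub>M distr M ?Q ?Y) H'"
      unfolding D integrable_distr_eq[OF pm H'] e by (rule i)
  qed
  also have "\<dots> = (\<integral>x. (\<integral>z. H (T x, z) \<partial>gauss s) \<partial>distr M ?P (\<lambda>\<omega>. past j \<omega>))"
    by (rule Bochner_Integration.integral_cong[OF refl]) (simp add: inner)
  also have "\<dots> = (\<integral>\<omega>. (\<integral>z. H (T (past j \<omega>), z) \<partial>gauss s) \<partial>M)"
  proof (rule integral_distr[OF rv1])
    have "H \<in> borel_measurable (N \<Otimes>\<^sub>M gauss s)" using H by measurable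
    then have "(\<lambda>x. \<integral>z. H (x, z) \<partial>gauss s) \<in> borel_measurable N" by measurable
    from measurable_compose[OF T this] show "(\<lambda>x. \<integral>z. H (T x, z) \<partial>gauss s) \<in> borel_measurable ?P" .
  qed
  finally show ?thesis .
qed

abbreviation phase :: "nat \<Rightarrow> 'a \<Rightarrow> nat" where
  "phase j \<omega> \<equiv> fst (chain (\<lambda>i. \<xi> i \<omega>) j)"

abbreviation level :: "nat \<Rightarrow> 'a \<Rightarrow> real" where
  "level j \<omega> \<equiv> snd (chain (\<lambda>i. \<xi> i \<omega>) j)"

abbreviation proposal :: "nat \<Rightarrow> 'a \<Rightarrow> real" where
  "proposal j \<omega> \<equiv> level j \<omega> + (if even (phase j \<omega>) then - \<xi> j \<omega> else \<xi> j \<omega>)"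

lemma chain_past: "chain (past j \<omega>) j = chain (\<lambda>i. \<xi> i \<omega>) j"
  by (rule chain_cong) simp

lemma measurable_state:
  assumes "j \<le> n"
  shows "(\<lambda>\<omega>. chain (\<lambda>i. \<xi> i \<omega>) j) \<in> M \<rightarrow>\<^sub>M count_space UNIV \<Otimes>\<^sub>M borel"
proof -
  have "(\<lambda>\<omega>. past j \<omega>) \<in> M \<rightarrow>\<^sub>M PiM {..<j} (\<lambda>_. borel)"
    using assms measurable_\<xi> by (intro measurable_restrict) auto
  from measurable_compose[OF this measurable_chain[of j "{..<j}"]] show ?thesis by (simp add: chain_past)
qed

lemma proposal_step:
  assumes j: "j < n" and h: "(\<lambda>(k, y). h k y) \<in> borel_measurable (count_space UNIV \<Otimes>\<^sub>M borel)"
    and b: "\<And>k x z. 0 \<le> x \<Longrightarrow> x \<le> 1 \<Longrightarrow> \<bar>h k (x + z)\<bar> \<le> A * (1 + z ^ 4)"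
  shows "integrable M (\<lambda>\<omega>. h (phase j \<omega>) (proposal j \<omega>))"
    "(\<integral>\<omega>. h (phase j \<omega>) (proposal j \<omega>) \<partial>M) =
     (\<integral>\<omega>. (\<integral>z. h (phase j \<omega>) (level j \<omega> + (if even (phase j \<omega>) then - z else z)) \<partial>gauss s) \<partial>M)"
proof -
  define H where "H = (\<lambda>p :: (nat \<times> real) \<times> real. h (fst (fst p)) (snd (fst p) + (if even (fst (fst p)) then - snd p else snd p)))"
  have "(\<lambda>p :: (nat \<times> real) \<times> real. (fst (fst p), snd (fst p) + (if even (fst (fst p)) then - snd p else snd p)))
      \<in> (count_space UNIV \<Otimes>\<^sub>M borel) \<Otimes>\<^sub>M borel \<rightarrow>\<^sub>M count_space UNIV \<Otimes>\<^sub>M borel" by measurable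
  from measurable_compose[OF this h] have H: "H \<in> borel_measurable ((count_space UNIV \<Otimes>\<^sub>M borel) \<Otimes>\<^sub>M borel)"
    by (simp add: H_def)
  have e: "H (chain (past j \<omega>) j, \<xi> j \<omega>) = h (phase j \<omega>) (proposal j \<omega>)" for \<omega>
    by (simp add: H_def chain_past)
  have "(\<lambda>\<omega>. (chain (\<lambda>i. \<xi> i \<omega>) j, \<xi> j \<omega>)) \<in> M \<rightarrow>\<^sub>M (count_space UNIV \<Otimes>\<^sub>M borel) \<Otimes>\<^sub>M borel"
    using j by (intro measurable_Pair measurable_state measurable_\<xi>) auto
  from measurable_compose[OF this H] have m: "(\<lambda>\<omega>. h (phase j \<omega>) (proposal j \<omega>)) \<in> borel_measurable M"
    by (simp only: e[unfolded chain_past])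
  interpret G: prob_space "gauss s" by (rule prob_space_gauss[OF s])
  have dom: "integrable M (\<lambda>\<omega>. A * (1 + \<xi> j \<omega> ^ 4))"
    using gauss_moments(1)[OF s, of 4] integral_\<xi>(2)[OF j, of "\<lambda>z. A * (1 + z ^ 4)"] by simp
  have le: "\<bar>h (phase j \<omega>) (proposal j \<omega>)\<bar> \<le> A * (1 + \<xi> j \<omega> ^ 4)" for \<omega>
    using b[of "level j \<omega>" "phase j \<omega>" "- \<xi> j \<omega>"] b[of "level j \<omega>" "phase j \<omega>" "\<xi> j \<omega>"]
    by (auto simp: snd_chain_bounds)
  show i: "integrable M (\<lambda>\<omega>. h (phase j \<omega>) (proposal j \<omega>))"
  proof (rule Bochner_Integration.integrable_bound[OF dom m], rule AE_I2)
    show "norm (h (phase j \<omega>) (proposal j \<omega>)) \<le> norm (A * (1 + \<xi> j \<omega> ^ 4))" for \<omega>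
      unfolding real_norm_def by (rule order_trans[OF le abs_ge_self])
  qed
  show "(\<integral>\<omega>. h (phase j \<omega>) (proposal j \<omega>) \<partial>M) =
     (\<integral>\<omega>. (\<integral>z. h (phase j \<omega>) (level j \<omega> + (if even (phase j \<omega>) then - z else z)) \<partial>gauss s) \<partial>M)"
    using indep_step[OF j measurable_chain[OF order_refl] H] i
    unfolding e by (simp only: H_def chain_past fst_conv snd_conv)
qed

lemma abs_chain_value_le:
  assumes f: "compatible c C f" and x: "0 \<le> x" "x \<le> 1"
  shows "\<bar>chain_value f k (x + z)\<bar> \<le> 136 * (\<bar>f 0\<bar> + 2 * C) * (1 + z ^ 4)"
proof -
  let ?A = "\<bar>f 0\<bar> + 2 * C"
  have A: "0 \<le> ?A" using compatible_nonneg[OF f] by simp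
  have b: "\<bar>f (a + u)\<bar> \<le> 136 * ?A * (1 + z ^ 4)" if "0 \<le> a" "a \<le> 2" "u ^ 4 = z ^ 4" for a u
  proof -
    have "a ^ 4 \<le> 2 ^ 4" using that by (intro power_mono) auto
    then have "a ^ 4 \<le> 16" by simp
    moreover have "0 \<le> z ^ 4" by simp
    ultimately have "1 + a ^ 4 + z ^ 4 \<le> 17 * (1 + z ^ 4)" by argo
    then have "8 * ?A * ((1 + a ^ 4) + u ^ 4) \<le> 8 * ?A * (17 * (1 + z ^ 4))"
      using A that by (intro mult_left_mono) auto
    from order_trans[OF compatible_growth_shift[OF f] this]
    have "\<bar>f (a + u)\<bar> \<le> 8 * ?A * (17 * (1 + z ^ 4))" .
    also have "\<dots> = 136 * ?A * (1 + z ^ 4)" by (simp add: algebra_simps)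
    finally show ?thesis .
  qed
  have "f (1 + (x + z)) = f ((1 + x) + z)" "f (1 - (x + z)) = f ((1 - x) + - z)" by (simp_all add: algebra_simps)
  then show ?thesis using b[of x z] b[of "1 + x" z] b[of "1 - x" "- z"] x unfolding chain_value_def by auto
qed

lemma measurable_chain_value:
  assumes [measurable]: "f \<in> borel_measurable borel"
  shows "(\<lambda>(k, y). chain_value f k y) \<in> borel_measurable (count_space UNIV \<Otimes>\<^sub>M borel)"
  unfolding chain_value_def by measurable

definition gain :: "real \<Rightarrow> (real \<Rightarrow> real) \<Rightarrow> nat \<Rightarrow> 'a \<Rightarrow> real" where
  "gain c f j \<omega> = c * real (phase j \<omega> div 2) + chain_value f (phase j \<omega>) (level j \<omega>)"

lemma integrable_level_bounded:
  assumes j: "j \<le> n" and h: "(\<lambda>(k, y). h k y) \<in> borel_measurable (count_space UNIV \<Otimes>\<^sub>M borel)"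
    and b: "\<And>k x. k \<le> n \<Longrightarrow> 0 \<le> x \<Longrightarrow> x \<le> 1 \<Longrightarrow> \<bar>h k x\<bar> \<le> A"
  shows "integrable M (\<lambda>\<omega>. h (phase j \<omega>) (level j \<omega>) :: real)"
proof (rule integrable_const_bound[where B = A])
  from measurable_compose[OF measurable_state[OF j] h]
  show "(\<lambda>\<omega>. h (phase j \<omega>) (level j \<omega>)) \<in> borel_measurable M" by (simp add: split_beta)
  have "phase j \<omega> \<le> n" for \<omega> using fst_chain_le[of "\<lambda>i. \<xi> i \<omega>" j] j by simp
  then show "AE \<omega> in M. norm (h (phase j \<omega>) (level j \<omega>)) \<le> A"
    using b by (auto simp: snd_chain_bounds)
qed

lemma integrable_gain:
  assumes f: "compatible c C f" and j: "j \<le> n"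
  shows "integrable M (gain d f j)" "integrable M (\<lambda>\<omega>. real (phase j \<omega> div 2))"
    "integrable M (\<lambda>\<omega>. chain_value f (phase j \<omega>) (level j \<omega>))"
proof -
  have "real (k div 2) \<le> real n" if "k \<le> n" for k using that by linarith
  then show 1: "integrable M (\<lambda>\<omega>. real (phase j \<omega> div 2))"
    by (intro integrable_level_bounded[OF j, of "\<lambda>k _. real (k div 2)" "real n"]) auto
  show 2: "integrable M (\<lambda>\<omega>. chain_value f (phase j \<omega>) (level j \<omega>))"
    by (rule integrable_level_bounded[OF j measurable_chain_value[OF compatibleD(1)[OF f]]])
      (use abs_chain_value_le[OF f, of _ _ 0] in auto)
  show "integrable M (gain d f j)" unfolding gain_def[abs_def] using 1 2 by simp
qed

lemma lyapunov_bounds: "0 \<le> x \<Longrightarrow> x \<le> 1 \<Longrightarrow> \<bar>lyapunov x\<bar> \<le> 7" "- 1 \<le> lyapunov x"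
proof -
  assume x: "0 \<le> x" "x \<le> 1"
  then have "x\<^sup>2 \<le> 1" by (simp add: abs_square_le_1)
  then show "\<bar>lyapunov x\<bar> \<le> 7" using x by (auto simp: lyapunov_def abs_le_iff) (smt (verit) zero_le_power2)
next
  have "0 \<le> (x - 1)\<^sup>2" by simp
  then have "2 * x \<le> 1 + x\<^sup>2" by (simp add: power2_eq_square algebra_simps)
  moreover have "0 \<le> x\<^sup>2" by simp
  ultimately show "- 1 \<le> lyapunov x" unfolding lyapunov_def by argo
qed

lemma integrable_lyapunov: "j \<le> n \<Longrightarrow> integrable M (\<lambda>\<omega>. lyapunov (level j \<omega>))"
  by (rule integrable_level_bounded[of j "\<lambda>_. lyapunov" 7]) (auto simp: lyapunov_def[abs_def] intro: lyapunov_bounds(1)[unfolded lyapunov_def])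

text \<open>The linear terms in the Gaussian step have mean 0, so only the square contributes. Thus
  the total Lyapunov drop over all steps is governed by the variance of the walk.\<close>

lemma lyapunov_proposal:
  assumes j: "j < n"
  shows "integrable M (\<lambda>\<omega>. lyapunov (proposal j \<omega>))"
    "(\<integral>\<omega>. lyapunov (proposal j \<omega>) \<partial>M) = (\<integral>\<omega>. lyapunov (level j \<omega>) \<partial>M) + 7 * s\<^sup>2"
proof -
  interpret G: prob_space "gauss s" by (rule prob_space_gauss[OF s])
  have b: "\<bar>lyapunov (x + z)\<bar> \<le> 30 * (1 + z ^ 4)" if x: "0 \<le> x" "x \<le> 1" for x z
  proof -
    have "x\<^sup>2 \<le> 1" using x by (simp add: abs_square_le_1)
    then have 1: "(x + z)\<^sup>2 \<le> 2 * (1 + z\<^sup>2)" using square_add_le[of x z] by argo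
    have "0 \<le> (z\<^sup>2 - 1)\<^sup>2" "0 \<le> (x + z - 1)\<^sup>2" "0 \<le> (x + z + 1)\<^sup>2" by simp_all
    then have "2 * z\<^sup>2 \<le> 1 + z ^ 4" "2 * \<bar>x + z\<bar> \<le> 1 + (x + z)\<^sup>2"
      by (auto simp: power2_eq_square power4_eq_xxxx algebra_simps abs_le_iff abs_if)
    moreover have "\<bar>lyapunov (x + z)\<bar> \<le> 7 * (x + z)\<^sup>2 + \<bar>x + z\<bar>"
      unfolding lyapunov_def by (rule order_trans[OF abs_triangle_ineq4]) simp
    moreover have "0 \<le> z ^ 4" by simp
    ultimately show ?thesis using 1 by argo
  qed
  have m: "(\<lambda>(k :: nat, y). lyapunov y) \<in> borel_measurable (count_space UNIV \<Otimes>\<^sub>M borel)"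
    unfolding lyapunov_def by measurable
  show "integrable M (\<lambda>\<omega>. lyapunov (proposal j \<omega>))"
    by (rule proposal_step(1)[OF j m b])
  have iz: "integrable (gauss s) (\<lambda>z. z)" "integrable (gauss s) (\<lambda>z. z\<^sup>2)"
    using gauss_moments(1)[OF s, of 1] gauss_moments(1)[OF s, of 2] by simp_all
  have "(\<integral>z. lyapunov (x + (if even k then - z else z)) \<partial>gauss s) = lyapunov x + 7 * s\<^sup>2" for x and k :: nat
  proof -
    define e :: real where "e = (if even k then - 1 else 1)"
    have e: "e\<^sup>2 = 1" by (simp add: e_def)
    have "lyapunov (x + (if even k then - z else z)) = lyapunov x + (14 * x * e - e) * z + 7 * z\<^sup>2" for z
      using e by (simp add: e_def lyapunov_def power2_eq_square algebra_simps)
    then show ?thesis using iz gauss_moments(3,5)[OF s] G.prob_space by simp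
  qed
  then show "(\<integral>\<omega>. lyapunov (proposal j \<omega>) \<partial>M) = (\<integral>\<omega>. lyapunov (level j \<omega>) \<partial>M) + 7 * s\<^sup>2"
    using proposal_step(2)[OF j m b] integrable_lyapunov[of j] j prob_space by simp
qed

text \<open>By \<open>chain_value_conv\<close> the gain with the averaged function is the mean over
  unclamped proposals; \<open>chain_step_value\<close> then bounds the difference. The 18 is 6 times
  the Gaussian fourth moment factor 3.\<close>

lemma gain_step:
  assumes f: "compatible c C f" and j: "j < n" and \<delta>: "0 < \<delta>" "\<delta> \<le> 1"
  shows "\<bar>(\<integral>\<omega>. gain c f (Suc j) \<omega> \<partial>M) - (\<integral>\<omega>. gain c (gauss_conv s f) j \<omega> \<partial>M)\<bar> \<le>
    C * (\<delta> * ((\<integral>\<omega>. lyapunov (level j \<omega>) \<partial>M) + 7 * s\<^sup>2 - (\<integral>\<omega>. lyapunov (level (Suc j) \<omega>) \<partial>M)) + 18 * s ^ 4 / \<delta> ^ 3)"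
proof -
  let ?v = "\<lambda>\<omega>. chain_value f (phase j \<omega>) (proposal j \<omega>)"
  have jn: "j \<le> n" "Suc j \<le> n" using j by auto
  note V = proposal_step[OF j measurable_chain_value[OF compatibleD(1)[OF f]] abs_chain_value_le[OF f]]
  have iv: "integrable M (\<lambda>\<omega>. c * real (phase j \<omega> div 2) + ?v \<omega>)"
    using V(1) integrable_gain(2)[OF f jn(1)] by simp
  have eq: "(\<integral>\<omega>. gain c (gauss_conv s f) j \<omega> \<partial>M) = (\<integral>\<omega>. c * real (phase j \<omega> div 2) + ?v \<omega> \<partial>M)"
    unfolding gain_def using V integrable_gain(2,3)[OF compatible_conv[OF f s] jn(1)] integrable_gain(2)[OF f jn(1)]
    by (simp add: chain_value_conv[OF f s])
  have i1: "integrable M (\<lambda>\<omega>. \<bar>gain c f (Suc j) \<omega> - (c * real (phase j \<omega> div 2) + ?v \<omega>)\<bar>)"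
    by (rule integrable_abs[OF Bochner_Integration.integrable_diff[OF integrable_gain(1)[OF f jn(2)] iv]])
  have i4: "integrable M (\<lambda>\<omega>. \<xi> j \<omega> ^ 4)"
    using gauss_moments(1)[OF s, of 4] integral_\<xi>(2)[OF j, of "\<lambda>z. z ^ 4"] by simp
  have i2: "integrable M (\<lambda>\<omega>. C * (\<delta> * (lyapunov (proposal j \<omega>) - lyapunov (level (Suc j) \<omega>)) + 6 / \<delta> ^ 3 * \<xi> j \<omega> ^ 4))"
    by (intro integrable_mult_right Bochner_Integration.integrable_add Bochner_Integration.integrable_diff
        lyapunov_proposal(1)[OF j] integrable_lyapunov[OF jn(2)] i4)
  have le: "\<bar>gain c f (Suc j) \<omega> - (c * real (phase j \<omega> div 2) + ?v \<omega>)\<bar> \<le>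
      C * (\<delta> * (lyapunov (proposal j \<omega>) - lyapunov (level (Suc j) \<omega>)) + 6 / \<delta> ^ 3 * \<xi> j \<omega> ^ 4)" for \<omega>
    using chain_step_value[OF f snd_chain_bounds \<delta>, of "phase j \<omega>" "\<lambda>i. \<xi> i \<omega>" j "\<xi> j \<omega>"]
    by (simp only: gain_def chain.simps prod.collapse)
  from eq have eq2: "(\<integral>\<omega>. gain c f (Suc j) \<omega> \<partial>M) - (\<integral>\<omega>. gain c (gauss_conv s f) j \<omega> \<partial>M) =
      (\<integral>\<omega>. gain c f (Suc j) \<omega> - (c * real (phase j \<omega> div 2) + ?v \<omega>) \<partial>M)"
    using iv integrable_gain(1)[OF f jn(2), of c] by simp
  have "\<bar>(\<integral>\<omega>. gain c f (Suc j) \<omega> \<partial>M) - (\<integral>\<omega>. gain c (gauss_conv s f) j \<omega> \<partial>M)\<bar>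
      \<le> (\<integral>\<omega>. \<bar>gain c f (Suc j) \<omega> - (c * real (phase j \<omega> div 2) + ?v \<omega>)\<bar> \<partial>M)"
    unfolding eq2 by (rule integral_abs_bound)
  also have "\<dots> \<le> (\<integral>\<omega>. C * (\<delta> * (lyapunov (proposal j \<omega>) - lyapunov (level (Suc j) \<omega>)) + 6 / \<delta> ^ 3 * \<xi> j \<omega> ^ 4) \<partial>M)"
    by (rule integral_mono[OF i1 i2 le])
  also have "\<dots> = C * (\<delta> * ((\<integral>\<omega>. lyapunov (proposal j \<omega>) \<partial>M) - (\<integral>\<omega>. lyapunov (level (Suc j) \<omega>) \<partial>M)) + 6 / \<delta> ^ 3 * (\<integral>\<omega>. \<xi> j \<omega> ^ 4 \<partial>M))"
    by (simp only: integral_mult_right_zero Bochner_Integration.integral_add Bochner_Integration.integral_diff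
        integrable_mult_right Bochner_Integration.integrable_diff
        lyapunov_proposal(1)[OF j] integrable_lyapunov[OF jn(2)] i4)
  also have "(\<integral>\<omega>. \<xi> j \<omega> ^ 4 \<partial>M) = 3 * s ^ 4"
    using integral_\<xi>(1)[OF j, of "\<lambda>z. z ^ 4"] gauss_moments(4)[OF s] by simp
  finally show ?thesis by (simp add: lyapunov_proposal(2)[OF j])
qed

lemma sum_step:
  assumes f: "compatible c C f" and j: "j < n"
  shows "(\<integral>\<omega>. f (\<Sum>i<Suc j. \<xi> i \<omega>) \<partial>M) = (\<integral>\<omega>. gauss_conv s f (\<Sum>i<j. \<xi> i \<omega>) \<partial>M)"
proof -
  have [measurable]: "f \<in> borel_measurable borel" by (rule compatibleD(1)[OF f])
  have T: "(\<lambda>w. \<Sum>i<j. w i) \<in> PiM {..<j} (\<lambda>_. borel) \<rightarrow>\<^sub>M (borel :: real measure)" by measurable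
  have i4: "k \<le> n \<Longrightarrow> integrable M (\<lambda>\<omega>. (\<Sum>i<k. \<xi> i \<omega>) ^ 4)" for k
  proof (induction k)
    case (Suc k)
    have m: "(\<lambda>\<omega>. \<Sum>i<Suc k. \<xi> i \<omega>) \<in> borel_measurable M" using Suc measurable_\<xi> by (intro borel_measurable_sum) auto
    show ?case
    proof (rule Bochner_Integration.integrable_bound)
      show "integrable M (\<lambda>\<omega>. 8 * ((\<Sum>i<k. \<xi> i \<omega>) ^ 4 + \<xi> k \<omega> ^ 4))"
        using Suc gauss_moments(1)[OF s, of 4] integral_\<xi>(2)[of k "\<lambda>z. z ^ 4"] by simp
      show "AE \<omega> in M. norm ((\<Sum>i<Suc k. \<xi> i \<omega>) ^ 4) \<le> norm (8 * ((\<Sum>i<k. \<xi> i \<omega>) ^ 4 + \<xi> k \<omega> ^ 4))"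
        using fourth_power_add_le by (auto simp: abs_of_nonneg)
    qed (use m in measurable)
  qed simp
  have "integrable M (\<lambda>\<omega>. f (\<Sum>i<Suc j. \<xi> i \<omega>))"
  proof (rule Bochner_Integration.integrable_bound)
    show "integrable M (\<lambda>\<omega>. (\<bar>f 0\<bar> + 2 * C) * (1 + (\<Sum>i<Suc j. \<xi> i \<omega>) ^ 4))" using i4[of "Suc j"] j by simp
    have "(\<lambda>\<omega>. \<Sum>i<Suc j. \<xi> i \<omega>) \<in> borel_measurable M" using j measurable_\<xi> by (intro borel_measurable_sum) auto
    then show "(\<lambda>\<omega>. f (\<Sum>i<Suc j. \<xi> i \<omega>)) \<in> borel_measurable M" by measurable
    show "AE \<omega> in M. norm (f (\<Sum>i<Suc j. \<xi> i \<omega>)) \<le> norm ((\<bar>f 0\<bar> + 2 * C) * (1 + (\<Sum>i<Suc j. \<xi> i \<omega>) ^ 4))"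
      using compatible_growth[OF f] by (intro AE_I2) (force intro: order_trans[OF _ abs_ge_self])
  qed
  then show ?thesis
    using indep_step[OF j T, of "\<lambda>p. f (fst p + snd p)"] by (simp add: gauss_conv_def)
qed

lemma compatible_conv_funpow:
  assumes "compatible c C G"
  shows "compatible c (C * (1 + s\<^sup>2) ^ m) ((gauss_conv s ^^ m) G)"
proof (induction m)
  case (Suc m)
  from compatible_conv[OF this s] show ?case by (simp add: mult_ac)
qed (use assms in simp)

text \<open>The expected gain, backpropagated by the Gaussian semigroup, changes little in each step,
  while the same backpropagation along the unreflected walk is exact.\<close>

lemma chain_expectation:
  assumes G: "compatible c C G" and s1: "s \<le> 1"
  defines "v \<equiv> real n * s\<^sup>2"
  shows "\<bar>(\<integral>\<omega>. gain c G n \<omega> \<partial>M) - (\<integral>\<omega>. G (\<Sum>i<n. \<xi> i \<omega>) \<partial>M)\<bar> \<le> C * exp v * ((1 + 25 * v) * sqrt s)"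
proof -
  \<comment> \<open>The terminal function averaged over the \<open>n - j\<close> steps still to
    come.\<close>
  define f where "f j = (gauss_conv s ^^ (n - j)) G" for j
  have C: "0 \<le> C" by (rule compatible_nonneg[OF G])
  have cf: "compatible c (C * (1 + s\<^sup>2) ^ (n - j)) (f j)" for j
    unfolding f_def by (rule compatible_conv_funpow[OF G])
  have fS: "gauss_conv s (f (Suc j)) = f j" if "j < n" for j
    using that by (simp add: f_def Suc_diff_Suc[symmetric])
  have Cb: "C * (1 + s\<^sup>2) ^ (n - j) \<le> C * exp v" for j
  proof -
    have "(1 + s\<^sup>2) ^ (n - j) \<le> (1 + s\<^sup>2) ^ n" by (intro power_increasing) auto
    also have "\<dots> \<le> exp (s\<^sup>2) ^ n" by (intro power_mono) (auto intro: exp_ge_add_one_self)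
    also have "\<dots> = exp v" by (simp add: v_def exp_of_nat_mult[symmetric])
    finally show ?thesis using C by (intro mult_left_mono)
  qed
  \<comment> \<open>Balances the two errors: the Lyapunov part is of order \<open>\<delta>\<close>
    and the large steps contribute \<open>n * s ^ 4 / \<delta> ^ 3\<close>, that is
    \<open>v * s\<^sup>2 / \<delta> ^ 3\<close>; both become of order \<open>sqrt s\<close>.\<close>
  define \<delta> where "\<delta> = sqrt s"
  have \<delta>: "0 < \<delta>" "\<delta> \<le> 1" using s s1 by (auto simp: \<delta>_def)
  let ?L = "\<lambda>j. \<integral>\<omega>. lyapunov (level j \<omega>) \<partial>M"
  let ?E = "\<lambda>j. \<delta> * (?L j + 7 * s\<^sup>2 - ?L (Suc j)) + 18 * s ^ 4 / \<delta> ^ 3"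
  \<comment> \<open>Nonnegativity comes for free from \<open>gain_step\<close> with the zero
    function and constant 1.\<close>
  have E0: "0 \<le> ?E j" if "j < n" for j
  proof -
    have "compatible 0 1 (\<lambda>_. 0)" by (simp add: compatible_def)
    from order_trans[OF abs_ge_zero gain_step[OF this that \<delta>]] show ?thesis by simp
  qed
  have step: "\<bar>(\<integral>\<omega>. gain c (f (Suc j)) (Suc j) \<omega> \<partial>M) - (\<integral>\<omega>. gain c (f j) j \<omega> \<partial>M)\<bar> \<le> C * exp v * ?E j" if "j < n" for j
    using gain_step[OF cf that \<delta>, of "Suc j"] mult_right_mono[OF Cb[of "Suc j"] E0[OF that]]
    unfolding fS[OF that] by linarith
  have tel: "j \<le> n \<Longrightarrow> \<bar>(\<integral>\<omega>. gain c (f j) j \<omega> \<partial>M) - (\<integral>\<omega>. gain c (f 0) 0 \<omega> \<partial>M)\<bar> \<le>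
      C * exp v * (\<delta> * (?L 0 + real j * (7 * s\<^sup>2) - ?L j) + real j * (18 * s ^ 4 / \<delta> ^ 3))" for j
  proof (induction j)
    case (Suc j)
    have "\<bar>(\<integral>\<omega>. gain c (f (Suc j)) (Suc j) \<omega> \<partial>M) - (\<integral>\<omega>. gain c (f 0) 0 \<omega> \<partial>M)\<bar> \<le>
       C * exp v * (\<delta> * (?L 0 + real j * (7 * s\<^sup>2) - ?L j) + real j * (18 * s ^ 4 / \<delta> ^ 3)) + C * exp v * ?E j"
      using Suc step[of j] by linarith
    also have "\<dots> = C * exp v * (\<delta> * (?L 0 + real (Suc j) * (7 * s\<^sup>2) - ?L (Suc j)) + real (Suc j) * (18 * s ^ 4 / \<delta> ^ 3))"
      unfolding distrib_left[symmetric] of_nat_Suc by (simp only: distrib_left distrib_right right_diff_distrib)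
    finally show ?case .
  qed simp
  \<comment> \<open>The telescoped Lyapunov terms leave only their endpoints: the start is 0 and the
    end is at least -1.\<close>
  have "?L n \<ge> (\<integral>\<omega>. - 1 \<partial>M)"
    by (intro integral_mono integrable_lyapunov lyapunov_bounds) auto
  then have Ln: "- 1 \<le> ?L n" using prob_space by simp
  have s4: "s ^ 4 = s\<^sup>2 * (\<delta> * \<delta> ^ 3)"
  proof -
    have "\<delta> * \<delta> ^ 3 = (\<delta>\<^sup>2)\<^sup>2" by (simp add: numeral_eq_Suc)
    also have "\<dots> = s\<^sup>2" using s by (simp add: \<delta>_def)
    finally show ?thesis by (simp flip: power_add)
  qed
  have "\<delta> * (?L 0 + real n * (7 * s\<^sup>2) - ?L n) + real n * (18 * s ^ 4 / \<delta> ^ 3) \<le> \<delta> * (1 + 7 * v) + 18 * v * \<delta>"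
    using Ln \<delta> unfolding s4 by (simp add: v_def lyapunov_def mult_ac)
  also have "\<dots> = (1 + 25 * v) * sqrt s" by (simp add: \<delta>_def algebra_simps)
  finally have "C * exp v * (\<delta> * (?L 0 + real n * (7 * s\<^sup>2) - ?L n) + real n * (18 * s ^ 4 / \<delta> ^ 3)) \<le> C * exp v * ((1 + 25 * v) * sqrt s)"
    using C by (intro mult_left_mono) auto
  then have main: "\<bar>(\<integral>\<omega>. gain c G n \<omega> \<partial>M) - (\<integral>\<omega>. gain c (f 0) 0 \<omega> \<partial>M)\<bar> \<le> C * exp v * ((1 + 25 * v) * sqrt s)"
    using tel[of n] by (simp add: f_def)
  have "j \<le> n \<Longrightarrow> (\<integral>\<omega>. f j (\<Sum>i<j. \<xi> i \<omega>) \<partial>M) = f 0 0" for j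
  proof (induction j)
    case (Suc j)
    then show ?case using sum_step[OF cf, of j "Suc j"] by (simp add: fS)
  qed (simp add: prob_space)
  from this[of n] have "(\<integral>\<omega>. G (\<Sum>i<n. \<xi> i \<omega>) \<partial>M) = f 0 0" by (simp add: f_def)
  moreover have "(\<integral>\<omega>. gain c (f 0) 0 \<omega> \<partial>M) = f 0 0" using prob_space by (simp add: gain_def chain_value_def)
  ultimately show ?thesis using main by simp
qed

text \<open>The vector of steps and its negative have the same law, a product of symmetric
  Gaussians, and the phase is a measurable function of that vector.\<close>

lemma phase_symmetric:
  assumes "0 < n"
  shows "(\<integral>\<omega>. of_bool (odd (phase n \<omega>)) \<partial>M) = (\<integral>\<omega>. (of_bool (odd (fst (chain (\<lambda>i. - \<xi> i \<omega>) n))) :: real) \<partial>M)"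
proof -
  let ?P = "PiM {..<n} (\<lambda>_. borel) :: (nat \<Rightarrow> real) measure"
  have law_eq: "distr M ?P (\<lambda>\<omega>. \<lambda>i\<in>{..<n}. X i \<omega>) = PiM {..<n} (\<lambda>_. gauss s)"
    if X: "indep_vars (\<lambda>_. borel) X {..<n}" and d: "\<And>i. i < n \<Longrightarrow> distr M borel (X i) = gauss s" for X
  proof -
    have "distr M ?P (\<lambda>\<omega>. \<lambda>i\<in>{..<n}. X i \<omega>) = PiM {..<n} (\<lambda>i. distr M borel (X i))"
      using X assms by (subst indep_vars_iff_distr_eq_PiM'[symmetric]) (auto simp: indep_vars_def)
    also have "\<dots> = PiM {..<n} (\<lambda>_. gauss s)" by (rule PiM_cong) (auto simp: d)
    finally show ?thesis .
  qed
  have E: "(\<integral>\<omega>. of_bool (odd (fst (chain (\<lambda>i. X i \<omega>) n))) \<partial>M) =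
      (\<integral>w. (of_bool (odd (fst (chain w n))) :: real) \<partial>PiM {..<n} (\<lambda>_. gauss s))"
    if X: "indep_vars (\<lambda>_. borel) X {..<n}" and d: "\<And>i. i < n \<Longrightarrow> distr M borel (X i) = gauss s" for X
  proof -
    have mX: "(\<lambda>\<omega>. \<lambda>i\<in>{..<n}. X i \<omega>) \<in> M \<rightarrow>\<^sub>M ?P"
      using X by (intro measurable_restrict) (auto simp: indep_vars_def)
    have "(\<lambda>p :: nat \<times> real. of_bool (odd (fst p)) :: real) \<in> borel_measurable (count_space UNIV \<Otimes>\<^sub>M borel)"
      by measurable
    from measurable_compose[OF measurable_chain[OF order_refl] this]
    have mw: "(\<lambda>w. of_bool (odd (fst (chain w n))) :: real) \<in> borel_measurable ?P" .
    have "chain (\<lambda>i. X i \<omega>) n = chain (\<lambda>i\<in>{..<n}. X i \<omega>) n" for \<omega> by (rule chain_cong) simp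
    then have "(\<integral>\<omega>. of_bool (odd (fst (chain (\<lambda>i. X i \<omega>) n))) \<partial>M) =
        (\<integral>\<omega>. (of_bool (odd (fst (chain (\<lambda>i\<in>{..<n}. X i \<omega>) n))) :: real) \<partial>M)" by (simp only:)
    also have "\<dots> = (\<integral>w. of_bool (odd (fst (chain w n))) \<partial>distr M ?P (\<lambda>\<omega>. \<lambda>i\<in>{..<n}. X i \<omega>))"
      by (rule integral_distr[OF mX mw, symmetric])
    also have "distr M ?P (\<lambda>\<omega>. \<lambda>i\<in>{..<n}. X i \<omega>) = PiM {..<n} (\<lambda>_. gauss s)"
      by (rule law_eq[OF X]) (rule d)
    finally show ?thesis .
  qed
  have "indep_vars (\<lambda>_. borel) (\<lambda>i \<omega>. - \<xi> i \<omega>) {..<n}"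
    using indep_vars_compose2[OF indep, of "\<lambda>_ x. - x" "\<lambda>_. borel"] by simp
  moreover have "distr M borel (\<lambda>\<omega>. - \<xi> i \<omega>) = gauss s" if i: "i < n" for i
  proof (rule measure_eqI)
    fix A :: "real set" assume "A \<in> sets (distr M borel (\<lambda>\<omega>. - \<xi> i \<omega>))"
    then have A[measurable]: "A \<in> sets borel" by simp
    note [measurable] = measurable_\<xi>[OF i]
    interpret D: prob_space "distr M borel (\<lambda>\<omega>. - \<xi> i \<omega>)" by (rule prob_space_distr) measurable
    interpret N: prob_space "gauss s" by (rule prob_space_gauss[OF s])
    have "measure (distr M borel (\<lambda>\<omega>. - \<xi> i \<omega>)) A = (\<integral>x. indicator A x \<partial>distr M borel (\<lambda>\<omega>. - \<xi> i \<omega>))"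
      by simp
    also have "\<dots> = (\<integral>\<omega>. indicator A (- \<xi> i \<omega>) \<partial>M)" by (rule integral_distr) measurable
    also have "\<dots> = (\<integral>x. indicator A (- x) \<partial>gauss s)" using i by (intro integral_\<xi>) measurable
    also have "\<dots> = (\<integral>x. indicator A x \<partial>gauss s)" by (rule gauss_minus) measurable
    also have "\<dots> = measure (gauss s) A" by simp
    finally show "emeasure (distr M borel (\<lambda>\<omega>. - \<xi> i \<omega>)) A = emeasure (gauss s) A"
      by (simp add: D.emeasure_eq_measure N.emeasure_eq_measure)
  qed simp
  ultimately show ?thesis using E[OF indep law] E[of "\<lambda>i \<omega>. - \<xi> i \<omega>"] by simp
qed

end

subsection \<open>Passage to Brownian motion\<close>

lemma abs_le_one_plus_square: "\<bar>y\<bar> \<le> 1 + y\<^sup>2" for y :: real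
proof -
  have "0 \<le> (\<bar>y\<bar> - 1)\<^sup>2" by simp
  then have "2 * \<bar>y\<bar> \<le> 1 + y\<^sup>2" by (simp add: power2_eq_square algebra_simps)
  then show ?thesis using abs_ge_zero[of y] by argo
qed

lemma DERIV_poisson_ker:
  assumes "0 \<le> r" "r < 1" "c \<le> 1"
  shows "(poisson_ker r has_real_derivative 2 * r * (1 - r\<^sup>2) / (1 - 2 * r * c + r\<^sup>2)\<^sup>2) (at c)"
  unfolding poisson_ker_def[abs_def] using poisson_denom_pos[OF assms]
  by (auto intro!: derivative_eq_intros simp: power2_eq_square)

text \<open>For fixed \<open>r\<close> the Poisson denominators stay above
  \<open>(1 - r)\<^sup>2\<close>, so \<open>profile_ker\<close> and its derivative are bounded. The
  resulting constant explodes as \<open>r\<close> tends to 1, which is harmless since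
  \<open>r\<close> is fixed before the grid is refined.\<close>

lemma compatible_profile:
  assumes r: "0 \<le> r" "r < 1"
  shows "\<exists>C. compatible 1 C (profile r)"
proof -
  define D where "D c = 2 * r * (1 - r\<^sup>2) / (1 - 2 * r * c + r\<^sup>2)\<^sup>2" for c
  define K' where "K' y = pi * sin (pi * y) * (2 * D (- cos (pi * y)) + D (cos (pi * y)))" for y
  define A where "A = 3 / (1 - r)\<^sup>2 + 6 * pi / (1 - r) ^ 4"
  have Db: "\<bar>D c\<bar> \<le> 2 / (1 - r) ^ 4" if "c \<le> 1" for c
  proof -
    have "((1 - r)\<^sup>2)\<^sup>2 \<le> (1 - 2 * r * c + r\<^sup>2)\<^sup>2"
      using poisson_denom_ge[of r c] r that by (intro power_mono) auto
    moreover have "r * (1 - r\<^sup>2) \<le> 1 * 1" using r by (intro mult_mono) (auto simp: power_le_one)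
    moreover have "0 \<le> r * (1 - r\<^sup>2)" using r by (auto simp: power_le_one)
    moreover have "0 < (1 - r) ^ 4" using r by simp
    ultimately show ?thesis unfolding D_def abs_divide by (intro frac_le) (auto simp flip: power_mult)
  qed
  have K: "(profile_ker r has_real_derivative K' y) (at y)" for y
  proof -
    have c: "- cos (pi * y) \<le> 1" using cos_ge_minus_one[of "pi * y"] by linarith
    have i: "((\<lambda>y. - cos (pi * y)) has_real_derivative pi * sin (pi * y)) (at y)"
      "((\<lambda>y. cos (pi * y)) has_real_derivative - (pi * sin (pi * y))) (at y)"
      by (auto intro!: derivative_eq_intros)
    have "((\<lambda>y. 2 * poisson_ker r (- cos (pi * y)) - poisson_ker r (cos (pi * y))) has_real_derivative
        2 * (D (- cos (pi * y)) * (pi * sin (pi * y))) - D (cos (pi * y)) * (- (pi * sin (pi * y)))) (at y)"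
      unfolding D_def
      by (intro DERIV_diff DERIV_cmult DERIV_chain2[OF DERIV_poisson_ker[OF r c] i(1)]
          DERIV_chain2[OF DERIV_poisson_ker[OF r cos_le_one] i(2)])
    then show ?thesis unfolding profile_ker_def[abs_def] K'_def by (simp add: algebra_simps)
  qed
  have Kb: "\<bar>profile_ker r y\<bar> \<le> 3 / (1 - r)\<^sup>2" for y
  proof -
    have c: "- cos (pi * y) \<le> 1" "cos (pi * y) \<le> 1" using cos_ge_minus_one[of "pi * y"] by auto
    have "3 / (1 - r)\<^sup>2 = 2 * (1 / (1 - r)\<^sup>2) + 1 / (1 - r)\<^sup>2" by simp
    then show ?thesis unfolding profile_ker_def abs_le_iff
      using poisson_ker_le[OF r c(1)] poisson_ker_le[OF r c(2)] poisson_ker_nonneg[OF r c(1)] poisson_ker_nonneg[OF r c(2)]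
      by argo
  qed
  have K'b: "\<bar>K' y\<bar> \<le> 6 * pi / (1 - r) ^ 4" for y
  proof -
    have c: "- cos (pi * y) \<le> 1" "cos (pi * y) \<le> 1" using cos_ge_minus_one[of "pi * y"] by auto
    have "\<bar>2 * D (- cos (pi * y)) + D (cos (pi * y))\<bar> \<le> 2 * (2 / (1 - r) ^ 4) + 2 / (1 - r) ^ 4"
      using Db[OF c(1)] Db[OF c(2)] unfolding abs_le_iff by argo
    then have "\<bar>K' y\<bar> \<le> (pi * 1) * (2 * (2 / (1 - r) ^ 4) + 2 / (1 - r) ^ 4)"
      unfolding K'_def abs_mult using pi_ge_zero by (intro mult_mono) auto
    then show ?thesis by (simp add: mult.commute)
  qed
  have "compatible 1 (4 * A) (profile r)"
  proof (rule compatible_of_DERIV)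
    show "profile r (y + 2) + profile r (y - 2) = 2 * profile r y + 4 * 1" for y using profile_shift[OF r] by simp
    show "(profile r has_real_derivative y * profile_ker r y) (at y)" for y by (rule DERIV_profile[OF r])
    show "((\<lambda>y. y * profile_ker r y) has_real_derivative profile_ker r y + y * K' y) (at y)" for y
      by (auto intro!: derivative_eq_intros K)
    have P: "0 \<le> 3 / (1 - r)\<^sup>2" "0 \<le> 6 * pi / (1 - r) ^ 4" by simp_all
    have 1: "\<bar>y * profile_ker r y\<bar> \<le> 3 / (1 - r)\<^sup>2 * (1 + y\<^sup>2)" for y
      unfolding abs_mult mult.commute[of "\<bar>y\<bar>"] by (intro mult_mono Kb abs_le_one_plus_square P) simp
    have 2: "\<bar>y * K' y\<bar> \<le> 6 * pi / (1 - r) ^ 4 * (1 + y\<^sup>2)" for y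
      unfolding abs_mult mult.commute[of "\<bar>y\<bar>"] by (intro mult_mono K'b abs_le_one_plus_square P) simp
    have 3: "\<bar>profile_ker r y\<bar> \<le> 3 / (1 - r)\<^sup>2 * (1 + y\<^sup>2)" for y
      using Kb[of y] mult_nonneg_nonneg[OF P(1) zero_le_power2[of y]] unfolding distrib_left by argo
    show "\<bar>y * profile_ker r y\<bar> \<le> A * (1 + y\<^sup>2)" for y
      using 1[of y] mult_nonneg_nonneg[OF P(2) add_nonneg_nonneg[OF zero_le_one zero_le_power2[of y]]] unfolding A_def distrib_right[of _ _ "1 + y\<^sup>2"] by argo
    show "\<bar>profile_ker r y + y * K' y\<bar> \<le> A * (1 + y\<^sup>2)" for y
      unfolding A_def distrib_right by (rule order_trans[OF abs_triangle_ineq add_mono[OF 3 2]])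
  qed (rule profile_minus)
  then show ?thesis ..
qed

text \<open>Equals 1 at the integers and decays to 0 elsewhere as \<open>a\<close> grows. Having
  period 1 and being even, it has the same chain value in both phases, so it measures how likely the
  final level is near the threshold.\<close>

definition bump :: "real \<Rightarrow> real \<Rightarrow> real" where
  "bump a y = exp (- (a * (1 - cos (2 * pi * y))))"

lemma bump_bounds: "0 \<le> a \<Longrightarrow> 0 < bump a y" "0 \<le> a \<Longrightarrow> bump a y \<le> 1"
  by (auto simp: bump_def)

lemma bump_add_int: "bump a (y + of_int i) = bump a y"
proof -
  have "2 * pi * (y + of_int i) = 2 * pi * y + 2 * pi * of_int i" by (simp add: distrib_left)
  then show ?thesis unfolding bump_def by (simp add: cos_add cos_int_2pin sin_int_2pin)
qed

lemma bump_minus: "bump a (- y) = bump a y"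
  by (simp add: bump_def)

lemma compatible_bump:
  assumes a: "0 \<le> a"
  shows "\<exists>C. compatible 0 C (bump a)"
proof -
  let ?c = "2 * pi * a"
  have b: "\<bar>bump a y\<bar> \<le> 1" "0 \<le> bump a y" for y using bump_bounds[OF a, of y] by auto
  have "compatible 0 (4 * (?c + (?c\<^sup>2 + 4 * pi\<^sup>2 * a))) (bump a)"
  proof (rule compatible_of_DERIV)
    show "bump a (y + 2) + bump a (y - 2) = 2 * bump a y + 4 * 0" for y
      using bump_add_int[of a y 2] bump_add_int[of a y "- 2"] by simp
    show "(bump a has_real_derivative - (?c * sin (2 * pi * y)) * bump a y) (at y)" for y
      unfolding bump_def[abs_def] by (auto intro!: derivative_eq_intros)
    then show "((\<lambda>y. - (?c * sin (2 * pi * y)) * bump a y) has_real_derivative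
        (?c\<^sup>2 * (sin (2 * pi * y))\<^sup>2 - 4 * pi\<^sup>2 * a * cos (2 * pi * y)) * bump a y) (at y)" for y
      by (auto intro!: derivative_eq_intros simp: power2_eq_square algebra_simps)
    have sc: "\<bar>sin (2 * pi * y)\<bar> \<le> 1" "\<bar>cos (2 * pi * y)\<bar> \<le> 1" "(sin (2 * pi * y))\<^sup>2 \<le> 1" for y
      by (auto simp: abs_square_le_1)
    have c: "0 \<le> ?c" "0 \<le> 4 * pi\<^sup>2 * a" "0 \<le> ?c\<^sup>2" using a by auto
    have 1: "\<bar>- (?c * sin (2 * pi * y)) * bump a y\<bar> \<le> ?c" for y
    proof -
      have "\<bar>?c * sin (2 * pi * y)\<bar> * \<bar>bump a y\<bar> \<le> (?c * 1) * 1"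
        unfolding abs_mult[of ?c] using c sc b by (intro mult_mono) auto
      then show ?thesis by (simp add: abs_mult)
    qed
    have 2: "\<bar>(?c\<^sup>2 * (sin (2 * pi * y))\<^sup>2 - 4 * pi\<^sup>2 * a * cos (2 * pi * y)) * bump a y\<bar> \<le> ?c\<^sup>2 + 4 * pi\<^sup>2 * a" for y
    proof -
      have "\<bar>?c\<^sup>2 * (sin (2 * pi * y))\<^sup>2\<bar> \<le> ?c\<^sup>2 * 1"
        unfolding abs_mult using c sc by (intro mult_mono) auto
      moreover have "\<bar>4 * pi\<^sup>2 * a * cos (2 * pi * y)\<bar> \<le> 4 * pi\<^sup>2 * a * 1"
        unfolding abs_mult[of "4 * pi\<^sup>2 * a"] using c sc by (intro mult_mono) auto
      ultimately have "\<bar>?c\<^sup>2 * (sin (2 * pi * y))\<^sup>2 - 4 * pi\<^sup>2 * a * cos (2 * pi * y)\<bar> \<le> ?c\<^sup>2 + 4 * pi\<^sup>2 * a"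
        using abs_triangle_ineq4[of "?c\<^sup>2 * (sin (2 * pi * y))\<^sup>2" "4 * pi\<^sup>2 * a * cos (2 * pi * y)"] by argo
      then have "\<bar>?c\<^sup>2 * (sin (2 * pi * y))\<^sup>2 - 4 * pi\<^sup>2 * a * cos (2 * pi * y)\<bar> * \<bar>bump a y\<bar> \<le> (?c\<^sup>2 + 4 * pi\<^sup>2 * a) * 1"
        using c b by (intro mult_mono) auto
      then show ?thesis by (simp add: abs_mult)
    qed
    have up: "u \<le> (?c + (?c\<^sup>2 + 4 * pi\<^sup>2 * a)) * (1 + y\<^sup>2)" if "u \<le> ?c + (?c\<^sup>2 + 4 * pi\<^sup>2 * a)" for u y
    proof -
      have "(?c + (?c\<^sup>2 + 4 * pi\<^sup>2 * a)) * 1 \<le> (?c + (?c\<^sup>2 + 4 * pi\<^sup>2 * a)) * (1 + y\<^sup>2)"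
        using c by (intro mult_left_mono) auto
      then show ?thesis using that by simp
    qed
    show "\<bar>- (?c * sin (2 * pi * y)) * bump a y\<bar> \<le> (?c + (?c\<^sup>2 + 4 * pi\<^sup>2 * a)) * (1 + y\<^sup>2)" for y
      using 1[of y] c by (intro up) argo
    show "\<bar>(?c\<^sup>2 * (sin (2 * pi * y))\<^sup>2 - 4 * pi\<^sup>2 * a * cos (2 * pi * y)) * bump a y\<bar> \<le>
        (?c + (?c\<^sup>2 + 4 * pi\<^sup>2 * a)) * (1 + y\<^sup>2)" for y
      using 2[of y] c by (intro up) argo
  qed (rule bump_minus)
  then show ?thesis ..
qed

lemma chain_value_bump: "chain_value (bump a) k x = bump a x"
  using bump_add_int[of a x 1] bump_add_int[of a "- x" 1] bump_minus[of a x]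
  by (simp add: chain_value_def add.commute)

lemma gauss_bump_tendsto:
  assumes s: "0 < s"
  shows "(\<lambda>m. \<integral>y. bump (real m) y \<partial>gauss s) \<longlonglongrightarrow> 0"
proof -
  interpret prob_space "gauss s" by (rule prob_space_gauss[OF s])
  have "(\<lambda>m. \<integral>y. bump (real m) y \<partial>gauss s) \<longlonglongrightarrow> (\<integral>y. 0 \<partial>gauss s)"
  proof (rule integral_dominated_convergence[where w = "\<lambda>_. 1"])
    show "bump (real m) \<in> borel_measurable (gauss s)" for m unfolding bump_def[abs_def] by measurable
    show "AE y in gauss s. (\<lambda>m. bump (real m) y) \<longlonglongrightarrow> 0"
      using AE_gauss_not_Ints
    proof eventually_elim
      case (elim y)
      have "cos (2 * pi * y) \<noteq> 1"
      proof
        assume "cos (2 * pi * y) = 1"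
        then obtain x :: int where "2 * pi * y = of_int x * 2 * pi" using cos_one_2pi_int by blast
        then have "y = of_int x" by simp
        then show False using elim by simp
      qed
      then have p: "0 < 1 - cos (2 * pi * y)" using cos_le_one[of "2 * pi * y"] by linarith
      have "bump (real m) y = exp (- (1 - cos (2 * pi * y))) ^ m" for m
        unfolding bump_def exp_of_nat_mult[symmetric] by (simp only: mult_minus_right)
      then show ?case using p by (simp add: LIMSEQ_realpow_zero)
    qed
    show "AE y in gauss s. norm (bump (real m) y) \<le> 1" for m
      using bump_bounds[of "real m"] by (intro AE_I2) (auto simp: abs_of_pos)
  qed auto
  then show ?thesis by simp
qed

text \<open>The terminal value of the problem, 0 in even and 2 in odd phases, jumps across a switch, so
  it is not compatible. It is approximated by a profile away from the threshold, and near the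
  threshold the error is dominated by a compatible bump of small expectation.\<close>

lemma terminal_approx:
  assumes s: "0 < s" and e: "0 < e"
  shows "\<exists>r a. 0 \<le> r \<and> r < 1 \<and> 0 \<le> a \<and>
    (\<forall>k x. 0 \<le> x \<longrightarrow> x \<le> 1 \<longrightarrow> \<bar>chain_value (profile r) k x - 2 * of_bool (odd k)\<bar> \<le> e + 24 * bump a x) \<and>
    \<bar>(\<integral>y. profile r y \<partial>gauss s) - (\<integral>y. step_profile y \<partial>gauss s)\<bar> \<le> e \<and> (\<integral>y. bump a y \<partial>gauss s) \<le> e"
proof -
  have "eventually (\<lambda>m. (\<integral>y. bump (real m) y \<partial>gauss s) < e) sequentially"
    by (rule order_tendstoD(2)[OF gauss_bump_tendsto[OF s] e])
  then obtain m where m: "(\<integral>y. bump (real m) y \<partial>gauss s) < e"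
    by (meson eventually_happens sequentially_bot)
  define a where "a = real m"
  have "isCont (bump a) 1" unfolding bump_def[abs_def] by (intro continuous_intros)
  moreover have "bump a 1 = 1" using bump_add_int[of a 0 1] by (simp add: bump_def)
  ultimately have "\<exists>d>0. \<forall>x. dist x 1 < d \<longrightarrow> dist (bump a x) 1 < 1 / 2"
    unfolding continuous_at_eps_delta by (metis half_gt_zero zero_less_one)
  then obtain d0 where d0: "d0 > 0" "\<And>x. dist x 1 < d0 \<Longrightarrow> dist (bump a x) 1 < 1 / 2" by blast
  \<comment> \<open>Chosen after \<open>a\<close>, so that the bump exceeds 1/2 within
    \<open>d\<close> of the threshold, and before the radius. The divisors 16 and 20 allot
    \<open>e / 4\<close> to each of \<open>4 * d\<close> and \<open>5 * p\<close> in
    \<open>profile_near\<close>.\<close>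
  define d where "d = min (min (1 / 2) (d0 / 2)) (e / 16)"
  have d: "0 < d" "d \<le> 1 / 2" "d < d0" "4 * d \<le> e / 4" using d0 e by (auto simp: d_def min_def)
  have "cos (pi * d) < 1" using d pi_gt_zero cos_monotone_0_pi[of 0 "pi * d"] mult_left_mono[of d 1 pi] by auto
  then have "eventually (\<lambda>m. poisson_ker (radius m) (cos (pi * d)) < e / 20) sequentially"
    using radius_poisson e by (intro order_tendstoD(2)[where a = "e / 20"]) auto
  moreover have "eventually (\<lambda>m. \<bar>profile (radius m) 0\<bar> < e / 4) sequentially"
    using tendstoD[OF profile_0_tendsto, of "e / 4"] e by (simp add: dist_real_def)
  moreover have "eventually (\<lambda>m. \<bar>profile (radius m) 1 - 2\<bar> < e / 4) sequentially"
    using tendstoD[OF profile_1_tendsto, of "e / 4"] e by (simp add: dist_real_def)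
  moreover have "eventually (\<lambda>m. \<bar>(\<integral>y. profile (radius m) y \<partial>gauss s) - (\<integral>y. step_profile y \<partial>gauss s)\<bar> < e) sequentially"
    using gauss_profile_tendsto[OF s] e by (auto simp: tendsto_iff dist_real_def)
  ultimately have "eventually (\<lambda>m. poisson_ker (radius m) (cos (pi * d)) < e / 20 \<and> \<bar>profile (radius m) 0\<bar> < e / 4 \<and>
     \<bar>profile (radius m) 1 - 2\<bar> < e / 4 \<and>
     \<bar>(\<integral>y. profile (radius m) y \<partial>gauss s) - (\<integral>y. step_profile y \<partial>gauss s)\<bar> < e) sequentially"
    by (intro eventually_conj)
  from eventually_happens'[OF sequentially_bot this] obtain j where j: "poisson_ker (radius j) (cos (pi * d)) < e / 20" "\<bar>profile (radius j) 0\<bar> < e / 4"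
     "\<bar>profile (radius j) 1 - 2\<bar> < e / 4"
     "\<bar>(\<integral>y. profile (radius j) y \<partial>gauss s) - (\<integral>y. step_profile y \<partial>gauss s)\<bar> < e"
    by (elim exE conjE)
  define r where "r = radius j"
  have r: "0 \<le> r" "1 / 4 \<le> r" "r < 1" using radius by (auto simp: r_def)
  have up0: "upper_profile r 0 = profile r 1" by (simp add: upper_profile_def)
  have val: "chain_value (profile r) k x = (if even k then profile r x else upper_profile r x)" for k x
    by (simp add: chain_value_def upper_profile_def)
  have "\<bar>chain_value (profile r) k x - 2 * of_bool (odd k)\<bar> \<le> e + 24 * bump a x" if x: "0 \<le> x" "x \<le> 1" for k x
  proof (cases "x \<le> 1 - d")
    case True
    note n = profile_near[OF r(2,3) d(1,2) x(1) True]
    have "\<bar>profile r x\<bar> \<le> e" using n(1) j(1,2) d(4) unfolding r_def[symmetric] abs_le_iff abs_less_iff by argo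
    moreover have "\<bar>upper_profile r x - 2\<bar> \<le> e"
      using n(2) j(1,3) d(4) unfolding r_def[symmetric] up0 abs_le_iff abs_less_iff by argo
    ultimately have "\<bar>chain_value (profile r) k x - 2 * of_bool (odd k)\<bar> \<le> e" by (simp add: val)
    then show ?thesis using bump_bounds(1)[of a x] by (simp add: a_def)
  next
    case False
    have "dist x 1 < d0" using False x d by (simp add: dist_real_def)
    then have "\<bar>bump a x - 1\<bar> < 1 / 2" using d0(2) by (simp add: dist_real_def)
    then have "1 / 2 < bump a x" unfolding abs_less_iff by argo
    \<comment> \<open>The crude bound 6 + 2 near the threshold, where the bump is above 1/2, lies
      below 24 times the bump.\<close>
    moreover have "\<bar>chain_value (profile r) k x - 2 * of_bool (odd k)\<bar> \<le> 8"
      unfolding val using abs_profile_le[OF r(1,3) x] by (auto simp: abs_le_iff)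
    ultimately show ?thesis using e by linarith
  qed
  moreover have "0 \<le> a" by (simp add: a_def)
  ultimately show ?thesis using r j(4) m unfolding r_def[symmetric] a_def[symmetric]
    by (intro exI[of _ r] exI[of _ a]) auto
qed

text \<open>Two uses of \<open>chain_expectation\<close>: for the profile, and for the bump, whose
  mean at the final level is carried over to the Gaussian endpoint. The tolerances add up to
  \<open>e\<close> for the payoff, \<open>24 * e\<close> for the bump and \<open>e\<close> for the
  Abel mean.\<close>

lemma (in gaussian_walk) expected_count:
  assumes s1: "s \<le> 1" and \<sigma>: "0 < \<sigma>" and S: "distr M borel (\<lambda>\<omega>. \<Sum>i<n. \<xi> i \<omega>) = gauss \<sigma>"
    and r: "0 \<le> r" "r < 1" and a: "0 \<le> a"
    and C: "compatible 1 C (profile r)" and C': "compatible 0 C' (bump a)"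
    and e: "\<And>k x. 0 \<le> x \<Longrightarrow> x \<le> 1 \<Longrightarrow> \<bar>chain_value (profile r) k x - 2 * of_bool (odd k)\<bar> \<le> e + 24 * bump a x"
      "\<bar>(\<integral>y. profile r y \<partial>gauss \<sigma>) - (\<integral>y. step_profile y \<partial>gauss \<sigma>)\<bar> \<le> e" "(\<integral>y. bump a y \<partial>gauss \<sigma>) \<le> e"
  defines "v \<equiv> real n * s\<^sup>2"
  shows "\<bar>(\<integral>\<omega>. real (phase n \<omega> div 2) + 2 * of_bool (odd (phase n \<omega>)) \<partial>M) - (\<integral>y. step_profile y \<partial>gauss \<sigma>)\<bar>
     \<le> 26 * e + (C + 24 * C') * exp v * ((1 + 25 * v) * sqrt s)"
proof -
  let ?q = "exp v * ((1 + 25 * v) * sqrt s)"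
  have mS: "(\<lambda>\<omega>. \<Sum>i<n. \<xi> i \<omega>) \<in> borel_measurable M" using measurable_\<xi> by (intro borel_measurable_sum) auto
  have law_S: "(\<integral>\<omega>. f (\<Sum>i<n. \<xi> i \<omega>) \<partial>M) = (\<integral>y. f y \<partial>gauss \<sigma>)" if "f \<in> borel_measurable borel" for f :: "real \<Rightarrow> real"
    unfolding S[symmetric] by (rule integral_distr[OF mS that, symmetric])
  have 1: "\<bar>(\<integral>\<omega>. gain 1 (profile r) n \<omega> \<partial>M) - (\<integral>y. profile r y \<partial>gauss \<sigma>)\<bar> \<le> C * ?q"
    using chain_expectation[OF C s1] law_S[OF compatibleD(1)[OF C]] by (simp add: v_def mult.assoc)
  have 2: "\<bar>(\<integral>\<omega>. bump a (level n \<omega>) \<partial>M) - (\<integral>y. bump a y \<partial>gauss \<sigma>)\<bar> \<le> C' * ?q"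
    using chain_expectation[OF C' s1] law_S[OF compatibleD(1)[OF C']]
    by (simp add: v_def mult.assoc gain_def chain_value_bump)
  have ib: "integrable M (\<lambda>\<omega>. bump a (level n \<omega>))"
    using integrable_gain(3)[OF C' order_refl] by (simp add: chain_value_bump)
  have io: "integrable M (\<lambda>\<omega>. 2 * of_bool (odd (phase n \<omega>)) :: real)"
    by (rule integrable_level_bounded[OF order_refl, of "\<lambda>k _. 2 * of_bool (odd k)" 2]) auto
  have ig: "integrable M (gain 1 (profile r) n)" by (rule integrable_gain(1)[OF C order_refl])
  have iF: "integrable M (\<lambda>\<omega>. real (phase n \<omega> div 2) + 2 * of_bool (odd (phase n \<omega>)))"
    using integrable_gain(2)[OF C order_refl] io by (rule Bochner_Integration.integrable_add)
  have eq: "(\<integral>\<omega>. real (phase n \<omega> div 2) + 2 * of_bool (odd (phase n \<omega>)) \<partial>M) - (\<integral>\<omega>. gain 1 (profile r) n \<omega> \<partial>M) =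
      (\<integral>\<omega>. real (phase n \<omega> div 2) + 2 * of_bool (odd (phase n \<omega>)) - gain 1 (profile r) n \<omega> \<partial>M)"
    by (rule Bochner_Integration.integral_diff[symmetric, OF iF ig])
  have "\<bar>(\<integral>\<omega>. real (phase n \<omega> div 2) + 2 * of_bool (odd (phase n \<omega>)) \<partial>M) - (\<integral>\<omega>. gain 1 (profile r) n \<omega> \<partial>M)\<bar>
      \<le> (\<integral>\<omega>. \<bar>real (phase n \<omega> div 2) + 2 * of_bool (odd (phase n \<omega>)) - gain 1 (profile r) n \<omega>\<bar> \<partial>M)"
    unfolding eq by (rule integral_abs_bound)
  also have "\<dots> \<le> (\<integral>\<omega>. e + 24 * bump a (level n \<omega>) \<partial>M)"
  proof (rule integral_mono)
    show "integrable M (\<lambda>\<omega>. \<bar>real (phase n \<omega> div 2) + 2 * of_bool (odd (phase n \<omega>)) - gain 1 (profile r) n \<omega>\<bar>)"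
      by (rule integrable_abs[OF Bochner_Integration.integrable_diff[OF iF ig]])
    show "integrable M (\<lambda>\<omega>. e + 24 * bump a (level n \<omega>))" using ib by simp
    show "\<bar>real (phase n \<omega> div 2) + 2 * of_bool (odd (phase n \<omega>)) - gain 1 (profile r) n \<omega>\<bar> \<le> e + 24 * bump a (level n \<omega>)" for \<omega>
      using e(1)[OF snd_chain_bounds, of "phase n \<omega>" "\<lambda>i. \<xi> i \<omega>" n]
      unfolding gain_def abs_le_iff by argo
  qed
  also have "\<dots> = e + 24 * (\<integral>\<omega>. bump a (level n \<omega>) \<partial>M)" using ib prob_space by simp
  finally have 3: "\<bar>(\<integral>\<omega>. real (phase n \<omega> div 2) + 2 * of_bool (odd (phase n \<omega>)) \<partial>M) - (\<integral>\<omega>. gain 1 (profile r) n \<omega> \<partial>M)\<bar>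
      \<le> e + 24 * (\<integral>\<omega>. bump a (level n \<omega>) \<partial>M)" .
  have 4: "(C + 24 * C') * exp v * ((1 + 25 * v) * sqrt s) = C * ?q + 24 * (C' * ?q)" by (simp add: algebra_simps)
  show ?thesis unfolding 4 using 1 2 3 e(2,3) unfolding abs_le_iff by argo
qed

section \<open>Brownian motion on grids and the limit\<close>

lemma grid_sum:
  assumes "0 < n" shows "(\<Sum>i<n. grid_incr b t \<epsilon> n i) = (b t - b 0) / \<epsilon>"
proof -
  have "(\<Sum>i<k. grid_incr b t \<epsilon> n i) = (b (t * real k / real n) - b 0) / \<epsilon>" for k
    by (induction k) (auto simp: grid_incr_def add_divide_distrib[symmetric] simp del: of_nat_Suc)
  from this[of n] show ?thesis using assms by simp
qed

context standard_brownian_motion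
begin

lemma scaled_increment_law:
  assumes "0 \<le> r" "r < u" "0 < \<epsilon>"
  shows "distr M borel (\<lambda>\<omega>. (B u \<omega> - B r \<omega>) / \<epsilon>) = gauss (sqrt (u - r) / \<epsilon>)"
proof -
  have "distributed M lborel (\<lambda>x. 0 + 1 / \<epsilon> * (B u x - B r x)) (normal_density (0 + 1 / \<epsilon> * 0) (\<bar>1 / \<epsilon>\<bar> * sqrt (u - r)))"
    using assms by (intro normal_density_affine gaussian_increments) auto
  then have "distributed M lborel (\<lambda>\<omega>. (B u \<omega> - B r \<omega>) / \<epsilon>) (normal_density 0 (sqrt (u - r) / \<epsilon>))"
    using assms by simp
  then show ?thesis by (rule distr_eq_gauss)
qed

lemma gaussian_walk_grid:
  assumes t: "0 < t" and \<epsilon>: "0 < \<epsilon>" and n: "0 < n"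
  shows "gaussian_walk M (\<lambda>i \<omega>. grid_incr (\<lambda>s. B s \<omega>) t \<epsilon> n i) n (sqrt (t / real n) / \<epsilon>)"
proof
  show "0 < sqrt (t / real n) / \<epsilon>" using assms by simp
  let ?\<tau> = "\<lambda>i. t * real i / real n"
  have "indep_vars (\<lambda>_. borel) (\<lambda>i \<omega>. B (?\<tau> (Suc i)) \<omega> - B (?\<tau> i) \<omega>) {..<n}"
    by (rule independent_increments[where \<tau> = ?\<tau>]) (use assms in \<open>auto intro!: divide_right_mono mult_left_mono\<close>)
  from indep_vars_compose2[OF this, of "\<lambda>_ x. x / \<epsilon>" "\<lambda>_. borel"]
  show "indep_vars (\<lambda>_. borel) (\<lambda>i \<omega>. grid_incr (\<lambda>s. B s \<omega>) t \<epsilon> n i) {..<n}"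
    by (simp add: grid_incr_def)
  fix i
  have d: "?\<tau> (Suc i) - ?\<tau> i = t / real n" by (simp add: diff_divide_distrib[symmetric] algebra_simps)
  have "?\<tau> i < ?\<tau> (Suc i)" using assms by (intro divide_strict_right_mono mult_strict_left_mono) auto
  then show "distr M borel (\<lambda>\<omega>. grid_incr (\<lambda>s. B s \<omega>) t \<epsilon> n i) = gauss (sqrt (t / real n) / \<epsilon>)"
    using scaled_increment_law[of "?\<tau> i" "?\<tau> (Suc i)" \<epsilon>] assms unfolding d grid_incr_def by simp
qed

lemma grid_count_expectation:
  assumes t: "0 < t" and \<epsilon>: "0 < \<epsilon>" and n: "0 < n"
  defines "phase \<equiv> \<lambda>\<omega>. fst (chain (\<lambda>i. grid_incr (\<lambda>s. B s \<omega>) t \<epsilon> n i) n)"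
  shows "(\<integral>\<omega>. real (grid_count (\<lambda>s. B s \<omega>) t \<epsilon> n) \<partial>M) = (\<integral>\<omega>. real (phase \<omega> div 2) + 2 * of_bool (odd (phase \<omega>)) \<partial>M)"
    "integrable M (\<lambda>\<omega>. real (grid_count (\<lambda>s. B s \<omega>) t \<epsilon> n))"
proof -
  interpret W: gaussian_walk M "\<lambda>i \<omega>. grid_incr (\<lambda>s. B s \<omega>) t \<epsilon> n i" n "sqrt (t / real n) / \<epsilon>"
    by (rule gaussian_walk_grid[OF t \<epsilon> n])
  let ?phase' = "\<lambda>\<omega>. fst (chain (\<lambda>i. - grid_incr (\<lambda>s. B s \<omega>) t \<epsilon> n i) n)"
  have g: "real (grid_count (\<lambda>s. B s \<omega>) t \<epsilon> n) = real (phase \<omega> div 2) + (of_bool (odd (phase \<omega>)) + of_bool (odd (?phase' \<omega>)))" for \<omega>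
    unfolding grid_count_def phase_def of_nat_add of_nat_of_bool
    by (subst chain_range[where s = "\<lambda>j. B (t * real j / real n) \<omega> / \<epsilon>"]) (rule grid_incr_Suc, rule refl)
  have i1: "integrable M (\<lambda>\<omega>. real (phase \<omega> div 2))"
    unfolding phase_def by (rule W.integrable_gain(2)[OF compatible_const order_refl])
  have i2: "integrable M (\<lambda>\<omega>. of_bool (odd (phase \<omega>)) :: real)" unfolding phase_def
    by (rule W.integrable_level_bounded[OF order_refl, of "\<lambda>k _. of_bool (odd k)" 1]) auto
  have i3: "integrable M (\<lambda>\<omega>. of_bool (odd (?phase' \<omega>)) :: real)"
  proof (rule integrable_const_bound[where B = 1])
    have "(\<lambda>\<omega>. \<lambda>i\<in>{..<n}. - grid_incr (\<lambda>s. B s \<omega>) t \<epsilon> n i) \<in> M \<rightarrow>\<^sub>M PiM {..<n} (\<lambda>_. borel)"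
      using W.measurable_\<xi> by (intro measurable_restrict borel_measurable_uminus) auto
    from measurable_compose[OF this measurable_chain[OF order_refl]]
    have "(\<lambda>\<omega>. chain (\<lambda>i. - grid_incr (\<lambda>s. B s \<omega>) t \<epsilon> n i) n) \<in> M \<rightarrow>\<^sub>M count_space UNIV \<Otimes>\<^sub>M borel"
      by (rule measurable_cong[THEN iffD1, rotated]) (rule chain_cong, simp)
    then show "(\<lambda>\<omega>. of_bool (odd (?phase' \<omega>)) :: real) \<in> borel_measurable M" by measurable
  qed auto
  show "integrable M (\<lambda>\<omega>. real (grid_count (\<lambda>s. B s \<omega>) t \<epsilon> n))"
    unfolding g using i1 i2 i3 by simp
  show "(\<integral>\<omega>. real (grid_count (\<lambda>s. B s \<omega>) t \<epsilon> n) \<partial>M) = (\<integral>\<omega>. real (phase \<omega> div 2) + 2 * of_bool (odd (phase \<omega>)) \<partial>M)"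
    unfolding g using i1 i2 i3 W.phase_symmetric[OF n] by (simp add: phase_def)
qed

lemma grid_count_tendsto:
  assumes t: "0 < t" and \<epsilon>: "0 < \<epsilon>"
  shows "(\<lambda>n. \<integral>\<omega>. real (grid_count (\<lambda>s. B s \<omega>) t \<epsilon> n) \<partial>M) \<longlonglongrightarrow> (\<integral>y. step_profile y \<partial>gauss (sqrt t / \<epsilon>))"
proof (rule tendstoI)
  fix e0 :: real assume e0: "0 < e0"
  define \<sigma> where "\<sigma> = sqrt t / \<epsilon>"
  have \<sigma>: "0 < \<sigma>" using assms by (simp add: \<sigma>_def)
  \<comment> \<open>So that the \<open>26 * e\<close> of \<open>expected_count\<close> is half of
    \<open>e0\<close>.\<close>
  define e where "e = e0 / 52"
  have e: "0 < e" using e0 by (simp add: e_def)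
  \<comment> \<open>These and the constants \<open>C\<close>, \<open>C'\<close> do not depend on the
    grid: refining it keeps the variance of the endpoint and sends only the step size to 0.\<close>
  obtain r a where ra: "0 \<le> r" "r < 1" "0 \<le> a"
    "\<And>k x. 0 \<le> x \<Longrightarrow> x \<le> 1 \<Longrightarrow> \<bar>chain_value (profile r) k x - 2 * of_bool (odd k)\<bar> \<le> e + 24 * bump a x"
    "\<bar>(\<integral>y. profile r y \<partial>gauss \<sigma>) - (\<integral>y. step_profile y \<partial>gauss \<sigma>)\<bar> \<le> e" "(\<integral>y. bump a y \<partial>gauss \<sigma>) \<le> e"
    using terminal_approx[OF \<sigma> e] by blast
  obtain C where C: "compatible 1 C (profile r)" using compatible_profile[OF ra(1,2)] by blast
  obtain C' where C': "compatible 0 C' (bump a)" using compatible_bump[OF ra(3)] by blast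
  let ?s = "\<lambda>n. sqrt (t / real n) / \<epsilon>"
  let ?b = "\<lambda>n. (C + 24 * C') * exp (\<sigma>\<^sup>2) * ((1 + 25 * \<sigma>\<^sup>2) * sqrt (?s n))"
  have s0: "?s \<longlonglongrightarrow> 0" using assms by real_asymp
  have "(\<lambda>n. sqrt (?s n)) \<longlonglongrightarrow> sqrt 0" by (intro tendsto_real_sqrt s0)
  then have "?b \<longlonglongrightarrow> (C + 24 * C') * exp (\<sigma>\<^sup>2) * ((1 + 25 * \<sigma>\<^sup>2) * sqrt 0)" by (intro tendsto_mult_left)
  then have "eventually (\<lambda>n. ?b n < e0 / 2) sequentially"
    using e0 by (intro order_tendstoD(2)) auto
  moreover have "eventually (\<lambda>n. ?s n < 1) sequentially" by (rule order_tendstoD(2)[OF s0]) simp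
  moreover have "eventually (\<lambda>n. 0 < n) sequentially" by (rule eventually_gt_at_top)
  ultimately show "eventually (\<lambda>n. dist (\<integral>\<omega>. real (grid_count (\<lambda>s. B s \<omega>) t \<epsilon> n) \<partial>M) (\<integral>y. step_profile y \<partial>gauss (sqrt t / \<epsilon>)) < e0) sequentially"
  proof eventually_elim
    case (elim n)
    interpret W: gaussian_walk M "\<lambda>i \<omega>. grid_incr (\<lambda>s. B s \<omega>) t \<epsilon> n i" n "?s n"
      by (rule gaussian_walk_grid[OF t \<epsilon> elim(3)])
    have v: "real n * (?s n)\<^sup>2 = \<sigma>\<^sup>2" using t \<epsilon> elim(3) by (simp add: \<sigma>_def power_divide)
    have "distr M borel (\<lambda>\<omega>. \<Sum>i<n. grid_incr (\<lambda>s. B s \<omega>) t \<epsilon> n i) = gauss \<sigma>"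
      unfolding grid_sum[OF elim(3)] \<sigma>_def using scaled_increment_law[of 0 t \<epsilon>] t \<epsilon> by simp
    from W.expected_count[OF less_imp_le[OF elim(2)] \<sigma> this ra(1-3) C C' ra(4-6)]
    have "\<bar>(\<integral>\<omega>. real (grid_count (\<lambda>s. B s \<omega>) t \<epsilon> n) \<partial>M) - (\<integral>y. step_profile y \<partial>gauss \<sigma>)\<bar> \<le> 26 * e + ?b n"
      unfolding grid_count_expectation(1)[OF t \<epsilon> elim(3)] v .
    also have "\<dots> < e0" using elim(1) by (simp add: e_def)
    finally show ?case unfolding dist_real_def \<sigma>_def .
  qed
qed

text \<open>The lower bound compares at threshold \<open>\<epsilon>\<close> for every grid. The
  upper bound has to go through smaller thresholds and gives integrability on the way; continuity in
  the threshold joins the two.\<close>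

lemma bar_count_expectation:
  assumes t: "0 < t" and \<epsilon>: "0 < \<epsilon>"
  shows "integrable M (\<lambda>\<omega>. real (bar_count (\<lambda>s. B s \<omega>) \<epsilon> t))"
    "(\<integral>\<omega>. real (bar_count (\<lambda>s. B s \<omega>) \<epsilon> t) \<partial>M) = (\<integral>y. step_profile y \<partial>gauss (sqrt t / \<epsilon>))"
proof -
  let ?N = "\<lambda>\<omega>. real (bar_count (\<lambda>s. B s \<omega>) \<epsilon> t)"
  let ?G = "\<lambda>\<epsilon> n \<omega>. real (grid_count (\<lambda>s. B s \<omega>) t \<epsilon> n)"
  let ?\<Psi> = "\<lambda>\<epsilon>. \<integral>y. step_profile y \<partial>gauss (sqrt t / \<epsilon>)"
  have [measurable]: "?N \<in> borel_measurable M"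
    by (rule measurable_bar_count[OF measurable_B continuous_paths t \<epsilon>])
  have up: "(\<integral>\<^sup>+\<omega>. ennreal (?N \<omega>) \<partial>M) \<le> ennreal (?\<Psi> \<epsilon>')" if \<epsilon>': "0 < \<epsilon>'" "\<epsilon>' < \<epsilon>" for \<epsilon>'
  proof -
    have [measurable]: "(\<lambda>\<omega>. ?G \<epsilon>' (Suc n) \<omega>) \<in> borel_measurable M" for n
      using grid_count_expectation(2)[OF t \<epsilon>'(1), of "Suc n"] by auto
    \<comment> \<open>Fatou is needed because the index from which the grid count dominates depends
      on the path. \<open>Suc n\<close> avoids the empty grid.\<close>
    have "(\<integral>\<^sup>+\<omega>. ennreal (?N \<omega>) \<partial>M) \<le> (\<integral>\<^sup>+\<omega>. liminf (\<lambda>n. ennreal (?G \<epsilon>' (Suc n) \<omega>)) \<partial>M)"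
    proof (rule nn_integral_mono)
      fix \<omega> assume "\<omega> \<in> space M"
      from bar_count_le_grid_count[OF continuous_paths[OF this] t \<epsilon>']
      have "eventually (\<lambda>n. bar_count (\<lambda>s. B s \<omega>) \<epsilon> t \<le> grid_count (\<lambda>s. B s \<omega>) t \<epsilon>' (Suc n)) sequentially"
        by (rule eventually_sequentially_Suc[THEN iffD2])
      then show "ennreal (?N \<omega>) \<le> liminf (\<lambda>n. ennreal (?G \<epsilon>' (Suc n) \<omega>))"
        by (intro Liminf_bounded) (auto elim!: eventually_mono intro: ennreal_leI)
    qed
    also have "\<dots> \<le> liminf (\<lambda>n. \<integral>\<^sup>+\<omega>. ennreal (?G \<epsilon>' (Suc n) \<omega>) \<partial>M)"
      by (rule nn_integral_liminf) measurable
    also have "\<dots> = liminf (\<lambda>n. ennreal (\<integral>\<omega>. ?G \<epsilon>' (Suc n) \<omega> \<partial>M))"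
      using grid_count_expectation(2)[OF t \<epsilon>'(1)] by (simp add: nn_integral_eq_integral)
    also have "\<dots> = ennreal (?\<Psi> \<epsilon>')"
      by (intro lim_imp_Liminf tendsto_ennrealI LIMSEQ_Suc grid_count_tendsto t \<epsilon>' sequentially_bot)
    finally show ?thesis .
  qed
  have h: "0 < \<epsilon> / 2" "\<epsilon> / 2 < \<epsilon>" using \<epsilon> by auto
  show int: "integrable M ?N"
  proof (rule integrableI_nonneg)
    show "(\<integral>\<^sup>+\<omega>. ennreal (?N \<omega>) \<partial>M) < \<infinity>"
      using up[OF h] by (rule order_le_less_trans) simp
  qed auto
  \<comment> \<open>Allows the upper bound to pass from extended nonnegative to real
    numbers.\<close>
  have pos: "0 \<le> ?\<Psi> \<epsilon>'" if "0 < \<epsilon>'" for \<epsilon>'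
    by (rule tendsto_lowerbound[OF grid_count_tendsto[OF t that]]) auto
  have up': "(\<integral>\<omega>. ?N \<omega> \<partial>M) \<le> ?\<Psi> \<epsilon>'" if \<epsilon>': "0 < \<epsilon>'" "\<epsilon>' < \<epsilon>" for \<epsilon>'
    using up[OF \<epsilon>'] pos[OF \<epsilon>'(1)] int by (simp add: nn_integral_eq_integral)
  \<comment> \<open>Positive thresholds increasing to \<open>\<epsilon>\<close> from strictly
    below.\<close>
  define E where "E j = \<epsilon> * (1 - 1 / (real j + 2))" for j :: nat
  have E: "0 < E j" "E j < \<epsilon>" for j using \<epsilon> by (auto simp: E_def field_simps add_pos_nonneg)
  have "E \<longlonglongrightarrow> \<epsilon> * (1 - 0)"
    unfolding E_def by (intro tendsto_intros) real_asymp
  then have "(\<lambda>j. ?\<Psi> (E j)) \<longlonglongrightarrow> ?\<Psi> \<epsilon>"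
    using E t \<epsilon> by (intro gauss_step_profile_continuous tendsto_divide tendsto_const) auto
  then have "(\<integral>\<omega>. ?N \<omega> \<partial>M) \<le> ?\<Psi> \<epsilon>" by (rule tendsto_lowerbound) (use up' E in auto)
  moreover have "?\<Psi> \<epsilon> \<le> (\<integral>\<omega>. ?N \<omega> \<partial>M)"
  proof (rule tendsto_upperbound[OF LIMSEQ_Suc[OF grid_count_tendsto[OF t \<epsilon>]]])
    show "eventually (\<lambda>n. (\<integral>\<omega>. ?G \<epsilon> (Suc n) \<omega> \<partial>M) \<le> (\<integral>\<omega>. ?N \<omega> \<partial>M)) sequentially"
      using grid_count_le_bar_count[OF continuous_paths t \<epsilon>] grid_count_expectation(2)[OF t \<epsilon>] int
      by (intro always_eventually allI integral_mono) auto
  qed simp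
  ultimately show "(\<integral>\<omega>. ?N \<omega> \<partial>M) = ?\<Psi> \<epsilon>" by (rule antisym)
qed

end

text \<open>Both formulas expand one number, the mean of \<open>step_profile\<close> under a
  Gaussian of standard deviation \<open>sqrt t / \<epsilon>\<close>: by its jumps, and by the
  trigonometric series, where \<open>series_term\<close> is twice
  \<open>small_eps_term\<close>.\<close>

theorem proposition4p4:
  fixes M :: "'a measure" and B :: "real \<Rightarrow> 'a \<Rightarrow> real" and t \<epsilon> :: real
  assumes "standard_brownian_motion M B" and "t > 0" and "\<epsilon> > 0"
  shows "integrable M (\<lambda>\<omega>. real (bar_count (\<lambda>s. B s \<omega>) \<epsilon> t)) \<and>
     summable (\<lambda>k. large_eps_term \<epsilon> t (Suc k)) \<and>
     prob_space.expectation M (\<lambda>\<omega>. real (bar_count (\<lambda>s. B s \<omega>) \<epsilon> t)) =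
           4 * (\<Sum>k. large_eps_term \<epsilon> t (Suc k)) \<and>
     summable (\<lambda>k. small_eps_term \<epsilon> t (Suc k)) \<and>
     prob_space.expectation M (\<lambda>\<omega>. real (bar_count (\<lambda>s. B s \<omega>) \<epsilon> t)) =
           t / (2 * \<epsilon>\<^sup>2) + 2 / 3 + 2 * (\<Sum>k. small_eps_term \<epsilon> t (Suc k))"
proof -
  interpret standard_brownian_motion M B by (rule assms(1))
  note N = bar_count_expectation[OF assms(2,3)]
  define s where "s = sqrt t / \<epsilon>"
  have s: "0 < s" using assms by (simp add: s_def)
  have s2: "s\<^sup>2 = t / \<epsilon>\<^sup>2" using assms by (simp add: s_def power_divide)
  have "x / (s * sqrt 2) = x * \<epsilon> / sqrt (2 * t)" for x
    using assms by (simp add: s_def real_sqrt_mult mult.commute)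
  then have L: "(\<lambda>i. 4 * large_eps_term \<epsilon> t (Suc i)) sums (\<integral>y. step_profile y \<partial>gauss s)"
    using gauss_step_profile_sums(1)[OF s] by (simp add: large_eps_term_def algebra_simps)
  then have Ls: "summable (\<lambda>i. large_eps_term \<epsilon> t (Suc i))"
    using summable_mult_D[of 4] by (auto simp: sums_iff)
  have S: "series_term s (Suc i) = 2 * small_eps_term \<epsilon> t (Suc i)" for i
  proof -
    define k where "k = real (Suc i)"
    have k: "k \<noteq> 0" by (simp add: k_def)
    have e: "- (pi * k * s)\<^sup>2 / 2 = - (pi\<^sup>2 * k\<^sup>2 * t / (2 * \<epsilon>\<^sup>2))" by (simp add: power_mult_distrib s2)
    have f: "1 / (pi * k)\<^sup>2 + s\<^sup>2 = t / \<epsilon>\<^sup>2 * (1 + \<epsilon>\<^sup>2 / (pi\<^sup>2 * k\<^sup>2 * t))"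
      using assms k by (simp add: s2 power_mult_distrib field_simps)
    have "2 * (2 * q - 1) * (x * (t / \<epsilon>\<^sup>2 * d)) = 2 * ((2 * q - 1) * (t * x / \<epsilon>\<^sup>2) * d)" for q x d :: real
      by (simp add: algebra_simps)
    then show ?thesis
      unfolding series_term_def small_eps_term_def wave_coeff_def k_def[symmetric] e f by blast
  qed
  have Ss: "summable (\<lambda>i. small_eps_term \<epsilon> t (Suc i))"
    using summable_mult_D[of 2] summable_series_term[of s] unfolding S by auto
  have "(\<integral>y. step_profile y \<partial>gauss s) = t / (2 * \<epsilon>\<^sup>2) + 2 / 3 + 2 * (\<Sum>k. small_eps_term \<epsilon> t (Suc k))"
    unfolding gauss_step_profile_eq[OF s] S suminf_mult[OF Ss] s2 by simp
  moreover have "(\<integral>y. step_profile y \<partial>gauss s) = 4 * (\<Sum>k. large_eps_term \<epsilon> t (Suc k))"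
    using L suminf_mult[OF Ls] by (simp add: sums_iff)
  ultimately show ?thesis using N Ls Ss unfolding s_def by simp
qed

end
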